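(* Let $\beta,\gamma_0,\gamma$ satisfy $0<\beta<\frac{\pi}{2}$, $0<\gamma_0<2\sin\left(\frac{\beta}{2}\right)$ and $\gamma=2\arcsin\left(\frac{\gamma_0}{2}\right)<\beta$. Suppose that there exists an index $i_*\in[N]$ such that $R_{i_*}^0\in B_{\gamma_0}$, that $R_i^0\in B_{\Gamma_i(\gamma)}$ for all $i\in[N]$, where $$\Gamma_i(\gamma):=\sqrt{2+2\sqrt{1-\frac{N^2\|\Omega_i\|^2}{\kappa^2\tilde I(\gamma)^2}}},$$ and that $$\lambda_1:=\kappa\big(\cos\gamma\,\tilde I(\gamma)-\gamma\,\mathrm{Lip}^*I\big)>0,\qquad \kappa>\kappa_c(\gamma,1):=\frac{N\max_{j\in[N]}\|\Omega_j\|}{\sin\left(2\sin(\gamma/2)\right)\tilde I(\gamma)}.$$ Let $\mathbf R(t)=\{R_i(t)\}_{i=1}^N$ be the global solution to the Winfree matrix model on $SO(n)$ (see context) with initial data $\{R_i^0\}$. Then there exists a unique equilibrium $\mathbf R^\infty\in(B_\gamma)^N$ of the model, and it satisfies $$\|\mathbf R(t)-\mathbf R^\infty\|_{\ell^1}\lesssim e^{-\lambda_1t}\quad\text{as } t\to\infty,$$ that is, there is a constant $C$ independent of $t$ such that $\|\mathbf R(t)-\mathbf R^\infty\|_{\ell^1}\le Ce^{-\lambda_1t}$ for all sufficiently large $t$.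
   Context: Let $[N]=\{1,\dots,N\}$, let $I_n$ be the $n\times n$ identity matrix, and let $\mathfrak{so}(n)$ be the space of real skew-symmetric $n\times n$ matrices. On $\mathbb{R}^{n\times n}$ use $\langle A,B\rangle=\frac12\operatorname{tr}(A^TB)$ and $\|A\|=\sqrt{\langle A,A\rangle}$; for $\mathbf R=(R_1,\dots,R_N)\in(\mathbb{R}^{n\times n})^N$ put $\|\mathbf R\|_{\ell^1}=\sum_{i=1}^N\|R_i\|$. Let $d$ be the geodesic (Riemannian) distance on $SO(n)$ for the metric $\langle\cdot,\cdot\rangle$ restricted to tangent spaces; if $R\in SO(n)$ has eigenvalues $e^{\pm \mathrm{i}\theta_1},\dots,e^{\pm\mathrm{i}\theta_m},1,\dots,1$ with $\theta_j\in(0,\pi]$, then $d(I_n,R)=\sqrt{\sum_j\theta_j^2}$. Put $B_r=\{R\in SO(n): d(I_n,R)<r\}$. The Winfree matrix model on $SO(n)$ is $$\dot R_i=\Omega_iR_i+\frac{\kappa}{2}\Big(\frac1N\sum_{j=1}^N I(R_j)\Big)(I_n-R_i^2),\quad t>0,\qquad R_i(0)=R_i^0\in SO(n),\quad i\in[N],$$ with $\Omega_i\in\mathfrak{so}(n)$ and $\kappa>0$. An equilibrium is a point $\mathbf R^\infty=(R_1^\infty,\dots,R_N^\infty)\in SO(n)^N$ at which all right-hand sides vanish. Standing assumptions on the influence function $I$: $I(R)=\tilde I(d(I_n,R))$ for a function $\tilde I:[0,\lfloor n/2\rfloor\pi]\to\mathbb{R}_{\ge0}$ that is decreasing (non-increasing),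 satisfies $\lim_{r\to0^+}\tilde I(r)=1$, is globally Lipschitz continuous, and has support $\operatorname{supp}\tilde I=[0,\beta]$ with $0<\beta<\frac{\pi}{2}$. Moreover $$\mathrm{Lip}^*I:=\sup_{X,Y\in SO(n),\,X\ne Y}\frac{|I(X)-I(Y)|}{\|X-Y\|}.$$ *)

theory Defs
  imports "HOL-Analysis.Analysis"
begin

definition mat_inner :: "real^'n^'n \<Rightarrow> real^'n^'n \<Rightarrow> real" where
  "mat_inner A B = trace (transpose A ** B) / 2"

text \<open>This is the library norm divided by the square root of 2.\<close>

definition mat_norm :: "real^'n^'n \<Rightarrow> real" where
  "mat_norm A = sqrt (mat_inner A A)"

definition l1_norm :: "real^'n^'n^'k \<Rightarrow> real" where
  "l1_norm R = (\<Sum>i\<in>UNIV. mat_norm (R $ i))"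

definition skew_symmetric :: "real^'n^'n \<Rightarrow> bool" where
  "skew_symmetric A \<longleftrightarrow> transpose A = - A"

definition SO :: "(real^'n^'n) set" where
  "SO = {R. rotation_matrix R}"

text \<open>
  The library notion of a piecewise continuously differentiable path does not bound
  the speed near the exceptional points, so such a path may have infinite length, and the
  total function \<^const>\<open>integral\<close> would give it length 0. Hence the length is
  expressed by \<^const>\<open>has_integral\<close>, which admits paths of finite length only.
\<close>

definition has_length :: "(real \<Rightarrow> real^'n^'n) \<Rightarrow> real \<Rightarrow> bool" where
  "has_length g L \<longleftrightarrow>
     ((\<lambda>t. mat_norm (vector_derivative g (at t))) has_integral L) {0..1}"

definition SO_dist :: "real^'n^'n \<Rightarrow> real^'n^'n \<Rightarrow> real" where
  "SO_dist X Y = Inf {L. \<exists>g. valid_path g \<and> path_image g \<subseteq> SO \<and>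
                            pathstart g = X \<and> pathfinish g = Y \<and> has_length g L}"

definition SO_ball :: "real \<Rightarrow> (real^'n^'n) set" where
  "SO_ball r = {R \<in> SO. SO_dist (mat 1) R < r}"

text \<open>
  A profile \<open>f\<close> is a total function, but only its values on the interval
  \<open>D = [0, \<lfloor>n/2\<rfloor>\<pi>]\<close> are constrained; the distance to the identity always
  lies in \<open>D\<close>. The support condition forces \<open>n \<ge> 2\<close>.
\<close>

definition influence_profile :: "nat \<Rightarrow> real \<Rightarrow> (real \<Rightarrow> real) \<Rightarrow> bool" where
  "influence_profile n \<beta> f \<longleftrightarrow>
     (let D = {0..real (n div 2) * pi} in
       (\<forall>r\<in>D. 0 \<le> f r) \<and>
       antimono_on D f \<and>
       (f \<longlongrightarrow> 1) (at_right 0) \<and>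
       (\<exists>L. L-lipschitz_on D f) \<and>
       closure {r\<in>D. f r \<noteq> 0} = {0..\<beta>})"

definition influence :: "(real \<Rightarrow> real) \<Rightarrow> real^'n^'n \<Rightarrow> real" where
  "influence f R = f (SO_dist (mat 1) R)"

definition Lip_star :: "(real^'n^'n \<Rightarrow> real) \<Rightarrow> real" where
  "Lip_star I = Sup {\<bar>I X - I Y\<bar> / mat_norm (X - Y) | X Y. X \<in> SO \<and> Y \<in> SO \<and> X \<noteq> Y}"

text \<open>The oscillators are indexed by a finite type \<open>'k\<close>, so \<open>N = CARD('k)\<close>.\<close>

definition winfree_field ::
    "(real^'n^'n \<Rightarrow> real) \<Rightarrow> real \<Rightarrow> real^'n^'n^'k \<Rightarrow> real^'n^'n^'k \<Rightarrow> real^'n^'n^'k" where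
  "winfree_field I \<kappa> \<Omega> R =
     (\<chi> i. \<Omega> $ i ** R $ i +
          (\<kappa> / 2 * (1 / real CARD('k) * (\<Sum>j\<in>UNIV. I (R $ j)))) *\<^sub>R (mat 1 - R $ i ** R $ i))"

definition winfree_solution ::
    "(real^'n^'n \<Rightarrow> real) \<Rightarrow> real \<Rightarrow> real^'n^'n^'k \<Rightarrow> real^'n^'n^'k \<Rightarrow> (real \<Rightarrow> real^'n^'n^'k) \<Rightarrow> bool"
  where
  "winfree_solution I \<kappa> \<Omega> R0 R \<longleftrightarrow>
     R 0 = R0 \<and> continuous_on {0..} R \<and>
     (\<forall>t\<ge>0. \<forall>i. R t $ i \<in> SO) \<and>
     (\<forall>t>0. (R has_vector_derivative winfree_field I \<kappa> \<Omega> (R t)) (at t))"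

definition winfree_equilibrium ::
    "(real^'n^'n \<Rightarrow> real) \<Rightarrow> real \<Rightarrow> real^'n^'n^'k \<Rightarrow> real^'n^'n^'k \<Rightarrow> bool" where
  "winfree_equilibrium I \<kappa> \<Omega> R \<longleftrightarrow>
     (\<forall>i. R $ i \<in> SO) \<and> winfree_field I \<kappa> \<Omega> R = 0"

end

theory Submission
  imports Defs
begin

text \<open>
  Put \<open>\<rho>(R) = \<parallel>I - R\<parallel>\<^sup>2 = n - tr R\<close>. The top eigenvalue of \<open>(I - R)\<^sup>T (I - R)\<close> is attained on a
  plane that \<open>R\<close> rotates, hence it is at most \<open>\<rho>(R)\<close>, and this gives
  \<open>\<parallel>R - R\<^sup>T\<parallel>\<^sup>2 \<ge> \<rho> (4 - \<rho>)\<close>. This inequality is used twice. Along the Cayley curve from \<open>I\<close> to \<open>R\<close>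
  it bounds the arc length by \<open>2 arcsin(\<parallel>I - R\<parallel>/2)\<close>, so that a chord below \<open>\<gamma>\<^sub>0 = 2 sin(\<gamma>/2)\<close> means a
  geodesic distance below \<open>\<gamma>\<close>. Along the Winfree flow it gives
  \<open>\<rho>\<^sub>i' \<le> n\<^sub>i (\<parallel>\<Omega>\<^sub>i\<parallel> - \<kappa> Itilde(\<gamma>) n\<^sub>i / (2 N))\<close> with
  \<open>n\<^sub>i = \<parallel>R\<^sub>i - R\<^sub>i\<^sup>T\<parallel> \<ge> sqrt (\<rho>\<^sub>i (4 - \<rho>\<^sub>i))\<close>, as long as the oscillator
  \<open>i_star\<close> stays in its ball. The right-hand side is negative for \<open>\<gamma>\<^sub>0\<^sup>2 \<le> \<rho>\<^sub>i < \<Gamma>\<^sub>i\<^sup>2\<close>, so every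
  oscillator enters the chordal ball of radius \<open>\<gamma>\<^sub>0\<close> in finite time and stays there.

  There the symmetric part of every \<open>R\<^sub>i\<close> is at least \<open>cos \<gamma>\<close>, and the flow contracts the
  \<open>\<ell>\<^sup>1\<close> distance at the rate \<open>\<lambda>\<^sub>1\<close>. Comparing \<open>R(t)\<close> with \<open>R(t + h)\<close> yields a limit, which is an
  equilibrium; comparing \<open>R(t)\<close> with any equilibrium in the geodesic ball, whose elements also have
  symmetric part at least \<open>cos \<gamma>\<close>, yields the rate and the uniqueness.

  The supremum \<open>Lip_star\<close> is a Lipschitz constant only because it is finite, which needs the
  diameter bound \<open>\<lfloor>n/2\<rfloor> \<pi>\<close>: outside \<open>[0, \<lfloor>n/2\<rfloor> \<pi>]\<close> the profile is arbitrary.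
\<close>

subsection \<open>Matrices and the Frobenius norm\<close>

lemma inner_matrix_transpose: "inner (A *v x) y = inner x (transpose A *v y)" for A :: "real^'n^'m"
  by (metis dot_lmul_matrix inner_commute transpose_matrix_vector)

lemma transpose_add: "transpose (A + B) = transpose A + transpose B"
  by (simp add: transpose_def vec_eq_iff)

lemma transpose_diff: "transpose (A - B) = transpose A - transpose B"
  by (simp add: transpose_def vec_eq_iff)

lemma norm_matrix_rows: "(norm A)\<^sup>2 = (\<Sum>i\<in>UNIV. (norm (A $ i))\<^sup>2)" for A :: "real^'n^'m"
  by (simp add: power2_norm_eq_inner inner_vec_def)

lemma inner_transpose_matrix: "inner (transpose A) (transpose B) = inner A B" for A B :: "real^'n^'m"
  unfolding inner_vec_def transpose_def by simp (rule sum.swap)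

lemma norm_transpose [simp]: "norm (transpose A) = norm A" for A :: "real^'n^'m"
  by (simp add: norm_eq_sqrt_inner inner_transpose_matrix)

lemma inner_matrix_columns: "inner A B = (\<Sum>j\<in>UNIV. inner (A *v axis j 1) (B *v axis j 1))" for A :: "real^'n^'m"
proof -
  have "A *v axis j 1 = transpose A $ j" "B *v axis j 1 = transpose B $ j" for j
    by (simp_all add: matrix_vector_mult_basis column_def transpose_def vec_eq_iff)
  then show ?thesis
    using inner_transpose_matrix[of A B] by (simp add: inner_vec_def[of "transpose A"])
qed

lemma norm_matrix_columns: "(norm A)\<^sup>2 = (\<Sum>j\<in>UNIV. (norm (A *v axis j 1))\<^sup>2)" for A :: "real^'n^'m"
  unfolding power2_norm_eq_inner by (rule inner_matrix_columns)

lemma bessel_two: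
  fixes v w x :: "'a::real_inner"
  assumes "norm v = 1" "norm w = 1" "inner v w = 0"
  shows "(inner x v)\<^sup>2 + (inner x w)\<^sup>2 \<le> (norm x)\<^sup>2"
proof -
  have vw: "inner v v = 1" "inner w w = 1" "inner w v = 0"
    using assms by (auto simp: norm_eq_1 inner_commute)
  have "0 \<le> inner (x - inner x v *\<^sub>R v - inner x w *\<^sub>R w) (x - inner x v *\<^sub>R v - inner x w *\<^sub>R w)"
    by simp
  also have "\<dots> = (norm x)\<^sup>2 - (inner x v)\<^sup>2 - (inner x w)\<^sup>2"
    unfolding power2_norm_eq_inner
    using assms(3) vw by (simp add: inner_diff_left inner_diff_right power2_eq_square
       inner_commute[of v x] inner_commute[of w x])
  finally show ?thesis by simp
qed

text \<open>Bessel's inequality applied to each row of \<open>A\<close>. A plane on which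
  \<open>A\<close> stretches every direction equally thus counts twice in the squared Frobenius
  norm, which is the source of the factor 1/2 in the operator bounds below.\<close>

lemma norm_orthonormal_pair_le:
  fixes A :: "real^'n^'m"
  assumes "norm v = 1" "norm w = 1" "inner v w = 0"
  shows "(norm (A *v v))\<^sup>2 + (norm (A *v w))\<^sup>2 \<le> (norm A)\<^sup>2"
proof -
  have "(norm (A *v x))\<^sup>2 = (\<Sum>i\<in>UNIV. (inner (A$i) x)\<^sup>2)" for x
    unfolding power2_norm_eq_inner by (simp add: inner_vec_def[of "A *v x"] matrix_vector_mul_component power2_eq_square)
  then show ?thesis
    unfolding norm_matrix_rows[of A] by (simp add: sum.distrib[symmetric] sum_mono bessel_two[OF assms])
qed

text \<open>The unit sphere is compact, so a top right singular vector \<open>v\<close> exists; the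
  eigenvector equation is its first-order optimality condition.\<close>

lemma quadratic_form_max_eigenvector:
  fixes A :: "real^'n^'n"
  obtains v where "norm v = 1" "\<And>x. (norm (A *v x))\<^sup>2 \<le> (norm (A *v v))\<^sup>2 * (norm x)\<^sup>2"
     "transpose A *v (A *v v) = (norm (A *v v))\<^sup>2 *\<^sub>R v"
proof -
  have "compact (sphere (0::real^'n) 1)" "sphere (0::real^'n) 1 \<noteq> {}"
    by (auto simp: sphere_eq_empty)
  moreover have "continuous_on (sphere 0 1) (\<lambda>x. norm (A *v x))"
    by (intro continuous_intros linear_continuous_on matrix_vector_mul_bounded_linear)
  ultimately obtain v where v: "v \<in> sphere 0 1" and max: "\<forall>x\<in>sphere 0 1. norm (A *v x) \<le> norm (A *v v)"
    using continuous_attains_sup[of "sphere 0 1" "\<lambda>x. norm (A *v x)"] by blast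
  define l where "l = (norm (A *v v))\<^sup>2"
  have nv: "norm v = 1" using v by simp
  have le: "(norm (A *v x))\<^sup>2 \<le> l * (norm x)\<^sup>2" for x
  proof (cases "x = 0")
    case False
    then have "norm (A *v (x /\<^sub>R norm x)) \<le> norm (A *v v)" using max by auto
    then have "norm (A *v x) \<le> norm (A *v v) * norm x"
      using False by (simp add: matrix_vector_mult_scaleR field_simps)
    then show ?thesis unfolding l_def power_mult_distrib[symmetric] by (intro power_mono) auto
  qed simp
  have orth: "inner (l *\<^sub>R v - transpose A *v (A *v v)) y = 0" for y
  proof -
    define b where "b = inner (l *\<^sub>R v - transpose A *v (A *v v)) y"
    define c where "c = l * (norm y)\<^sup>2 - (norm (A *v y))\<^sup>2"
    \<comment> \<open>Maximality of \<open>v\<close> tested at \<open>v + t y\<close>. The quadratic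
      has no constant term, so its linear coefficient must vanish as well.\<close>
    have q: "0 \<le> 2 * t * b + t\<^sup>2 * c" for t
    proof -
      have "0 \<le> l * (norm (v + t *\<^sub>R y))\<^sup>2 - (norm (A *v (v + t *\<^sub>R y)))\<^sup>2" using le by simp
      also have "\<dots> = 2 * t * b + t\<^sup>2 * c"
        using nv unfolding b_def c_def l_def power2_norm_eq_inner
        by (simp add: matrix_vector_right_distrib matrix_vector_mult_scaleR
           inner_add_left inner_add_right inner_diff_left inner_commute[of y v] inner_commute[of "A *v y" "A *v v"]
           dot_lmul_matrix algebra_simps power2_eq_square norm_eq_1)
      finally show ?thesis .
    qed
    have c0: "c \<ge> 0" using le[of y] by (simp add: c_def)
    have "b = 0"
    proof (rule ccontr)
      assume "b \<noteq> 0"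
      \<comment> \<open>The minimiser would be \<open>- b / c\<close>; dividing by
        \<open>c + 1\<close> avoids a zero denominator and still gives a negative value.\<close>
      have "0 \<le> 2 * (- b / (c + 1)) * b + (- b / (c + 1))\<^sup>2 * c" by (rule q)
      also have "\<dots> = - (b\<^sup>2 * (c + 2)) / (c + 1)\<^sup>2"
        using c0 by (simp add: power2_eq_square divide_simps) (simp add: algebra_simps)
      also have "\<dots> < 0" using \<open>b \<noteq> 0\<close> c0 by (simp add: divide_neg_pos)
      finally show False by simp
    qed
    then show ?thesis by (simp add: b_def)
  qed
  have "l *\<^sub>R v - transpose A *v (A *v v) = 0"
    using orth[of "l *\<^sub>R v - transpose A *v (A *v v)"] by simp
  then show thesis using that[of v] nv le unfolding l_def by simp
qed

subsection \<open>Extremal rotation planes\<close>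

lemma SO_D:
  assumes "R \<in> SO"
  shows "orthogonal_matrix R" "det R = 1" "transpose R ** R = mat 1" "R ** transpose R = mat 1"
  using assms by (auto simp: SO_def rotation_matrix_def orthogonal_matrix_def)

lemma orthogonal_matrix_inner:
  fixes R :: "real^'n^'n"
  assumes "orthogonal_matrix R"
  shows "inner (R *v x) (R *v y) = inner x y"
  using assms by (metis inner_matrix_transpose matrix_vector_mul_assoc matrix_vector_mul_lid orthogonal_matrix_def)

lemma orthogonal_matrix_norm [simp]:
  fixes R :: "real^'n^'n"
  assumes "orthogonal_matrix R"
  shows "norm (R *v x) = norm x"
  using assms by (simp add: norm_eq_sqrt_inner orthogonal_matrix_inner)

lemma SO_transpose: "R \<in> SO \<Longrightarrow> transpose R \<in> SO"
  by (auto simp: SO_def rotation_matrix_def orthogonal_matrix_def)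

lemma SO_mult: "R \<in> SO \<Longrightarrow> S \<in> SO \<Longrightarrow> R ** S \<in> SO"
  by (auto simp: SO_def rotation_matrix_def orthogonal_matrix_mul det_mul)

lemma SO_one: "mat 1 \<in> SO"
  by (auto simp: SO_def rotation_matrix_def orthogonal_matrix_id)

text \<open>Orthogonality gives \<open>M (I + M)^T = I + M\<close>, and taking determinants yields
  \<open>det (I + M) = - det (I + M)\<close>.\<close>

lemma orthogonal_det_minus_one_eigenvector:
  fixes M :: "real^'n^'n"
  assumes "orthogonal_matrix M" "det M = -1"
  obtains u where "u \<noteq> 0" "M *v u = - u"
proof -
  have "M ** transpose (mat 1 + M) = mat 1 + M"
    using assms(1) by (simp add: orthogonal_matrix_def matrix_add_ldistrib add.commute transpose_add)
  then have "det M * det (mat 1 + M) = det (mat 1 + M)"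
    by (metis det_mul det_transpose)
  then have "det (mat 1 + M) = 0" using assms(2) by simp
  then have "\<not> invertible (mat 1 + M)" by (simp add: invertible_det_nz)
  then obtain u where "u \<noteq> 0" "(mat 1 + M) *v u = 0"
    by (metis invertible_left_inverse matrix_left_invertible_ker)
  then show thesis
    using that[of u] by (simp add: matrix_vector_mult_add_rdistrib eq_neg_iff_add_eq_0 add.commute)
qed

text \<open>The Householder reflection in the hyperplane orthogonal to \<open>v\<close>. It is built
  by conjugating a diagonal matrix with an orthogonal matrix that sends a basis vector to
  \<open>v\<close>, so that its determinant can be read off.\<close>

lemma reflection_matrix_exists:
  fixes v :: "real^'n"
  assumes "norm v = 1"
  obtains H :: "real^'n^'n" where "orthogonal_matrix H" "det H = -1" "\<And>x. H *v x = x - (2 * inner v x) *\<^sub>R v"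
proof -
  obtain k :: 'n where True by simp
  obtain A :: "real^'n^'n" where A: "orthogonal_matrix A" "A *v axis k 1 = v"
    using orthogonal_matrix_exists_basis assms by metis
  define D :: "real^'n^'n" where "D = (\<chi> i j. if i = j then (if i = k then -1 else 1) else 0)"
  have D: "D *v y = y - (2 * inner (axis k 1) y) *\<^sub>R axis k 1" for y
    by (auto simp: D_def vec_eq_iff matrix_vector_mult_def if_distrib[of "\<lambda>x. x * _"] axis_def
       inner_vec_def cong: if_cong)
  have "transpose D = D" by (auto simp: D_def transpose_def vec_eq_iff)
  moreover have "D ** D = mat 1"
    by (auto simp: D_def matrix_matrix_mult_def vec_eq_iff mat_def if_distrib[of "\<lambda>x. x * _"] cong: if_cong)
  ultimately have oD: "orthogonal_matrix D" by (simp add: orthogonal_matrix_def)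
  have "det D = (\<Prod>i\<in>UNIV. D $ i $ i)" by (rule det_diagonal) (simp add: D_def)
  also have "\<dots> = (\<Prod>i\<in>UNIV. if i = k then -1 else 1)" by (simp add: D_def)
  also have "\<dots> = -1" by simp
  finally have dD: "det D = -1" .
  define H where "H = A ** D ** transpose A"
  show thesis
  proof
    show "orthogonal_matrix H" unfolding H_def
      by (intro orthogonal_matrix_mul A oD) (use A in \<open>simp add: orthogonal_matrix_transpose\<close>)
    have "det A * det A = 1" using det_orthogonal_matrix[OF A(1)] by auto
    then show "det H = -1" by (simp add: H_def det_mul dD)
    fix x
    have "inner (axis k 1) (transpose A *v x) = inner v x"
      using A(2) inner_matrix_transpose[of A "axis k 1" x] by simp
    moreover have "A *v (transpose A *v x) = x"
      using A(1) by (metis matrix_vector_mul_assoc matrix_vector_mul_lid orthogonal_matrix_def)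
    ultimately show "H *v x = x - (2 * inner v x) *\<^sub>R v"
      using A(2) by (simp add: H_def D matrix_vector_mul_assoc[symmetric] matrix_vector_mult_diff_distrib
        matrix_vector_mult_scaleR del: transpose_matrix_vector)
  qed
qed

text \<open>With \<open>H\<close> the reflection in \<open>v\<close>, the product \<open>H R\<close>
  has determinant -1 and hence an eigenvector \<open>u\<close> for -1. This \<open>u\<close> turns
  out to be orthogonal to \<open>v\<close> and then is an eigenvector of \<open>R\<close>
  too.\<close>

lemma SO_eigenvalue_minus_one_double:
  fixes R :: "real^'n^'n"
  assumes "R \<in> SO" "norm v = 1" "R *v v = - v"
  obtains w where "norm w = 1" "inner v w = 0" "R *v w = - w"
proof -
  obtain H :: "real^'n^'n" where H: "orthogonal_matrix H" "det H = -1" "\<And>x. H *v x = x - (2 * inner v x) *\<^sub>R v"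
    using reflection_matrix_exists[OF assms(2)] by blast
  have "orthogonal_matrix (H ** R)" "det (H ** R) = -1"
    using H SO_D[OF assms(1)] by (auto simp: orthogonal_matrix_mul det_mul)
  then obtain u where u: "u \<noteq> 0" "(H ** R) *v u = - u"
    using orthogonal_det_minus_one_eigenvector by blast
  have "R *v u = H *v (H *v (R *v u))"
    using assms(2) by (simp add: H(3) inner_diff_right norm_eq_1)
  also have "\<dots> = - (H *v u)" using u(2) by (simp add: matrix_vector_mul_assoc[symmetric] H(3))
  finally have Ru: "R *v u = - u + (2 * inner v u) *\<^sub>R v" by (simp add: H(3))
  \<comment> \<open>Inserting both images turns this invariance into
    \<open>- inner v u = inner v u\<close>.\<close>
  have "inner (R *v v) (R *v u) = inner v u"
    using assms(1) by (simp add: orthogonal_matrix_inner SO_D)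
  then have "inner v u = 0"
    using assms(2) unfolding Ru assms(3) by (auto simp: inner_diff_right inner_add_right norm_eq_1)
  with Ru have "R *v u = - u" by simp
  with \<open>inner v u = 0\<close> show thesis
    using u(1) by (intro that[of "u /\<^sub>R norm u"]) (auto simp: matrix_vector_mult_scaleR)
qed

lemma transpose_diff_mult_vector:
  fixes R :: "real^'n^'n"
  assumes "orthogonal_matrix R"
  shows "transpose (mat 1 - R) *v ((mat 1 - R) *v x) = 2 *\<^sub>R x - R *v x - transpose R *v x"
proof -
  have "transpose R *v (R *v x) = x"
    using assms by (metis matrix_vector_mul_assoc matrix_vector_mul_lid orthogonal_matrix_def)
  then show ?thesis
    by (simp add: transpose_diff matrix_vector_mult_diff_rdistrib matrix_vector_mult_diff_distrib scaleR_2
       del: transpose_matrix_vector)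
qed

text \<open>A top eigenvector \<open>v\<close> of \<open>(I - R)^T (I - R) = 2 I - R - R^T\<close>
  satisfies \<open>R^T v + R v = 2 c v\<close>, so \<open>v\<close> and \<open>R v\<close> span an
  invariant plane. In the degenerate case \<open>R v = - v\<close> the determinant supplies the
  second direction.\<close>

lemma SO_extremal_rotation_plane:
  fixes R :: "real^'n^'n"
  assumes R: "R \<in> SO" "R \<noteq> mat 1"
  obtains v w c s where "norm v = 1" "norm w = 1" "inner v w = 0"
    "R *v v = c *\<^sub>R v + s *\<^sub>R w" "R *v w = - s *\<^sub>R v + c *\<^sub>R w" "c\<^sup>2 + s\<^sup>2 = 1" "c < 1"
    "\<And>x. (norm ((mat 1 - R) *v x))\<^sup>2 \<le> 2 * (1 - c) * (norm x)\<^sup>2"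
proof -
  note oR = SO_D(1)[OF R(1)]
  obtain v where v: "norm v = 1" and
    max: "\<And>x. (norm ((mat 1 - R) *v x))\<^sup>2 \<le> (norm ((mat 1 - R) *v v))\<^sup>2 * (norm x)\<^sup>2" and
    ev: "transpose (mat 1 - R) *v ((mat 1 - R) *v v) = (norm ((mat 1 - R) *v v))\<^sup>2 *\<^sub>R v"
    using quadratic_form_max_eigenvector[of "mat 1 - R"] by metis
  define l where "l = (norm ((mat 1 - R) *v v))\<^sup>2"
  define c where "c = inner v (R *v v)"
  have vv: "inner v v = 1" using v by (simp add: norm_eq_1)
  have RR: "inner (R *v v) (R *v v) = 1" using oR vv by (simp add: orthogonal_matrix_inner)
  have l: "l = 2 * (1 - c)"
    unfolding l_def c_def power2_norm_eq_inner using vv RR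
    by (simp add: matrix_vector_mult_diff_rdistrib inner_diff_left inner_diff_right inner_commute)
  have "l \<noteq> 0"
  proof
    assume "l = 0"
    then have "(mat 1 - R) *v x = 0" for x
      using max[of x] by (simp add: l_def)
    then have "mat 1 = R"
      by (simp add: matrix_vector_mult_diff_rdistrib matrix_eq)
    with R(2) show False by simp
  qed
  moreover have "l \<ge> 0" by (simp add: l_def)
  ultimately have c1: "c < 1" using l by simp
  have "R *v (transpose R *v v) = v"
    using oR by (metis matrix_vector_mul_assoc matrix_vector_mul_lid orthogonal_matrix_def)
  moreover have "transpose R *v v = (2 * c) *\<^sub>R v - R *v v"
    using ev unfolding transpose_diff_mult_vector[OF oR] l_def[symmetric] l by (simp add: algebra_simps scaleR_2)
  ultimately have "v = (2 * c) *\<^sub>R (R *v v) - R *v (R *v v)"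
    by (metis matrix_vector_mult_diff_distrib matrix_vector_mult_scaleR)
  then have RRv: "R *v (R *v v) = (2 * c) *\<^sub>R (R *v v) - v"
    by (metis add_diff_cancel_left' diff_add_cancel)
  show thesis
  proof (cases "R *v v = c *\<^sub>R v")
    case True
    then have "c\<^sup>2 = 1" using RR vv by (simp add: power2_eq_square)
    then have c: "c = -1" using c1 by (auto simp: power2_eq_1_iff)
    with True have "R *v v = - v" by simp
    from SO_eigenvalue_minus_one_double[OF R(1) v this]
    obtain w where w: "norm w = 1" "inner v w = 0" "R *v w = - w" by blast
    show thesis
      using that[of v w c 0] v w True c max l by (simp add: l_def)
  next
    case False
    \<comment> \<open>Gram-Schmidt on \<open>v\<close> and \<open>R v\<close>; the image of
      \<open>w\<close> then follows from the recurrence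
      \<open>R (R v) = 2 c R v - v\<close>.\<close>
    define s where "s = norm (R *v v - c *\<^sub>R v)"
    define w where "w = (R *v v - c *\<^sub>R v) /\<^sub>R s"
    have s0: "s > 0" using False by (simp add: s_def)
    have Rv: "R *v v = c *\<^sub>R v + s *\<^sub>R w" using s0 by (simp add: w_def)
    have nw: "norm w = 1" using s0 by (simp add: w_def s_def)
    have vw: "inner v w = 0" using vv by (simp add: w_def inner_diff_right c_def[symmetric])
    have cs: "c\<^sup>2 + s\<^sup>2 = 1"
      using RR nw vw vv unfolding Rv by (simp add: inner_add_left inner_add_right norm_eq_1 inner_commute power2_eq_square)
    have "s *\<^sub>R (R *v w) = R *v (R *v v) - c *\<^sub>R (R *v v)"
      using s0 by (simp add: w_def matrix_vector_mult_diff_distrib matrix_vector_mult_scaleR)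
    also have "\<dots> = c *\<^sub>R (R *v v) - v" unfolding RRv by (simp add: algebra_simps flip: scaleR_2)
    also have "\<dots> = (c\<^sup>2 - 1) *\<^sub>R v + (c * s) *\<^sub>R w" unfolding Rv by (simp add: algebra_simps power2_eq_square)
    also have "c\<^sup>2 - 1 = - s\<^sup>2" using cs by simp
    also have "- s\<^sup>2 *\<^sub>R v + (c * s) *\<^sub>R w = s *\<^sub>R (- s *\<^sub>R v + c *\<^sub>R w)"
      by (simp add: algebra_simps power2_eq_square)
    finally have "R *v w = - s *\<^sub>R v + c *\<^sub>R w" using s0 by simp
    then show thesis
      using that[of v w c s] v nw vw Rv cs c1 max l by (simp add: l_def)
  qed
qed

text \<open>On the extremal plane \<open>I - R\<close> scales every length by its largest factor, so
  twice the square of that factor is at most the squared Frobenius norm.\<close>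

lemma SO_diff_one_operator_bound:
  fixes R :: "real^'n^'n"
  assumes R: "R \<in> SO"
  shows "(norm ((mat 1 - R) *v x))\<^sup>2 \<le> (norm (mat 1 - R))\<^sup>2 / 2 * (norm x)\<^sup>2"
proof (cases "R = mat 1")
  case False
  from SO_extremal_rotation_plane[OF R False] obtain v w c s where *: "norm v = 1" "norm w = 1" "inner v w = 0"
    "R *v v = c *\<^sub>R v + s *\<^sub>R w" "R *v w = - s *\<^sub>R v + c *\<^sub>R w" "c\<^sup>2 + s\<^sup>2 = 1" "c < 1"
    "\<And>x. (norm ((mat 1 - R) *v x))\<^sup>2 \<le> 2 * (1 - c) * (norm x)\<^sup>2" by metis
  have 1: "inner v v = 1" "inner w w = 1" "inner w v = 0" using * by (auto simp: norm_eq_1 inner_commute)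
  have "(norm ((mat 1 - R) *v v))\<^sup>2 = (1 - c)\<^sup>2 + s\<^sup>2" "(norm ((mat 1 - R) *v w))\<^sup>2 = (1 - c)\<^sup>2 + s\<^sup>2"
    unfolding power2_norm_eq_inner matrix_vector_mult_diff_rdistrib matrix_vector_mul_lid *(4,5) using *(3) 1
    by (simp_all add: inner_diff_left inner_diff_right inner_add_left inner_add_right
       power2_eq_square algebra_simps)
  moreover have "(1 - c)\<^sup>2 + s\<^sup>2 = 2 * (1 - c)" using *(6) by (simp add: power2_eq_square algebra_simps)
  ultimately have "2 * (2 * (1 - c)) \<le> (norm (mat 1 - R))\<^sup>2"
    using norm_orthonormal_pair_le[OF *(1-3), of "mat 1 - R"] by simp
  then show ?thesis
    by (intro order_trans[OF *(8)] mult_right_mono) auto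
qed simp

lemma transpose_mat_1 [simp]: "transpose (mat 1) = mat 1"
  by (rule transpose_mat)

lemma norm_mat_1_diff_transpose: "norm (mat 1 - transpose R) = norm (mat 1 - R)" for R :: "real^'n^'n"
  by (metis norm_transpose transpose_diff transpose_mat_1)

text \<open>For the eigenangles \<open>\<theta>\<^sub>j\<close> of \<open>R\<close> and \<open>x\<^sub>j = 4 sin\<^sup>2 (\<theta>\<^sub>j / 2)\<close> this is
  \<open>(\<Sum>j. x\<^sub>j (4 - x\<^sub>j)) \<ge> (\<Sum>j. x\<^sub>j) (4 - (\<Sum>j. x\<^sub>j))\<close>.\<close>

lemma SO_norm_diff_transpose_ge:
  fixes R :: "real^'n^'n"
  assumes R: "R \<in> SO"
  shows "(norm (R - transpose R))\<^sup>2 \<ge> (4 - (norm (mat 1 - R))\<^sup>2 / 2) * (norm (mat 1 - R))\<^sup>2"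
proof -
  note oR = SO_D(1)[OF R]
  define r where "r = (norm (mat 1 - R))\<^sup>2 / 2"
  have *: "(norm ((R - transpose R) *v x))\<^sup>2 \<ge> (4 - r) * (norm ((mat 1 - R) *v x))\<^sup>2" for x
  proof -
    define y z where "y = R *v x" and "z = transpose R *v x"
    have oT: "orthogonal_matrix (transpose R)" using oR by (simp add: orthogonal_matrix_transpose)
    have i: "inner y y = inner x x" "inner z z = inner x x" "inner x z = inner x y"
      unfolding y_def z_def by (simp_all add: orthogonal_matrix_inner oR oT del: transpose_matrix_vector)
        (metis inner_commute inner_matrix_transpose)
    have "(norm (y - z))\<^sup>2 = 4 * (norm (x - y))\<^sup>2 - (norm (2 *\<^sub>R x - y - z))\<^sup>2"
      unfolding power2_norm_eq_inner using i
      by (simp add: inner_diff_left inner_diff_right inner_commute algebra_simps)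
    \<comment> \<open>The vector is \<open>(I - R^T) (I - R) x\<close>, so the operator bound for
      \<open>R^T\<close> applies.\<close>
    moreover have "(norm (2 *\<^sub>R x - y - z))\<^sup>2 \<le> r * (norm (x - y))\<^sup>2"
      using SO_diff_one_operator_bound[OF SO_transpose[OF R], of "(mat 1 - R) *v x"]
        transpose_diff_mult_vector[OF oR, of x]
      unfolding norm_mat_1_diff_transpose r_def[symmetric] y_def z_def transpose_diff transpose_mat_1
      by (simp add: matrix_vector_mult_diff_rdistrib[of "mat 1" R x] del: transpose_matrix_vector)
    ultimately show ?thesis
      unfolding y_def z_def
      by (simp add: matrix_vector_mult_diff_rdistrib algebra_simps del: transpose_matrix_vector)
  qed
  have "(4 - r) * (norm (mat 1 - R))\<^sup>2 = (\<Sum>j\<in>UNIV. (4 - r) * (norm ((mat 1 - R) *v axis j 1))\<^sup>2)"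
    by (simp add: norm_matrix_columns[of "mat 1 - R"] sum_distrib_left)
  also have "\<dots> \<le> (norm (R - transpose R))\<^sup>2"
    unfolding norm_matrix_columns[of "R - transpose R"] by (intro sum_mono *)
  finally show ?thesis by (simp add: r_def)
qed

lemma mat_inner_eq: "mat_inner A B = inner A B / 2"
proof -
  have "trace (transpose A ** B) = inner A B"
    unfolding trace_def matrix_matrix_mult_def transpose_def inner_vec_def
    by simp (rule sum.swap)
  then show ?thesis by (simp add: mat_inner_def)
qed

lemma mat_norm_eq: "mat_norm A = norm A / sqrt 2"
  by (simp add: mat_norm_def mat_inner_eq norm_eq_sqrt_inner real_sqrt_divide)

lemma mat_norm_power2: "(mat_norm A)\<^sup>2 = (norm A)\<^sup>2 / 2"
  by (simp add: mat_norm_eq power_divide)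

lemma mat_norm_nonneg [simp]: "0 \<le> mat_norm A"
  by (simp add: mat_norm_eq)

lemma mat_norm_eq_0 [simp]: "mat_norm A = 0 \<longleftrightarrow> A = 0"
  by (simp add: mat_norm_eq)

lemma mat_norm_pos [simp]: "0 < mat_norm A \<longleftrightarrow> A \<noteq> 0"
  using mat_norm_nonneg[of A] mat_norm_eq_0[of A] by linarith

lemma mat_norm_triangle: "mat_norm (A + B) \<le> mat_norm A + mat_norm B"
  by (simp add: mat_norm_eq divide_right_mono norm_triangle_ineq flip: add_divide_distrib)

lemma mat_norm_minus_commute: "mat_norm (A - B) = mat_norm (B - A)"
  by (simp add: mat_norm_eq norm_minus_commute)

lemma norm_orthogonal_matrix_mult:
  fixes R :: "real^'n^'n"
  assumes "orthogonal_matrix R"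
  shows "norm (R ** A) = norm A"
proof -
  have "(norm (R ** A))\<^sup>2 = (norm A)\<^sup>2"
    unfolding norm_matrix_columns by (simp add: assms flip: matrix_vector_mul_assoc)
  then show ?thesis by simp
qed

lemma SO_mat_norm_diff_transpose_ge:
  fixes R :: "real^'n^'n"
  assumes "R \<in> SO"
  shows "(mat_norm (R - transpose R))\<^sup>2 \<ge> (mat_norm (mat 1 - R))\<^sup>2 * (4 - (mat_norm (mat 1 - R))\<^sup>2)"
  using SO_norm_diff_transpose_ge[OF assms] by (simp add: mat_norm_power2 algebra_simps)

lemma matrix_diff_ldistrib: "A ** (B - C) = A ** B - A ** C"
  for A :: "'a::ring_1^'n^'m"
  by (simp add: matrix_matrix_mult_def vec_eq_iff right_diff_distrib sum_subtractf)

lemma matrix_diff_rdistrib: "(A - B) ** C = A ** C - B ** C"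
  for A :: "'a::ring_1^'n^'m"
  by (simp add: matrix_matrix_mult_def vec_eq_iff left_diff_distrib sum_subtractf)

lemma trace_transpose: "trace (transpose A) = trace A"
  by (simp add: trace_def transpose_def)

text \<open>Makes the squared chord affine in \<open>R\<close>, so that its derivative along a curve
  is minus the trace of the velocity, even where the chord vanishes.\<close>

lemma SO_mat_norm_power2_trace:
  fixes R :: "real^'n^'n"
  assumes "R \<in> SO"
  shows "(mat_norm (mat 1 - R))\<^sup>2 = real CARD('n) - trace R"
proof -
  have "(mat_norm (mat 1 - R))\<^sup>2 = trace (transpose (mat 1 - R) ** (mat 1 - R)) / 2"
    unfolding mat_norm_def by (simp add: mat_inner_eq mat_inner_def[symmetric])
  also have "transpose (mat 1 - R) ** (mat 1 - R) = (mat 1 - R) + (mat 1 - transpose R)"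
    using SO_D[OF assms] by (simp add: transpose_diff matrix_diff_ldistrib matrix_diff_rdistrib del: diff_add_eq)
  also have "trace \<dots> = 2 * (real CARD('n) - trace R)"
    by (simp only: trace_add trace_sub trace_I trace_transpose mult_2)
  finally show ?thesis by simp
qed

subsection \<open>Curves in the rotation group\<close>

lemma bounded_bilinear_matrix_mult:
  "bounded_bilinear ((**) :: real^'n^'m \<Rightarrow> real^'p^'n \<Rightarrow> real^'p^'m)"
proof -
  have "bilinear ((**) :: real^'n^'m \<Rightarrow> real^'p^'n \<Rightarrow> real^'p^'m)"
    unfolding bilinear_def
    by (intro conjI allI linearI)
      (simp_all add: matrix_add_ldistrib matrix_matrix_mult_def vec_eq_iff sum.distrib algebra_simps
        sum_distrib_left sum_distrib_right)
  then show ?thesis by (simp add: bilinear_conv_bounded_bilinear)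
qed

lemmas has_vector_derivative_matrix_mult =
  bounded_bilinear.has_vector_derivative[OF bounded_bilinear_matrix_mult]
lemmas continuous_on_matrix_mult = bounded_bilinear.continuous_on[OF bounded_bilinear_matrix_mult]
lemmas tendsto_matrix_mult = bounded_bilinear.tendsto[OF bounded_bilinear_matrix_mult]
lemmas bounded_linear_matrix_mult_right = bounded_bilinear.bounded_linear_right[OF bounded_bilinear_matrix_mult]

lemma bounded_linear_transpose: "bounded_linear (transpose :: real^'n^'m \<Rightarrow> real^'m^'n)"
  by (simp add: linear_conv_bounded_linear[symmetric] linear_iff transpose_add transpose_scalar)

lemma matrix_mult_scaleR_left: "(c *\<^sub>R A) ** B = c *\<^sub>R (A ** B)" for A :: "real^'n^'m"
  by (rule bounded_bilinear.scaleR_left[OF bounded_bilinear_matrix_mult])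

lemma matrix_mult_scaleR_right: "A ** (c *\<^sub>R B) = c *\<^sub>R (A ** B)" for A :: "real^'n^'m"
  by (rule bounded_bilinear.scaleR_right[OF bounded_bilinear_matrix_mult])

lemma matrix_mult_minus_left: "(- A) ** B = - (A ** B)" for A :: "real^'n^'m"
  by (rule bounded_bilinear.minus_left[OF bounded_bilinear_matrix_mult])

lemma matrix_mult_minus_right: "A ** (- B) = - (A ** B)" for A :: "real^'n^'m"
  by (rule bounded_bilinear.minus_right[OF bounded_bilinear_matrix_mult])

lemma trace_minus: "trace (- A) = - trace A" for A :: "real^'n^'n"
  by (simp add: trace_def sum_negf)

lemma trace_scaleR: "trace (c *\<^sub>R A) = c * trace A" for A :: "real^'n^'n"
  by (simp add: trace_def sum_distrib_left)

lemma bounded_linear_trace: "bounded_linear (trace :: real^'n^'n \<Rightarrow> real)"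
  by (simp add: linear_conv_bounded_linear[symmetric] linear_iff trace_add trace_scaleR)

definition SO_curve :: "real^'n^'n \<Rightarrow> real^'n^'n \<Rightarrow> real \<Rightarrow> bool" where
  "SO_curve X Y L \<longleftrightarrow> (\<exists>g. valid_path g \<and> path_image g \<subseteq> SO \<and> pathstart g = X \<and> pathfinish g = Y \<and> has_length g L)"

lemma SO_dist_eq: "SO_dist X Y = Inf {L. SO_curve X Y L}"
  by (simp add: SO_dist_def SO_curve_def)

lemma valid_path_smoothE:
  fixes g :: "real \<Rightarrow> 'a::real_normed_vector"
  assumes "valid_path g"
  obtains S where "finite S" "\<And>t. t \<in> {0..1} - S \<Longrightarrow> (g has_vector_derivative vector_derivative g (at t)) (at t)"
    "continuous_on {0..1} g"
  using assms unfolding valid_path_def piecewise_C1_differentiable_on_def C1_differentiable_on_eq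
  by (metis vector_derivative_works)

lemma SO_curveI:
  assumes "\<And>t. t \<in> {0..1} \<Longrightarrow> (g has_vector_derivative g' t) (at t)" "continuous_on {0..1} g'"
    "\<And>t. t \<in> {0..1} \<Longrightarrow> g t \<in> SO" "((\<lambda>t. mat_norm (g' t)) has_integral L) {0..1}"
  shows "SO_curve (g 0) (g 1) L"
  unfolding SO_curve_def
proof (intro exI[of _ g] conjI)
  show "valid_path g"
    unfolding valid_path_def
    by (rule C1_differentiable_imp_piecewise) (use assms in \<open>unfold C1_differentiable_on_def, blast\<close>)
  show "has_length g L"
    unfolding has_length_def using assms(4)
    by (rule has_integral_eq[rotated]) (simp add: vector_derivative_at[OF assms(1)])
qed (use assms in \<open>auto simp: path_image_def pathstart_def pathfinish_def\<close>)

lemma SO_curve_refl: "X \<in> SO \<Longrightarrow> SO_curve X X 0"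
  using SO_curveI[of "\<lambda>_. X" "\<lambda>_. 0" 0] by (simp add: mat_norm_eq)

text \<open>The velocity integrates to the chord, finitely many exceptional times being harmless.
  This also bounds all lengths below, as the infimum in \<open>SO_dist\<close> requires.\<close>

lemma SO_curve_chord:
  assumes "SO_curve X Y L"
  shows "mat_norm (X - Y) \<le> L"
proof -
  obtain g where g: "valid_path g" "g 0 = X" "g 1 = Y" "has_length g L"
    using assms by (auto simp: SO_curve_def pathstart_def pathfinish_def)
  obtain S where S: "finite S" "\<And>t. t \<in> {0..1} - S \<Longrightarrow> (g has_vector_derivative vector_derivative g (at t)) (at t)"
    "continuous_on {0..1} g" using valid_path_smoothE[OF g(1)] by blast
  have "((\<lambda>t. vector_derivative g (at t)) has_integral (g 1 - g 0)) {0..1}"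
    by (rule fundamental_theorem_of_calculus_interior_strong[OF S(1)]) (use S in auto)
  moreover have "((\<lambda>t. norm (vector_derivative g (at t))) has_integral (sqrt 2 * L)) {0..1}"
    using has_integral_mult_right[OF g(4)[unfolded has_length_def], of "sqrt 2"] by (simp add: mat_norm_eq)
  ultimately have "norm (g 1 - g 0) \<le> sqrt 2 * L"
    using integral_norm_bound_integral[of "\<lambda>t. vector_derivative g (at t)" "{0..1}" "\<lambda>t. norm (vector_derivative g (at t))"]
    by (auto simp: has_integral_iff)
  then show ?thesis
    using g by (simp add: mat_norm_eq norm_minus_commute field_simps)
qed

lemma SO_curve_nonneg: "SO_curve X Y L \<Longrightarrow> 0 \<le> L"
  by (rule order_trans[OF mat_norm_nonneg SO_curve_chord])

text \<open>Each half of the joined path runs at double speed for half the time, so the lengths add.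
  Only the joint at 1/2 and the preimages of the exceptional times have to be discarded.\<close>

lemma SO_curve_trans:
  assumes "SO_curve X Y L" "SO_curve Y Z M"
  shows "SO_curve X Z (L + M)"
proof -
  obtain f where f: "valid_path f" "path_image f \<subseteq> SO" "pathstart f = X" "pathfinish f = Y" "has_length f L"
    using assms(1) by (auto simp: SO_curve_def)
  obtain g where g: "valid_path g" "path_image g \<subseteq> SO" "pathstart g = Y" "pathfinish g = Z" "has_length g M"
    using assms(2) by (auto simp: SO_curve_def)
  obtain S where S: "finite S" "\<And>t. t \<in> {0..1} - S \<Longrightarrow> (f has_vector_derivative vector_derivative f (at t)) (at t)"
    using valid_path_smoothE[OF f(1)] by metis
  obtain T where T: "finite T" "\<And>t. t \<in> {0..1} - T \<Longrightarrow> (g has_vector_derivative vector_derivative g (at t)) (at t)"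
    using valid_path_smoothE[OF g(1)] by metis
  define h where "h = f +++ g"
  have half: "((\<lambda>x. mat_norm (2 *\<^sub>R vector_derivative f (at (2 * x)))) has_integral L) {0..1/2}"
    "((\<lambda>x. mat_norm (2 *\<^sub>R vector_derivative g (at (2 * x - 1)))) has_integral M) {1/2..1}"
    using has_integral_affinity01[OF f(5)[unfolded has_length_def], where m=2 and c=0, THEN has_integral_mult_right[where c=2]]
      has_integral_affinity01[OF g(5)[unfolded has_length_def], where m=2 and c="-1", THEN has_integral_mult_right[where c=2]]
    by (simp_all only: image_affinity_atLeastAtMost_div_diff) (simp_all add: mat_norm_eq)
  have d1: "vector_derivative h (at z) = 2 *\<^sub>R vector_derivative f (at (2 * z))" if "0 \<le> z" "z < 1/2" "2 * z \<notin> S" for z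
  proof (rule vector_derivative_at [OF has_vector_derivative_transform_within])
    show "0 < \<bar>z - 1/2\<bar>" using that by auto
    have "((*) 2 has_vector_derivative 2) (at z)"
      by (auto intro!: derivative_eq_intros)
    then show "((\<lambda>x. f (2 * x)) has_vector_derivative 2 *\<^sub>R vector_derivative f (at (2 * z))) (at z)"
      using vector_diff_chain_at[of "(*) 2" 2 z f] S(2)[of "2 * z"] that by (auto simp: o_def)
  qed (use that in \<open>auto simp: h_def joinpaths_def dist_real_def abs_if split: if_split_asm\<close>)
  have d2: "vector_derivative h (at z) = 2 *\<^sub>R vector_derivative g (at (2 * z - 1))" if "1/2 < z" "z \<le> 1" "2 * z - 1 \<notin> T" for z
  proof (rule vector_derivative_at [OF has_vector_derivative_transform_within])
    show "0 < \<bar>z - 1/2\<bar>" using that by auto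
    have "((\<lambda>x. 2 * x - 1) has_vector_derivative 2) (at z)"
      by (auto intro!: derivative_eq_intros)
    then show "((\<lambda>x. g (2 * x - 1)) has_vector_derivative 2 *\<^sub>R vector_derivative g (at (2 * z - 1))) (at z)"
      using vector_diff_chain_at[of "\<lambda>x. 2 * x - 1" 2 z g] T(2)[of "2 * z - 1"] that by (auto simp: o_def)
  qed (use that in \<open>auto simp: h_def joinpaths_def dist_real_def abs_if split: if_split_asm\<close>)
  have "((\<lambda>x. mat_norm (vector_derivative h (at x))) has_integral L) {0..1/2}"
  proof (rule has_integral_spike_finite[OF _ _ half(1)])
    show "finite (insert (1/2) ((*) 2 -` S))"
      using S(1) by (auto intro: finite_vimageI inj_onI)
  qed (auto simp: d1)
  moreover have "((\<lambda>x. mat_norm (vector_derivative h (at x))) has_integral M) {1/2..1}"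
  proof (rule has_integral_spike_finite[OF _ _ half(2)])
    show "finite (insert (1/2) ((\<lambda>x. 2 * x - 1) -` T))"
      using T(1) by (auto intro!: finite_vimageI inj_onI)
  qed (auto simp: d2)
  ultimately have "has_length h (L + M)"
    unfolding has_length_def by (rule has_integral_combine[rotated 2]) auto
  then show ?thesis
    unfolding SO_curve_def using f g
    by (intro exI[of _ h]) (auto simp: h_def path_image_join valid_path_join)
qed

text \<open>Left invariance of the metric, which reduces curves between arbitrary points to curves
  that start at the identity.\<close>

lemma SO_curve_left_mult:
  assumes "SO_curve X Y L" "Q \<in> SO"
  shows "SO_curve (Q ** X) (Q ** Y) L"
proof -
  obtain g where g: "valid_path g" "path_image g \<subseteq> SO" "pathstart g = X" "pathfinish g = Y" "has_length g L"
    using assms(1) by (auto simp: SO_curve_def)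
  obtain S where S: "finite S" "\<And>t. t \<in> {0..1} - S \<Longrightarrow> (g has_vector_derivative vector_derivative g (at t)) (at t)"
    using valid_path_smoothE[OF g(1)] by metis
  have "vector_derivative ((**) Q \<circ> g) (at t) = Q ** vector_derivative g (at t)" if "t \<in> {0..1} - S" for t
    unfolding o_def
    by (intro vector_derivative_at bounded_linear.has_vector_derivative[OF bounded_linear_matrix_mult_right] S that)
  then have "has_length ((**) Q \<circ> g) L"
    unfolding has_length_def using S(1) g(5) assms(2)
    by (intro has_integral_spike_finite[OF S(1) _ g(5)[unfolded has_length_def]])
      (auto simp: mat_norm_eq norm_orthogonal_matrix_mult SO_D)
  moreover have "valid_path ((**) Q \<circ> g)"
    using g(1) by (intro linear_image_valid_path bounded_linear.linear[OF bounded_linear_matrix_mult_right])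
  ultimately show ?thesis
    unfolding SO_curve_def using g assms(2)
    by (intro exI[of _ "(**) Q \<circ> g"]) (auto simp: path_image_def pathstart_def pathfinish_def intro!: SO_mult)
qed

subsection \<open>Plane rotations and the diameter\<close>

definition outer :: "real^'m \<Rightarrow> real^'n \<Rightarrow> real^'n^'m" where
  "outer a b = (\<chi> i j. a $ i * b $ j)"

lemma outer_mult_vector: "outer a b *v x = inner b x *\<^sub>R a"
  by (simp add: outer_def matrix_vector_mult_def inner_vec_def vec_eq_iff sum_distrib_left sum_distrib_right mult_ac)

lemma transpose_outer: "transpose (outer a b) = outer b a"
  by (simp add: outer_def transpose_def vec_eq_iff mult.commute)

lemma inner_outer: "inner (outer a b) (outer c d) = inner a c * inner b d"
  by (simp add: outer_def inner_vec_def sum_product mult_ac) (rule sum.swap)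

text \<open>For orthonormal \<open>v\<close> and \<open>w\<close> this is the rotation by
  \<open>\<phi>\<close> from \<open>v\<close> towards \<open>w\<close> that fixes their orthogonal
  complement, written without a change of basis.\<close>

definition plane_rotation :: "real^'n \<Rightarrow> real^'n \<Rightarrow> real \<Rightarrow> real^'n^'n" where
  "plane_rotation v w \<phi> = mat 1 + (cos \<phi> - 1) *\<^sub>R (outer v v + outer w w) + sin \<phi> *\<^sub>R (outer w v - outer v w)"

lemma plane_rotation_mult_vector:
  "plane_rotation v w \<phi> *v x = x + (cos \<phi> - 1) *\<^sub>R (inner v x *\<^sub>R v + inner w x *\<^sub>R w)
     + sin \<phi> *\<^sub>R (inner v x *\<^sub>R w - inner w x *\<^sub>R v)"
  by (simp add: plane_rotation_def matrix_vector_mult_add_rdistrib matrix_vector_mult_diff_rdistrib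
     outer_mult_vector scaleR_matrix_vector_assoc[symmetric])

lemma plane_rotation_0 [simp]: "plane_rotation v w 0 = mat 1"
  by (simp add: plane_rotation_def)

lemma plane_rotation_mult:
  assumes "norm v = 1" "norm w = 1" "inner v w = 0"
  shows "plane_rotation v w \<phi> ** plane_rotation v w \<psi> = plane_rotation v w (\<phi> + \<psi>)"
proof -
  have *: "inner v v = 1" "inner w w = 1" "inner w v = 0" using assms by (auto simp: norm_eq_1 inner_commute)
  have "plane_rotation v w \<phi> *v (plane_rotation v w \<psi> *v x) = plane_rotation v w (\<phi> + \<psi>) *v x" for x
  proof -
    define a b where "a = inner v x" and "b = inner w x"
    have y: "inner v (plane_rotation v w \<psi> *v x) = cos \<psi> * a - sin \<psi> * b"
      "inner w (plane_rotation v w \<psi> *v x) = cos \<psi> * b + sin \<psi> * a"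
      using * assms(3) by (simp_all add: plane_rotation_mult_vector a_def b_def inner_add_right inner_diff_right algebra_simps)
    show ?thesis
      unfolding plane_rotation_mult_vector[of v w \<phi>] y
      unfolding plane_rotation_mult_vector a_def[symmetric] b_def[symmetric]
      by (simp add: cos_add sin_add algebra_simps)
  qed
  then show ?thesis by (simp add: matrix_eq flip: matrix_vector_mul_assoc)
qed

lemma transpose_plane_rotation: "transpose (plane_rotation v w \<phi>) = plane_rotation v w (- \<phi>)"
  by (simp add: plane_rotation_def transpose_add transpose_diff transpose_outer transpose_scalar algebra_simps)

text \<open>The determinant is the square of the determinant at half the angle, which is 1 or
  -1.\<close>

lemma plane_rotation_in_SO:
  assumes "norm v = 1" "norm w = 1" "inner v w = 0"
  shows "plane_rotation v w \<phi> \<in> SO"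
proof -
  have o: "orthogonal_matrix (plane_rotation v w \<psi>)" for \<psi>
    by (simp add: orthogonal_matrix_def transpose_plane_rotation plane_rotation_mult[OF assms])
  have "det (plane_rotation v w \<phi>) = det (plane_rotation v w (\<phi>/2)) * det (plane_rotation v w (\<phi>/2))"
    by (simp add: plane_rotation_mult[OF assms] flip: det_mul)
  also have "\<dots> = 1" using det_orthogonal_matrix[OF o[of "\<phi>/2"]] by auto
  finally show ?thesis using o by (simp add: SO_def rotation_matrix_def)
qed

text \<open>Turning the angle uniformly gives constant speed, because the generator
  \<open>outer w v - outer v w\<close> has \<open>mat_norm\<close> 1.\<close>

lemma SO_curve_plane_rotation:
  assumes "norm v = 1" "norm w = 1" "inner v w = 0"
  shows "SO_curve (mat 1) (plane_rotation v w \<theta>) \<bar>\<theta>\<bar>"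
proof -
  define g where "g t = plane_rotation v w (t * \<theta>)" for t
  define g' where "g' t = \<theta> *\<^sub>R (- sin (t * \<theta>) *\<^sub>R (outer v v + outer w w) + cos (t * \<theta>) *\<^sub>R (outer w v - outer v w))" for t
  have vw: "inner v v = 1" "inner w w = 1" "inner w v = 0" using assms by (auto simp: norm_eq_1 inner_commute)
  have "SO_curve (g 0) (g 1) \<bar>\<theta>\<bar>"
  proof (rule SO_curveI)
    fix t :: real
    have "((\<lambda>t. (cos (t * \<theta>) - 1) *\<^sub>R (outer v v + outer w w) + sin (t * \<theta>) *\<^sub>R (outer w v - outer v w)) has_vector_derivative
      ((- sin (t * \<theta>) * \<theta>) *\<^sub>R (outer v v + outer w w) + (cos (t * \<theta>) * \<theta>) *\<^sub>R (outer w v - outer v w))) (at t)"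
      by (rule derivative_eq_intros refl | simp)+
    from has_vector_derivative_add[OF has_vector_derivative_const[of "mat 1"] this]
    show "(g has_vector_derivative g' t) (at t)"
      unfolding g_def g'_def plane_rotation_def
      by (simp add: add.assoc scaleR_add_right scaleR_diff_right mult.commute)
    show "g t \<in> SO" unfolding g_def using assms by (rule plane_rotation_in_SO)
  next
    show "continuous_on {0..1} g'" unfolding g'_def by (intro continuous_intros)
    have "mat_norm (g' t) = \<bar>\<theta>\<bar>" for t
    proof -
      define s c where "s = sin (t * \<theta>)" and "c = cos (t * \<theta>)"
      have "(norm (- s *\<^sub>R (outer v v + outer w w) + c *\<^sub>R (outer w v - outer v w)))\<^sup>2 = 2 * (s\<^sup>2 + c\<^sup>2)"
        unfolding power2_norm_eq_inner using vw assms(3)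
        by (simp add: inner_add_left inner_add_right inner_diff_left inner_diff_right inner_outer power2_eq_square algebra_simps)
      then have "norm (- s *\<^sub>R (outer v v + outer w w) + c *\<^sub>R (outer w v - outer v w)) = sqrt 2"
        unfolding s_def c_def by (metis mult.right_neutral norm_ge_zero real_sqrt_unique sin_cos_squared_add)
      then show ?thesis unfolding g'_def s_def[symmetric] c_def[symmetric] by (simp add: mat_norm_eq)
    qed
    then show "((\<lambda>t. mat_norm (g' t)) has_integral \<bar>\<theta>\<bar>) {0..1}"
      using has_integral_const_real[of "\<bar>\<theta>\<bar>" 0 1] by simp
  qed
  then show ?thesis by (simp add: g_def)
qed

lemma exists_angle:
  fixes c s :: real
  assumes "c\<^sup>2 + s\<^sup>2 = 1"
  obtains \<theta> where "\<bar>\<theta>\<bar> \<le> pi" "cos \<theta> = c" "sin \<theta> = s"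
proof (cases "s \<ge> 0")
  case True
  with sincos_total_pi[OF True assms] show ?thesis using that by force
next
  case False
  then obtain t where "0 \<le> t" "t \<le> pi" "c = cos t" "- s = sin t"
    using sincos_total_pi[of "- s" c] assms by auto
  then show ?thesis using that[of "- t"] by auto
qed

text \<open>Each plane rotation split off from \<open>R\<close> enlarges the space of fixed vectors by two dimensions.\<close>

lemma SO_curve_fixed_space:
  fixes R :: "real^'n^'n"
  assumes "R \<in> SO"
  shows "\<exists>L. SO_curve (mat 1) R L \<and> L \<le> real ((CARD('n) - dim {x. R *v x = x}) div 2) * pi"
  using assms
proof (induction "CARD('n) - dim {x. R *v x = x}" arbitrary: R rule: less_induct)
  case less
  show ?case
  proof (cases "R = mat 1")
    case True
    then show ?thesis using SO_curve_refl[OF SO_one] by (intro exI[of _ 0]) auto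
  next
    case False
    from SO_extremal_rotation_plane[OF less.prems False] obtain v w c s where
      vw: "norm v = 1" "norm w = 1" "inner v w = 0" and
      Rv: "R *v v = c *\<^sub>R v + s *\<^sub>R w" and Rw: "R *v w = - s *\<^sub>R v + c *\<^sub>R w" and
      cs: "c\<^sup>2 + s\<^sup>2 = 1" and c1: "c < 1" by metis
    obtain \<theta> where \<theta>: "\<bar>\<theta>\<bar> \<le> pi" "cos \<theta> = c" "sin \<theta> = s" using exists_angle[OF cs] by blast
    have vw': "inner v v = 1" "inner w w = 1" "inner w v = 0" using vw by (auto simp: norm_eq_1 inner_commute)
    \<comment> \<open>Undoing the rotation in the extremal plane fixes \<open>v\<close> and
      \<open>w\<close> in addition to all vectors that \<open>R\<close> fixes.\<close>
    define M where "M = plane_rotation v w (- \<theta>) ** R"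
    define F where "F = {x. R *v x = x}"
    define G where "G = {x. M *v x = x}"
    have M: "M \<in> SO" unfolding M_def by (intro SO_mult plane_rotation_in_SO vw less.prems)
    have sub: "subspace F" "subspace G"
      unfolding F_def G_def by (auto simp: subspace_def matrix_vector_right_distrib matrix_vector_mult_scaleR)
    \<comment> \<open>A plane rotation with \<open>c < 1\<close> fixes no nonzero vector of its
      plane, so a fixed vector of \<open>R\<close> has no component there.\<close>
    have perp: "inner v x = 0 \<and> inner w x = 0" if "x \<in> F" for x
    proof -
      define a b where "a = inner v x" and "b = inner w x"
      have "inner (R *v v) (R *v x) = a" "inner (R *v w) (R *v x) = b"
        using less.prems by (simp_all add: orthogonal_matrix_inner SO_D a_def b_def)
      then have ab: "a = c * a + s * b" "b = - s * a + c * b"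
        using that unfolding Rv Rw F_def by (simp_all add: inner_add_left inner_diff_left a_def b_def)
      have "((1 - c)\<^sup>2 + s\<^sup>2) * a = (1 - c) * (a - (c * a + s * b)) + s * (b - (- s * a + c * b))"
        "((1 - c)\<^sup>2 + s\<^sup>2) * b = (1 - c) * (b - (- s * a + c * b)) - s * (a - (c * a + s * b))"
        by (simp_all add: power2_eq_square algebra_simps)
      then have "((1 - c)\<^sup>2 + s\<^sup>2) * a = 0" "((1 - c)\<^sup>2 + s\<^sup>2) * b = 0" using ab by auto
      moreover have "(1 - c)\<^sup>2 + s\<^sup>2 > 0" using c1 by (simp add: add_pos_nonneg)
      ultimately show ?thesis by (auto simp: a_def b_def)
    qed
    have M1: "M *v x = plane_rotation v w (- \<theta>) *v (R *v x)" for x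
      by (simp add: M_def matrix_vector_mul_assoc)
    have "F \<subseteq> G"
      unfolding G_def using perp by (auto simp: M1 F_def plane_rotation_mult_vector)
    moreover have "M *v v = (c\<^sup>2 + s\<^sup>2) *\<^sub>R v"
      unfolding M1 Rv plane_rotation_mult_vector using vw vw' \<theta>
      by (simp add: inner_add_right power2_eq_square algebra_simps)
    moreover have "M *v w = (c\<^sup>2 + s\<^sup>2) *\<^sub>R w"
      unfolding M1 Rw plane_rotation_mult_vector using vw vw' \<theta>
      by (simp add: inner_add_right inner_diff_right power2_eq_square algebra_simps)
    ultimately have "insert v (insert w F) \<subseteq> G" using cs by (auto simp: G_def)
    then have "dim (insert v (insert w F)) \<le> dim G" by (rule dim_subset)
    moreover have "w \<notin> span F"
      using perp[of w] vw' sub(1) by (auto simp: span_eq_iff[THEN iffD2])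
    moreover have "v \<notin> span (insert w F)"
    proof
      assume v: "v \<in> span (insert w F)"
      have "orthogonal v v"
        by (rule orthogonal_to_span[OF v]) (use perp vw in \<open>auto simp: orthogonal_def\<close>)
      with vw' show False by (simp add: orthogonal_def)
    qed
    ultimately have d: "dim F + 2 \<le> dim G" by (simp add: dim_insert)
    have dG: "dim G \<le> CARD('n)" using dim_subset_UNIV[of G] by simp
    then have "CARD('n) - dim {x. M *v x = x} < CARD('n) - dim {x. R *v x = x}"
      using d unfolding F_def G_def by linarith
    from less.hyps[OF this M] obtain L where L: "SO_curve (mat 1) M L" "L \<le> real ((CARD('n) - dim G) div 2) * pi"
      unfolding G_def by blast
    \<comment> \<open>The curve to \<open>M\<close> is moved by the rotation and appended to the arc
      that starts at the identity.\<close>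
    have "SO_curve (plane_rotation v w \<theta> ** mat 1) (plane_rotation v w \<theta> ** M) L"
      by (intro SO_curve_left_mult L plane_rotation_in_SO vw)
    moreover have "plane_rotation v w \<theta> ** M = R"
      by (simp add: M_def plane_rotation_mult[OF vw] matrix_mul_assoc)
    ultimately have "SO_curve (mat 1) R (\<bar>\<theta>\<bar> + L)"
      using SO_curve_trans[OF SO_curve_plane_rotation[OF vw]] by simp
    moreover have "\<bar>\<theta>\<bar> + L \<le> real ((CARD('n) - dim F) div 2) * pi"
    proof -
      have "(CARD('n) - dim G) div 2 + 1 \<le> (CARD('n) - dim F) div 2" using d dG by linarith
      then have "(real ((CARD('n) - dim G) div 2) + 1) * pi \<le> real ((CARD('n) - dim F) div 2) * pi"
        by (intro mult_right_mono) (linarith, simp)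
      then show ?thesis using L(2) \<theta>(1) by (simp add: algebra_simps)
    qed
    ultimately show ?thesis unfolding F_def by blast
  qed
qed

text \<open>Keeps the distance to the identity inside the interval on which the influence profile is
  constrained.\<close>

lemma SO_curve_diameter:
  fixes R :: "real^'n^'n"
  assumes "R \<in> SO"
  obtains L where "SO_curve (mat 1) R L" "L \<le> real (CARD('n) div 2) * pi"
proof -
  obtain L where L: "SO_curve (mat 1) R L" "L \<le> real ((CARD('n) - dim {x. R *v x = x}) div 2) * pi"
    using SO_curve_fixed_space[OF assms] by blast
  have "real ((CARD('n) - dim {x. R *v x = x}) div 2) * pi \<le> real (CARD('n) div 2) * pi"
    by (intro mult_right_mono of_nat_mono div_le_mono) auto
  with L show thesis using that[of L] by linarith
qed

subsection \<open>Cayley curves\<close>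

lemma matrix_add_rdistrib: "(A + B) ** C = A ** C + B ** C"
  for A :: "real^'n^'m"
  by (rule bounded_bilinear.add_left[OF bounded_bilinear_matrix_mult])

lemmas matrix_distribs = matrix_add_ldistrib matrix_add_rdistrib matrix_diff_ldistrib matrix_diff_rdistrib
  matrix_mult_scaleR_left matrix_mult_scaleR_right matrix_mult_minus_left matrix_mult_minus_right

text \<open>Up to a factor, this is the rate at which both the coupling term and the Cayley velocity
  change the squared chord.\<close>

lemma SO_trace_square:
  fixes R :: "real^'n^'n"
  assumes "R \<in> SO"
  shows "trace (mat 1 - R ** R) = (mat_norm (R - transpose R))\<^sup>2"
proof -
  have "(mat_norm (R - transpose R))\<^sup>2 = trace (transpose (R - transpose R) ** (R - transpose R)) / 2"
    unfolding mat_norm_def by (simp add: mat_inner_eq mat_inner_def[symmetric])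
  also have "transpose (R - transpose R) ** (R - transpose R) = (mat 1 - R ** R) + transpose (mat 1 - R ** R)"
    using SO_D[OF assms] by (simp add: transpose_diff matrix_distribs matrix_transpose_mul)
  finally show ?thesis by (simp add: trace_add trace_transpose)
qed

lemma norm_one_minus_square_eq:
  fixes R :: "real^'n^'n"
  assumes "R \<in> SO"
  shows "mat_norm (mat 1 - R ** R) = mat_norm (R - transpose R)"
proof -
  have "mat 1 - R ** R = R ** (transpose R - R)"
    using SO_D[OF assms] by (simp add: matrix_distribs)
  then show ?thesis
    using SO_D[OF assms] by (simp add: mat_norm_eq norm_orthogonal_matrix_mult norm_minus_commute)
qed

lemma skew_inner_zero:
  fixes K :: "real^'n^'n"
  assumes "transpose K = - K"
  shows "inner x (K *v x) = 0"
proof -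
  have "inner x (K *v x) = inner (transpose K *v x) x"
    using inner_matrix_transpose[of "transpose K" x x] by (simp del: transpose_matrix_vector)
  also have "\<dots> = - inner x (K *v x)"
    unfolding assms using matrix_vector_mult_diff_rdistrib[of 0 K x] by (simp add: inner_commute)
  finally show ?thesis by simp
qed

text \<open>Skewness gives \<open>inner x ((I + s K) x) = (norm x)^2\<close>, so the inverse exists
  for every real \<open>s\<close> and is a contraction.\<close>

lemma skew_resolvent:
  fixes K :: "real^'n^'n"
  assumes K: "transpose K = - K"
  obtains B :: "real \<Rightarrow> real^'n^'n" where
    "\<And>s. (mat 1 + s *\<^sub>R K) ** B s = mat 1" "\<And>s. B s ** (mat 1 + s *\<^sub>R K) = mat 1"
    "\<And>t. (B has_vector_derivative - (B t ** K ** B t)) (at t)"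
proof -
  have ip: "inner x ((mat 1 + s *\<^sub>R K) *v x) = (norm x)\<^sup>2" for s x
    using skew_inner_zero[OF K, of x]
    by (simp add: matrix_vector_mult_add_rdistrib inner_add_right scaleR_matrix_vector_assoc[symmetric]
        power2_norm_eq_inner del: scaleR_matrix_vector_assoc)
  have "\<exists>C. C ** (mat 1 + s *\<^sub>R K) = mat 1" for s
    unfolding matrix_left_invertible_ker using ip[of _ s] by (metis inner_zero_right norm_eq_zero power_zero_numeral zero_eq_power2)
  then obtain B where B: "\<And>s. B s ** (mat 1 + s *\<^sub>R K) = mat 1" by metis
  then have B': "(mat 1 + s *\<^sub>R K) ** B s = mat 1" for s
    using matrix_left_right_inverse by blast
  have contr: "norm (B s *v y) \<le> norm y" for s y
  proof -
    have y: "(mat 1 + s *\<^sub>R K) *v (B s *v y) = y" by (simp add: matrix_vector_mul_assoc B')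
    have "(norm (B s *v y))\<^sup>2 \<le> norm (B s *v y) * norm y"
      using Cauchy_Schwarz_ineq2[of "B s *v y" y] ip[of "B s *v y" s] unfolding y by simp
    then show ?thesis by (cases "norm (B s *v y) = 0") (auto simp: power2_eq_square mult_le_cancel_left)
  qed
  \<comment> \<open>Each of the \<open>CARD('n)\<close> columns of \<open>B s\<close> has norm at
    most 1.\<close>
  define b where "b = sqrt CARD('n)"
  have b0: "b \<ge> 0" by (simp add: b_def)
  have Bb: "norm (B s) \<le> b" for s
  proof -
    have "(norm (B s))\<^sup>2 \<le> (\<Sum>j\<in>(UNIV::'n set). 1\<^sup>2)"
      unfolding norm_matrix_columns by (intro sum_mono power_mono) (use contr[of s "axis _ 1"] in auto)
    then show ?thesis unfolding b_def by (intro real_le_rsqrt) simp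
  qed
  have "\<exists>M>0. \<forall>(X :: real^'n^'n) Y :: real^'n^'n. norm (X ** Y) \<le> norm X * norm Y * M"
    by (rule bounded_bilinear.pos_bounded[OF bounded_bilinear_matrix_mult])
  then obtain M where M: "M > 0" "\<And>(X :: real^'n^'n) Y :: real^'n^'n. norm (X ** Y) \<le> norm X * norm Y * M"
    by metis
  have KB: "norm (K ** B t) \<le> norm K * b * M" for t
  proof -
    have "norm (K ** B t) \<le> norm K * norm (B t) * M" by (rule M(2))
    also have "\<dots> \<le> norm K * b * M" using M(1) Bb[of t] by (intro mult_right_mono mult_left_mono) auto
    finally show ?thesis .
  qed
  have XKB: "norm ((X :: real^'n^'n) ** K ** B t) \<le> norm X * (norm K * b * M) * M" for X t
  proof -
    have "norm (X ** (K ** B t)) \<le> norm X * norm (K ** B t) * M" by (rule M(2))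
    also have "\<dots> \<le> norm X * (norm K * b * M) * M"
      using M(1) KB[of t] by (intro mult_right_mono mult_left_mono) auto
    finally show ?thesis by (simp add: matrix_mul_assoc)
  qed
  define D where "D = norm K * b * M * M"
  have D: "D \<ge> 0" using b0 M(1) by (simp add: D_def)
  \<comment> \<open>The resolvent identity. With the uniform bound on \<open>B\<close> it gives
    first Lipschitz continuity and then, applied once more, a remainder quadratic in
    \<open>s - t\<close>.\<close>
  have diff: "B s - B t = (t - s) *\<^sub>R (B s ** K ** B t)" for s t
  proof -
    have "B s ** ((mat 1 + t *\<^sub>R K) - (mat 1 + s *\<^sub>R K)) ** B t = B s ** ((mat 1 + t *\<^sub>R K) ** B t) - (B s ** (mat 1 + s *\<^sub>R K)) ** B t"
      by (simp only: matrix_diff_ldistrib matrix_diff_rdistrib matrix_mul_assoc)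
    also have "\<dots> = B s - B t" by (simp only: B B' matrix_mul_lid matrix_mul_rid)
    also have "(mat 1 + t *\<^sub>R K) - (mat 1 + s *\<^sub>R K) = (t - s) *\<^sub>R K"
      by (simp add: scaleR_left_diff_distrib)
    finally show ?thesis
      by (simp only: matrix_mult_scaleR_left matrix_mult_scaleR_right)
  qed
  have lip: "norm (B s - B t) \<le> \<bar>s - t\<bar> * (b * D)" for s t
  proof -
    have "norm (B s - B t) = \<bar>s - t\<bar> * norm (B s ** K ** B t)" unfolding diff by (simp add: abs_minus_commute)
    also have "\<dots> \<le> \<bar>s - t\<bar> * (norm (B s) * D)"
      using XKB[of "B s" t] by (intro mult_left_mono) (auto simp: D_def mult_ac)
    also have "\<dots> \<le> \<bar>s - t\<bar> * (b * D)" using Bb D by (intro mult_left_mono mult_right_mono) auto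
    finally show ?thesis .
  qed
  have "(B has_vector_derivative - (B t ** K ** B t)) (at t)" for t
    unfolding has_vector_derivative_def
  proof (rule has_derivativeI_sandwich[where e=1 and H="\<lambda>s. \<bar>s - t\<bar> * (b * D) * D"])
    show "bounded_linear (\<lambda>x. x *\<^sub>R - (B t ** K ** B t))" by (rule bounded_linear_scaleR_left)
    show "((\<lambda>s. \<bar>s - t\<bar> * (b * D) * D) \<longlongrightarrow> 0) (at t)"
      by (rule tendsto_eq_intros | simp)+
    fix s assume "s \<noteq> t"
    have "B s - B t - (s - t) *\<^sub>R - (B t ** K ** B t) = (t - s) *\<^sub>R ((B s - B t) ** K ** B t)"
    proof -
      have "(s - t) *\<^sub>R - (B t ** K ** B t) = (t - s) *\<^sub>R (B t ** K ** B t)"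
        by (metis minus_diff_eq scaleR_minus_left scaleR_minus_right)
      moreover have "(B s - B t) ** K ** B t = B s ** K ** B t - B t ** K ** B t"
        by (simp only: matrix_diff_rdistrib)
      ultimately show ?thesis by (simp only: diff[of s t] scaleR_diff_right)
    qed
    then have "norm (B s - B t - (s - t) *\<^sub>R - (B t ** K ** B t)) = \<bar>s - t\<bar> * norm ((B s - B t) ** K ** B t)"
      by (simp only: norm_scaleR abs_minus_commute[of t s])
    also have "\<dots> \<le> \<bar>s - t\<bar> * (norm (B s - B t) * D)"
      using XKB[of "B s - B t" t] by (intro mult_left_mono) (auto simp: D_def mult_ac)
    also have "\<dots> \<le> \<bar>s - t\<bar> * (\<bar>s - t\<bar> * (b * D) * D)"
      using lip D by (intro mult_left_mono mult_right_mono) auto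
    finally show "norm (B s - B t - (s - t) *\<^sub>R - (B t ** K ** B t)) / norm (s - t) \<le> \<bar>s - t\<bar> * (b * D) * D"
      using \<open>s \<noteq> t\<close> by (simp add: field_simps)
  qed simp
  with B B' show thesis using that by blast
qed

text \<open>The Cayley curve \<open>(I - s K) (I + s K)\<^sup>-\<^sup>1\<close> follows the gradient lines of the squared chord \<open>\<rho>\<close>,
  along which \<open>d\<rho> \<ge> sqrt (\<rho> (4 - \<rho>)) d\<close>(arc length).\<close>

lemma SO_cayley_curve:
  fixes R :: "real^'n^'n"
  assumes R: "R \<in> SO" and inj: "\<And>x. R *v x = - x \<Longrightarrow> x = 0"
  obtains g g' where "g 0 = mat 1" "g 1 = R" "\<And>t. g t \<in> SO" "\<And>t. (g has_vector_derivative g' t) (at t)"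
    "continuous_on UNIV g'" "\<And>s. s *\<^sub>R g' s = - (1/2) *\<^sub>R (mat 1 - g s ** g s)" 
    "\<And>s. s \<noteq> 0 \<Longrightarrow> g s = mat 1 \<Longrightarrow> R = mat 1"
proof -
  \<comment> \<open>Since -1 is not an eigenvalue, \<open>I + R\<close> is invertible and the Cayley
    transform \<open>K\<close> of \<open>R\<close> exists.\<close>
  have "\<exists>E. E ** (mat 1 + R) = mat 1"
    unfolding matrix_left_invertible_ker using inj
    by (metis add.commute add_eq_0_iff matrix_vector_mul_lid matrix_vector_mult_add_rdistrib)
  then obtain E where E1: "E ** (mat 1 + R) = mat 1" by blast
  then have E2: "(mat 1 + R) ** E = mat 1" using matrix_left_right_inverse by blast
  have cancel: "X = Y" if "(mat 1 + R) ** X = (mat 1 + R) ** Y" for X Y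
    using that E1 by (metis matrix_mul_assoc matrix_mul_lid)
  define K where "K = (mat 1 - R) ** E"
  have K1: "K ** (mat 1 + R) = mat 1 - R" unfolding K_def by (simp only: matrix_mul_assoc[symmetric] E1 matrix_mul_rid)
  have "(mat 1 + R) ** (mat 1 - R) = (mat 1 - R) ** (mat 1 + R)" by (simp add: matrix_distribs)
  then have K2: "(mat 1 + R) ** K = mat 1 - R" unfolding K_def
    by (metis E2 matrix_mul_assoc matrix_mul_rid)
  \<comment> \<open>Transposing the relation that defines \<open>K\<close> and multiplying by
    \<open>R\<close> identifies \<open>K^T\<close> with \<open>- K\<close>.\<close>
  have "(mat 1 + transpose R) ** transpose K = mat 1 - transpose R"
    using arg_cong[OF K1, of transpose] by (simp add: matrix_transpose_mul transpose_add transpose_diff)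
  then have "R ** ((mat 1 + transpose R) ** transpose K) = R ** (mat 1 - transpose R)" by simp
  then have "(mat 1 + R) ** transpose K = (mat 1 + R) ** (- K)"
    using SO_D[OF R] by (simp add: matrix_distribs matrix_mul_assoc K2[simplified matrix_distribs matrix_mul_lid] add.commute)
  then have skew: "transpose K = - K" by (rule cancel)
  obtain B where B1: "\<And>s. (mat 1 + s *\<^sub>R K) ** B s = mat 1" and B2: "\<And>s. B s ** (mat 1 + s *\<^sub>R K) = mat 1"
    and B': "\<And>t. (B has_vector_derivative - (B t ** K ** B t)) (at t)"
    using skew_resolvent[OF skew] by blast
  \<comment> \<open>Equal to \<open>(I - s K) (I + s K)^-1\<close>, but affine in \<open>B s\<close>
    and hence easy to differentiate.\<close>
  define g where "g s = 2 *\<^sub>R B s - mat 1" for s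
  define g' where "g' s = 2 *\<^sub>R - (B s ** K ** B s)" for s
  have g: "g s ** (mat 1 + s *\<^sub>R K) = mat 1 - s *\<^sub>R K" for s
    by (simp add: g_def matrix_diff_rdistrib matrix_mult_scaleR_left B2) (simp add: vec_eq_iff)
  have SO: "g s \<in> SO" for s
  proof -
    have T: "transpose (mat 1 + s *\<^sub>R K) = mat 1 - s *\<^sub>R K" by (simp add: transpose_add transpose_scalar skew)
    have "det (g s) * det (mat 1 + s *\<^sub>R K) = det (mat 1 + s *\<^sub>R K)"
      by (metis T g det_mul det_transpose)
    moreover have "det (mat 1 + s *\<^sub>R K) \<noteq> 0"
      using B1[of s] by (metis det_I det_mul mult_zero_left zero_neq_one)
    ultimately have det: "det (g s) = 1" by simp
    have "norm (g s *v x) = norm x" for x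
    proof -
      define y z where "y = B s *v x" and "z = s *\<^sub>R (K *v y)"
      have x: "x = y + z" using arg_cong[OF B1[of s], of "\<lambda>A. A *v x"]
        by (simp add: y_def z_def matrix_vector_mul_assoc[symmetric] matrix_vector_mult_add_rdistrib scaleR_matrix_vector_assoc)
      have "g s *v x = y - z"
        by (simp add: g_def matrix_vector_mult_diff_rdistrib scaleR_matrix_vector_assoc[symmetric] y_def[symmetric])
          (simp add: x vec_eq_iff)
      moreover have "inner y z = 0" using skew_inner_zero[OF skew, of y] by (simp add: z_def)
      ultimately show ?thesis unfolding x
        by (simp add: norm_eq_sqrt_inner inner_diff_left inner_diff_right inner_add_left inner_add_right inner_commute)
    qed
    then have "orthogonal_transformation ((*v) (g s))" by (simp add: orthogonal_transformation)
    then show ?thesis using det by (simp add: SO_def rotation_matrix_def orthogonal_transformation_matrix)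
  qed
  have "s *\<^sub>R g' s = - (1/2) *\<^sub>R (mat 1 - g s ** g s)" for s
  proof -
    \<comment> \<open>Eliminates \<open>K\<close> from the velocity. For positive \<open>s\<close>
      and in the time \<open>- ln s\<close>, the resulting equation is the Winfree equation with
      zero frequency and constant coefficient 1/2.\<close>
    have sK: "(s *\<^sub>R K) ** B s = mat 1 - B s" using B1[of s] by (simp add: matrix_add_rdistrib algebra_simps)
    have "s *\<^sub>R g' s = (-2) *\<^sub>R (B s ** ((s *\<^sub>R K) ** B s))"
      by (simp add: g'_def matrix_mult_scaleR_left matrix_mult_scaleR_right matrix_mul_assoc)
    also have "\<dots> = - (1/2) *\<^sub>R (mat 1 - g s ** g s)"
      unfolding sK
      by (simp add: g_def matrix_distribs) (simp add: vec_eq_iff algebra_simps)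
    finally show ?thesis .
  qed
  moreover have "(g has_vector_derivative g' t) (at t)" for t
    unfolding g_def g'_def
    using has_vector_derivative_diff[OF has_vector_derivative_scaleR[OF DERIV_const B'[of t]] has_vector_derivative_const] by auto
  moreover have contB: "continuous_on UNIV B"
    using B' by (auto intro!: continuous_at_imp_continuous_on intro: has_vector_derivative_continuous)
  then have "continuous_on UNIV g'"
    unfolding g'_def by (intro continuous_intros continuous_on_matrix_mult)
  moreover have "g 0 = mat 1" using B1[of 0] by (simp add: g_def scaleR_2)
  moreover have "g 1 = R"
  proof -
    have "(mat 1 + K) ** (mat 1 + R) = 2 *\<^sub>R mat 1"
      using K1 by (simp add: matrix_add_rdistrib scaleR_2)
    then have "B 1 ** (mat 1 + K) ** (mat 1 + R) = 2 *\<^sub>R B 1"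
      by (metis matrix_mul_assoc matrix_mul_rid matrix_mult_scaleR_right)
    then have "mat 1 + R = 2 *\<^sub>R B 1" using B2[of 1] by simp
    then show ?thesis by (simp add: g_def flip: \<open>mat 1 + R = 2 *\<^sub>R B 1\<close>)
  qed
  moreover have "R = mat 1" if "s \<noteq> 0" "g s = mat 1" for s
  proof -
    have "s *\<^sub>R K + s *\<^sub>R K = 0" using g[of s] that by (simp add: algebra_simps)
    then have "K = 0" using that(1) by (simp flip: scaleR_2)
    then show "R = mat 1" using K1 by simp
  qed
  ultimately show thesis using SO that by blast
qed

text \<open>Let \<open>\<psi> = arccos (1 - \<rho> / 2)\<close>, the planar angle whose chord is the
  square root of \<open>\<rho>\<close>. Along the Cayley curve the speed is at most
  \<open>\<psi>'\<close>, and integration gives the bound.\<close>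

lemma SO_curve_le_arcsin_chord:
  fixes R :: "real^'n^'n"
  assumes R: "R \<in> SO" and r2: "mat_norm (mat 1 - R) < 2"
  obtains L where "SO_curve (mat 1) R L" "L \<le> 2 * arcsin (mat_norm (mat 1 - R) / 2)"
proof (cases "R = mat 1")
  case True
  have "mat_norm (0 :: real^'n^'n) = 0" by simp
  then show thesis using that[of 0] SO_curve_refl[OF SO_one] True by (simp del: mat_norm_eq_0)
next
  case False
  define r where "r = mat_norm (mat 1 - R)"
  have r: "0 \<le> r" "r < 2" using r2 by (auto simp: r_def)
  \<comment> \<open>On an eigenvector for -1 the matrix \<open>I - R\<close> would stretch by 2, but
    its operator norm is at most \<open>r < 2\<close>.\<close>
  have "x = 0" if "R *v x = - x" for x
  proof (rule ccontr)
    assume "x \<noteq> 0"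
    have "(norm (2 *\<^sub>R x))\<^sup>2 \<le> r\<^sup>2 * (norm x)\<^sup>2"
      using SO_diff_one_operator_bound[OF R, of x] that
      by (simp add: matrix_vector_mult_diff_rdistrib scaleR_2 mat_norm_power2 r_def)
    then have "4 * (norm x)\<^sup>2 \<le> r\<^sup>2 * (norm x)\<^sup>2" by (simp add: power_mult_distrib)
    then have "2\<^sup>2 \<le> r\<^sup>2" using \<open>x \<noteq> 0\<close> by simp
    then show False using r by (metis abs_of_nonneg abs_le_square_iff abs_numeral not_less)
  qed
  then obtain g g' where g0: "g 0 = mat 1" and g1: "g 1 = R" and gSO: "\<And>t. g t \<in> SO" and
    gd: "\<And>t. (g has_vector_derivative g' t) (at t)" and
    g'c: "continuous_on UNIV g'" and g's: "\<And>s. s *\<^sub>R g' s = - (1/2) *\<^sub>R (mat 1 - g s ** g s)" and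
    gn: "\<And>s. s \<noteq> 0 \<Longrightarrow> g s = mat 1 \<Longrightarrow> R = mat 1"
    using SO_cayley_curve[OF R] by blast
  define L where "L = integral {0..1} (\<lambda>t. mat_norm (g' t))"
  have "continuous_on {0..1} (\<lambda>t. mat_norm (g' t))"
    unfolding mat_norm_eq by (intro continuous_intros continuous_on_subset[OF g'c]) auto
  then have L: "((\<lambda>t. mat_norm (g' t)) has_integral L) {0..1}"
    unfolding L_def by (intro integrable_integral integrable_continuous_real)
  have "SO_curve (g 0) (g 1) L"
    by (rule SO_curveI[OF gd continuous_on_subset[OF g'c] gSO L]) auto
  then have 1: "SO_curve (mat 1) R L" by (simp add: g0 g1)
  define \<rho> where "\<rho> s = real CARD('n) - trace (g s)" for s
  define \<rho>' where "\<rho>' s = - trace (g' s)" for s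
  define n where "n s = mat_norm (g s - transpose (g s))" for s
  have \<rho>: "\<rho> s = (mat_norm (mat 1 - g s))\<^sup>2" for s
    using SO_mat_norm_power2_trace[OF gSO] by (simp add: \<rho>_def)
  have \<rho>d: "(\<rho> has_real_derivative \<rho>' s) (at s)" for s
    unfolding \<rho>_def \<rho>'_def has_real_derivative_iff_has_vector_derivative
    using has_vector_derivative_diff[OF has_vector_derivative_const[of "real CARD('n)"]
      bounded_linear.has_vector_derivative[OF bounded_linear_trace gd]] by simp
  have s\<rho>': "s * \<rho>' s = (n s)\<^sup>2 / 2" for s
    using arg_cong[OF g's[of s], of trace] SO_trace_square[OF gSO, of s]
    by (simp add: trace_minus trace_scaleR \<rho>'_def n_def)
  have sg': "s * mat_norm (g' s) = n s / 2" if "s > 0" for s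
    using arg_cong[OF g's[of s], of mat_norm] norm_one_minus_square_eq[OF gSO, of s] that
    by (simp add: n_def mat_norm_eq)
  have \<rho>4: "\<rho> s < 4" if "0 < s" "s \<le> 1" for s
  proof -
    \<comment> \<open>The squared chord is nondecreasing along the curve, so it stays below its
      final value.\<close>
    have "\<rho> s \<le> \<rho> 1"
    proof (rule DERIV_nonneg_imp_nondecreasing[OF that(2)])
      fix x assume "s \<le> x"
      then have "x > 0" using that by simp
      moreover have "x * \<rho>' x \<ge> 0" unfolding s\<rho>' by simp
      ultimately have "\<rho>' x \<ge> 0" by (simp add: zero_le_mult_iff)
      then show "\<exists>y. (\<rho> has_real_derivative y) (at x) \<and> 0 \<le> y" using \<rho>d by blast
    qed
    also have "\<rho> 1 < 2\<^sup>2" unfolding \<rho> g1 using r2 by (intro power_strict_mono) auto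
    finally show ?thesis by simp
  qed
  have \<rho>0: "\<rho> s > 0" if "s > 0" for s
  proof -
    have "mat 1 - g s \<noteq> 0" using gn[of s] that False by auto
    then show ?thesis unfolding \<rho> by simp
  qed
  define \<psi> where "\<psi> s = arccos (1 - \<rho> s / 2)" for s
  \<comment> \<open>The quotient is singular at 0, where \<open>\<rho>\<close> vanishes. Outside the
    open interval the speed itself is taken, so that the pointwise comparison holds there
    trivially.\<close>
  define \<psi>' where "\<psi>' s = (if 0 < s \<and> s < 1 then \<rho>' s / sqrt (\<rho> s * (4 - \<rho> s)) else mat_norm (g' s))" for s
  have "(\<psi>' has_integral (\<psi> 1 - \<psi> 0)) {0..1}"
  proof (rule fundamental_theorem_of_calculus_interior[where f=\<psi> and f'=\<psi>'])
    show "continuous_on {0..1} \<psi>"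
      unfolding \<psi>_def
    proof (rule continuous_on_arccos)
      have "continuous_on {0..1} \<rho>" by (rule DERIV_continuous_on[OF has_field_derivative_at_within[OF \<rho>d]])
      then show "continuous_on {0..1} (\<lambda>s. 1 - \<rho> s / 2)" by (auto intro!: continuous_intros)
    next
      have "-1 \<le> 1 - \<rho> s / 2 \<and> 1 - \<rho> s / 2 \<le> 1" if s: "s \<in> {0..1}" for s
      proof
        show "1 - \<rho> s / 2 \<le> 1" by (simp add: \<rho>)
        have "\<rho> 0 = 0" by (simp add: \<rho> g0)
        then show "-1 \<le> 1 - \<rho> s / 2"
          using \<rho>4[of s] s by (cases "s = 0") auto
      qed
      then show "\<forall>s\<in>{0..1}. - 1 \<le> 1 - \<rho> s / 2 \<and> 1 - \<rho> s / 2 \<le> 1" by blast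
    qed
  next
    fix s :: real assume s: "s \<in> {0<..<1}"
    have p: "\<rho> s > 0" "\<rho> s < 4" using \<rho>0 \<rho>4 s by auto
    have q: "1 - (1 - \<rho> s / 2)\<^sup>2 = \<rho> s * (4 - \<rho> s) / 2\<^sup>2" by (simp add: power2_eq_square field_simps)
    have "sqrt (1 - (1 - \<rho> s / 2)\<^sup>2) = sqrt (\<rho> s * (4 - \<rho> s)) / 2"
      unfolding q real_sqrt_divide by simp
    moreover have "(\<psi> has_real_derivative (- (\<rho>' s / 2)) * inverse (- sqrt (1 - (1 - \<rho> s / 2)\<^sup>2))) (at s)"
    proof -
      have d: "((\<lambda>s. 1 - \<rho> s / 2) has_real_derivative - (\<rho>' s / 2)) (at s)"
        by (auto intro!: derivative_eq_intros \<rho>d)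
      have "DERIV arccos (1 - \<rho> s / 2) :> inverse (- sqrt (1 - (1 - \<rho> s / 2)\<^sup>2))"
        using p by (intro DERIV_arccos) auto
      from DERIV_chain2[OF this d] show ?thesis by (simp add: mult.commute \<psi>_def[abs_def])
    qed
    ultimately show "(\<psi> has_vector_derivative \<psi>' s) (at s)"
      using s by (simp add: \<psi>'_def has_real_derivative_iff_has_vector_derivative[symmetric] field_simps)
  qed simp
  then have "L \<le> \<psi> 1 - \<psi> 0"
  proof (rule has_integral_le[OF L])
    fix s :: real
    show "mat_norm (g' s) \<le> \<psi>' s"
    proof (cases "0 < s \<and> s < 1")
      case True
      have p: "\<rho> s * (4 - \<rho> s) > 0" using \<rho>0 \<rho>4 True by auto
      have "sqrt (\<rho> s * (4 - \<rho> s)) \<le> n s"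
        using SO_mat_norm_diff_transpose_ge[OF gSO, of s] by (intro real_le_lsqrt) (auto simp: n_def \<rho>)
      then have "s * mat_norm (g' s) * sqrt (\<rho> s * (4 - \<rho> s)) \<le> s * \<rho>' s"
        unfolding s\<rho>' sg'[OF conjunct1[OF True]]
        using mult_left_mono[of "sqrt (\<rho> s * (4 - \<rho> s))" "n s" "n s / 2"]
        by (simp add: power2_eq_square n_def)
      then have "mat_norm (g' s) * sqrt (\<rho> s * (4 - \<rho> s)) \<le> \<rho>' s" using True by (simp add: mult.assoc)
      then show ?thesis using True p by (simp add: \<psi>'_def pos_le_divide_eq)
    qed (auto simp: \<psi>'_def)
  qed
  also have "\<psi> 0 = 0"
  proof -
    have "\<rho> 0 = 0" unfolding \<rho> g0 by (simp add: mat_norm_eq)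
    then show ?thesis by (simp add: \<psi>_def)
  qed
  also have "\<psi> 1 = arccos (cos (2 * arcsin (r / 2)))"
    using r by (simp add: \<psi>_def \<rho> g1 r_def[symmetric] cos_double_sin power_divide)
  also have "\<dots> = 2 * arcsin (r / 2)"
    using r arcsin_bounded[of "r/2"] arcsin_le_arcsin[of 0 "r/2"] by (intro arccos_cos) auto
  finally show thesis using that[OF 1] by (simp add: r_def)
qed

subsection \<open>Geodesic distance\<close>

text \<open>With \<open>w\<close> the unit direction of \<open>K v\<close>, skewness gives
  \<open>inner (K w) v = - norm (K v)\<close>. So \<open>K\<close> stretches both vectors of the
  orthonormal pair \<open>v\<close>, \<open>w\<close> by at least \<open>norm (K v)\<close>, and the
  Frobenius norm counts both.\<close>

lemma skew_operator_bound:
  fixes K :: "real^'n^'n"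
  assumes K: "transpose K = - K" and v: "norm v = 1"
  shows "norm (K *v v) \<le> mat_norm K"
proof (cases "K *v v = 0")
  case False
  define w where "w = (K *v v) /\<^sub>R norm (K *v v)"
  have w: "norm w = 1" "inner v w = 0"
    using False skew_inner_zero[OF K, of v] by (auto simp: w_def)
  have "inner w (K *v v) = norm (K *v v)"
    using False by (simp add: w_def flip: power2_norm_eq_inner) (simp add: power2_eq_square)
  moreover have "inner w (K *v v) = inner (transpose K *v w) v"
    using inner_matrix_transpose[of "transpose K" w v] by (simp del: transpose_matrix_vector)
  moreover have "\<dots> = - inner (K *v w) v"
    unfolding K using matrix_vector_mult_diff_rdistrib[of 0 K w] by simp
  ultimately have "norm (K *v v) \<le> norm (K *v w)"
    using Cauchy_Schwarz_ineq2[of "K *v w" v] v by simp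
  then have "(norm (K *v v))\<^sup>2 \<le> (norm (K *v w))\<^sup>2" by (rule power_mono) simp
  then have "(norm (K *v v))\<^sup>2 \<le> (norm K)\<^sup>2 / 2"
    using norm_orthonormal_pair_le[OF v w, of K] by linarith
  then show ?thesis unfolding mat_norm_power2[symmetric] by (rule power2_le_imp_le) simp
qed simp

text \<open>Equivalently, the angle between \<open>v\<close> and \<open>g t v\<close> changes at rate at most \<open>mat_norm g'\<close>.\<close>

lemma SO_inner_derivative_bound:
  fixes g :: "real \<Rightarrow> real^'n^'n"
  assumes g: "(g has_vector_derivative g') (at t)" and t: "t \<in> S" "open S" "\<And>s. s \<in> S \<Longrightarrow> g s \<in> SO"
    and v: "norm v = 1"
  shows "\<bar>inner v (g' *v v)\<bar> \<le> sqrt (1 - (inner v (g t *v v))\<^sup>2) * mat_norm g'"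
proof -
  \<comment> \<open>The velocity translated back to the identity; differentiating
    \<open>g^T g = I\<close> shows that it is skew.\<close>
  define K where "K = transpose (g t) ** g'"
  have o: "g t \<in> SO" using t by blast
  have "((\<lambda>t. transpose (g t) ** g t) has_vector_derivative (transpose (g t) ** g' + transpose g' ** g t)) (at t)"
    by (intro has_vector_derivative_matrix_mult bounded_linear.has_vector_derivative[OF bounded_linear_transpose] g)
  moreover have "((\<lambda>t. transpose (g t) ** g t) has_vector_derivative 0) (at t)"
    by (rule has_vector_derivative_transform_within_open[OF has_vector_derivative_const[of "mat 1"] t(2,1)])
      (use t(3) in \<open>simp add: SO_D\<close>)
  ultimately have "transpose (g t) ** g' + transpose g' ** g t = 0"
    by (rule vector_derivative_unique_at)
  then have "K + transpose K = 0" by (simp add: K_def matrix_transpose_mul)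
  then have skew: "transpose K = - K" by (simp add: eq_neg_iff_add_eq_0 add.commute)
  have g': "g' = g t ** K" using SO_D[OF o] by (simp add: K_def matrix_mul_assoc)
  have m: "mat_norm g' = mat_norm K"
    unfolding g' using SO_D[OF o] by (simp add: mat_norm_eq norm_orthogonal_matrix_mult)
  define u where "u = transpose (g t) *v v"
  define \<phi> where "\<phi> = inner u v"
  have nu: "norm u = 1" using SO_D(1)[OF SO_transpose[OF o]] v by (simp add: u_def del: transpose_matrix_vector)
  have \<phi>: "inner v (g t *v v) = \<phi>"
    using inner_matrix_transpose[of "g t" v v] by (simp add: \<phi>_def u_def inner_commute del: transpose_matrix_vector)
  have "inner v (g' *v v) = inner (g t *v (K *v v)) v" unfolding g' by (simp add: matrix_vector_mul_assoc inner_commute)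
  also have "\<dots> = inner (K *v v) u" unfolding u_def by (rule inner_matrix_transpose)
  \<comment> \<open>As \<open>K v\<close> is orthogonal to \<open>v\<close>, only the component of
    \<open>u\<close> orthogonal to \<open>v\<close> counts, and its length is
    \<open>sqrt (1 - \<phi>^2)\<close>.\<close>
  also have "\<dots> = inner (u - \<phi> *\<^sub>R v) (K *v v)"
    using skew_inner_zero[OF skew, of v] by (simp add: inner_diff_left inner_commute[of "K *v v" u])
  finally have "\<bar>inner v (g' *v v)\<bar> \<le> norm (u - \<phi> *\<^sub>R v) * norm (K *v v)"
    using Cauchy_Schwarz_ineq2 by metis
  moreover have "(norm (u - \<phi> *\<^sub>R v))\<^sup>2 = 1 - \<phi>\<^sup>2"
    unfolding power2_norm_eq_inner using nu v
    by (simp add: inner_diff_left inner_diff_right norm_eq_1 inner_commute[of v u] power2_eq_square flip: \<phi>_def)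
  then have "norm (u - \<phi> *\<^sub>R v) = sqrt (1 - \<phi>\<^sup>2)" by (metis norm_ge_zero real_sqrt_unique)
  ultimately show ?thesis
    unfolding \<phi> m using mult_left_mono[OF skew_operator_bound[OF skew v] norm_ge_zero[of "u - \<phi> *\<^sub>R v"]] by simp
qed

text \<open>The angle between \<open>v\<close> and \<open>g t v\<close> starts at 0 and grows at
  most as fast as arc length, so it ends at most at \<open>L\<close>; the cosine reverses this on
  the interval from 0 to pi.\<close>

lemma SO_curve_inner_ge:
  fixes X :: "real^'n^'n"
  assumes c: "SO_curve (mat 1) X L" and L: "L \<le> pi" and v: "norm v = 1"
  shows "cos L \<le> inner v (X *v v)"
proof -
  obtain g where g: "valid_path g" "path_image g \<subseteq> SO" "g 0 = mat 1" "g 1 = X" "has_length g L"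
    using c by (auto simp: SO_curve_def pathstart_def pathfinish_def)
  obtain S where S: "finite S" "\<And>t. t \<in> {0..1} - S \<Longrightarrow> (g has_vector_derivative vector_derivative g (at t)) (at t)"
    "continuous_on {0..1} g" using valid_path_smoothE[OF g(1)] by blast
  have gSO: "g t \<in> SO" if "t \<in> {0..1}" for t using g(2) that by (auto simp: path_image_def)
  define \<phi> where "\<phi> t = inner v (g t *v v)" for t
  have bl: "bounded_linear (\<lambda>A::real^'n^'n. inner v (A *v v))"
    by (auto simp: linear_conv_bounded_linear[symmetric] linear_iff matrix_vector_mult_add_rdistrib inner_add_right
       scaleR_matrix_vector_assoc[symmetric] simp del: scaleR_matrix_vector_assoc)
  have \<phi>1: "\<bar>\<phi> t\<bar> \<le> 1" if "t \<in> {0..1}" for t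
    using Cauchy_Schwarz_ineq2[of v "g t *v v"] gSO[OF that] v by (simp add: \<phi>_def SO_D)
  have \<phi>c: "continuous_on {0..1} \<phi>"
    unfolding \<phi>_def by (rule bounded_linear.continuous_on[OF bl S(3)])
  have \<phi>0: "\<phi> 0 = 1" using v by (simp add: \<phi>_def g norm_eq_1)
  text \<open>The factor \<open>q < 1\<close> keeps \<open>q \<phi>\<close> away from the points where \<open>arccos\<close> is not differentiable.\<close>
  have q: "arccos (q * \<phi> 1) - arccos q \<le> L" if q: "0 \<le> q" "q < 1" for q
  proof -
    have q\<phi>: "\<bar>q * \<phi> t\<bar> < 1" if "t \<in> {0..1}" for t
      using mult_left_mono[OF \<phi>1[OF that] q(1)] q by (simp add: abs_mult)
    define \<phi>' where "\<phi>' t = inner v (vector_derivative g (at t) *v v)" for t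
    define \<psi> where "\<psi> t = arccos (q * \<phi> t)" for t
    define \<psi>' where "\<psi>' t = (if t \<in> {0<..<1} - S then q * \<phi>' t * inverse (- sqrt (1 - (q * \<phi> t)\<^sup>2)) else 0)" for t
    have "(\<psi>' has_integral (\<psi> 1 - \<psi> 0)) {0..1}"
    proof (rule fundamental_theorem_of_calculus_interior_strong[OF S(1), where f=\<psi> and f'=\<psi>'])
      have "\<forall>t\<in>{0..1}. - 1 \<le> q * \<phi> t \<and> q * \<phi> t \<le> 1" using q\<phi> by (auto simp: abs_less_iff less_imp_le)
      then show "continuous_on {0..1} \<psi>"
        unfolding \<psi>_def by (intro continuous_on_arccos continuous_intros \<phi>c)
      fix t assume t: "t \<in> {0<..<1} - S"
      have "(\<phi> has_vector_derivative \<phi>' t) (at t)"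
        unfolding \<phi>_def \<phi>'_def using t by (intro bounded_linear.has_vector_derivative[OF bl] S) auto
      then have d: "((\<lambda>t. q * \<phi> t) has_real_derivative q * \<phi>' t) (at t)"
        unfolding has_real_derivative_iff_has_vector_derivative[symmetric] by (rule DERIV_cmult)
      have "DERIV arccos (q * \<phi> t) :> inverse (- sqrt (1 - (q * \<phi> t)\<^sup>2))"
        using q\<phi>[of t] t by (intro DERIV_arccos) auto
      from DERIV_chain2[OF this d] show "(\<psi> has_vector_derivative \<psi>' t) (at t)"
        using t by (simp add: \<psi>_def[abs_def] \<psi>'_def has_real_derivative_iff_has_vector_derivative[symmetric] mult.commute)
    qed simp
    then have "\<psi> 1 - \<psi> 0 \<le> L"
    proof (rule has_integral_le[OF _ g(5)[unfolded has_length_def]])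
      fix t :: real
      show "\<psi>' t \<le> mat_norm (vector_derivative g (at t))"
      proof (cases "t \<in> {0<..<1} - S")
        case True
        define m where "m = mat_norm (vector_derivative g (at t))"
        have m: "m \<ge> 0" by (simp add: m_def)
        have b: "\<bar>\<phi>' t\<bar> \<le> sqrt (1 - (\<phi> t)\<^sup>2) * m"
          unfolding \<phi>_def \<phi>'_def m_def
          by (rule SO_inner_derivative_bound[of g _ t "{0<..<1}"]) (use True S gSO v in auto)
        have q2: "q\<^sup>2 \<le> 1" using q by (simp add: power_le_one)
        have pos: "0 < 1 - (q * \<phi> t)\<^sup>2" using q\<phi>[of t] True by (simp add: abs_square_less_1)
        \<comment> \<open>From \<open>q^2 - (q \<phi>)^2 \<le> 1 - (q \<phi>)^2\<close>: the speed
          bound for \<open>\<phi>\<close> passes to \<open>q \<phi>\<close>.\<close>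
        have "q * sqrt (1 - (\<phi> t)\<^sup>2) = sqrt (q\<^sup>2 * (1 - (\<phi> t)\<^sup>2))" using q by (simp add: real_sqrt_mult)
        also have "\<dots> \<le> sqrt (1 - (q * \<phi> t)\<^sup>2)"
          using q2 by (simp add: power_mult_distrib algebra_simps)
        finally have "q * sqrt (1 - (\<phi> t)\<^sup>2) * m \<le> sqrt (1 - (q * \<phi> t)\<^sup>2) * m" using m by (rule mult_right_mono)
        moreover have "- (q * \<phi>' t) \<le> q * (sqrt (1 - (\<phi> t)\<^sup>2) * m)"
          using mult_left_mono[of "- \<phi>' t" _ q] b q(1) by (simp add: abs_le_iff)
        ultimately have "- (q * \<phi>' t) \<le> m * sqrt (1 - (q * \<phi> t)\<^sup>2)" by (simp add: mult_ac)
        then have "- (q * \<phi>' t) / sqrt (1 - (q * \<phi> t)\<^sup>2) \<le> m"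
          using pos by (subst pos_divide_le_eq) auto
        then show ?thesis using True by (simp add: \<psi>'_def m_def field_simps)
      qed (auto simp: \<psi>'_def)
    qed
    then show ?thesis by (simp add: \<psi>_def \<phi>0)
  qed
  \<comment> \<open>Admissible factors that tend to 1; continuity of \<open>arccos\<close> up to the
    end points removes the regularisation.\<close>
  define Q where "Q n = real n / real (Suc n)" for n
  have Q: "0 \<le> Q n" "Q n < 1" for n by (auto simp: Q_def)
  have Q1: "Q \<longlonglongrightarrow> 1" unfolding Q_def by (rule LIMSEQ_n_over_Suc_n)
  have p: "\<bar>\<phi> 1\<bar> \<le> 1" using \<phi>1 by simp
  have "continuous_on {0..1} (\<lambda>q. arccos (q * \<phi> 1) - arccos q)"
  proof (intro continuous_intros continuous_on_arccos ballI conjI)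
    fix r :: real assume r: "r \<in> {0..1}"
    have "\<bar>r * \<phi> 1\<bar> \<le> 1" using r p by (simp add: abs_mult mult_le_one)
    then show "-1 \<le> r * \<phi> 1" "r * \<phi> 1 \<le> 1" by auto
  qed auto
  then have "(\<lambda>n. arccos (Q n * \<phi> 1) - arccos (Q n)) \<longlonglongrightarrow> arccos (1 * \<phi> 1) - arccos 1"
    by (rule continuous_on_tendsto_compose[OF _ Q1]) (use Q in \<open>auto simp: less_imp_le\<close>)
  then have "arccos (\<phi> 1) \<le> L"
    by (rule LIMSEQ_le_const2[THEN order_trans[rotated]]) (use q Q in auto)
  then have "cos L \<le> cos (arccos (\<phi> 1))"
    using p L arccos_lbound[of "\<phi> 1"] by (intro cos_monotone_0_pi_le) auto
  then show ?thesis using p by (simp add: \<phi>_def g abs_le_iff)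
qed

lemma SO_curve_exists:
  fixes X :: "real^'n^'n"
  assumes "X \<in> SO" "Y \<in> SO"
  obtains L where "SO_curve X Y L" "L \<le> real (CARD('n) div 2) * pi"
proof -
  obtain L where L: "SO_curve (mat 1) (transpose X ** Y) L" "L \<le> real (CARD('n) div 2) * pi"
    using SO_curve_diameter SO_mult[OF SO_transpose[OF assms(1)] assms(2)] by blast
  have "SO_curve (X ** mat 1) (X ** (transpose X ** Y)) L"
    by (rule SO_curve_left_mult[OF L(1) assms(1)])
  with L(2) show thesis using that SO_D[OF assms(1)] by (simp add: matrix_mul_assoc)
qed

lemma SO_dist_le: "SO_curve X Y L \<Longrightarrow> SO_dist X Y \<le> L"
  unfolding SO_dist_eq by (intro cInf_lower bdd_belowI[of _ 0]) (auto dest: SO_curve_nonneg)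

lemma SO_dist_le_diameter:
  fixes X :: "real^'n^'n"
  assumes "X \<in> SO" "Y \<in> SO"
  shows "SO_dist X Y \<le> real (CARD('n) div 2) * pi"
  using SO_curve_exists[OF assms] SO_dist_le order_trans by metis

lemma SO_dist_nonneg:
  assumes "X \<in> SO" "Y \<in> SO"
  shows "0 \<le> SO_dist X Y"
  unfolding SO_dist_eq using SO_curve_exists[OF assms] by (intro cInf_greatest) (auto dest: SO_curve_nonneg)

lemma SO_dist_lessE:
  assumes "X \<in> SO" "Y \<in> SO" "SO_dist X Y < r"
  obtains L where "SO_curve X Y L" "L < r"
  using cInf_lessD[of "{L. SO_curve X Y L}" r] SO_curve_exists[OF assms(1,2)] assms(3)
  unfolding SO_dist_eq by blast

lemma SO_dist_triangle:
  assumes "X \<in> SO" "Y \<in> SO" "Z \<in> SO"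
  shows "SO_dist X Z \<le> SO_dist X Y + SO_dist Y Z"
proof (rule field_le_epsilon)
  fix e :: real assume "e > 0"
  then obtain L M where "SO_curve X Y L" "L < SO_dist X Y + e/2" "SO_curve Y Z M" "M < SO_dist Y Z + e/2"
    using SO_dist_lessE[of X Y "SO_dist X Y + e/2"] SO_dist_lessE[of Y Z "SO_dist Y Z + e/2"] assms
    by (metis half_gt_zero less_add_same_cancel1)
  then show "SO_dist X Z \<le> SO_dist X Y + SO_dist Y Z + e"
    using SO_dist_le[OF SO_curve_trans, of X Y L Z M] by linarith
qed

lemma SO_dist_le_arcsin:
  assumes "X \<in> SO" "Y \<in> SO" "mat_norm (X - Y) < 2"
  shows "SO_dist X Y \<le> 2 * arcsin (mat_norm (X - Y) / 2)"
proof -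
  have X: "X ** transpose X = mat 1" using SO_D[OF assms(1)] by simp
  have "X - Y = X ** (mat 1 - transpose X ** Y)"
    by (simp add: matrix_diff_ldistrib matrix_mul_assoc X)
  then have e: "mat_norm (X - Y) = mat_norm (mat 1 - transpose X ** Y)"
    using SO_D[OF assms(1)] by (simp add: mat_norm_eq norm_orthogonal_matrix_mult)
  have "mat_norm (mat 1 - transpose X ** Y) < 2" using assms(3) e by simp
  from SO_curve_le_arcsin_chord[OF SO_mult[OF SO_transpose[OF assms(1)] assms(2)] this]
  obtain L where L: "SO_curve (mat 1) (transpose X ** Y) L" "L \<le> 2 * arcsin (mat_norm (X - Y) / 2)"
    unfolding e by blast
  have "SO_curve (X ** mat 1) (X ** (transpose X ** Y)) L"
    by (rule SO_curve_left_mult[OF L(1) assms(1)])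
  then have "SO_curve X Y L" by (simp add: matrix_mul_assoc X)
  with L(2) show ?thesis using SO_dist_le by force
qed

text \<open>Since \<open>1 < pi / 3\<close>, the cosine is at least 1/2 on [0, 1]; hence
  \<open>sin c \<ge> c / 2\<close>, that is, \<open>arcsin (c / 2) \<le> c\<close>.\<close>

lemma SO_dist_le_two_chord:
  assumes "X \<in> SO" "Y \<in> SO" "mat_norm (X - Y) \<le> 1"
  shows "SO_dist X Y \<le> 2 * mat_norm (X - Y)"
proof -
  define c where "c = mat_norm (X - Y)"
  have c: "0 \<le> c" "c \<le> 1" using assms by (auto simp: c_def)
  have "(\<lambda>x. sin x - x / 2) 0 \<le> (\<lambda>x. sin x - x / 2) c"
  proof (rule DERIV_nonneg_imp_nondecreasing[OF c(1)])
    fix x assume x: "0 \<le> x" "x \<le> c"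
    have "cos (pi / 3) \<le> cos x" using x c pi_gt3 by (intro cos_monotone_0_pi_le) auto
    moreover have "((\<lambda>x. sin x - x / 2) has_real_derivative (cos x - 1 / 2)) (at x)"
      by (auto intro!: derivative_eq_intros)
    ultimately show "\<exists>y. ((\<lambda>x. sin x - x / 2) has_real_derivative y) (at x) \<and> 0 \<le> y"
      by (intro exI[of _ "cos x - 1/2"]) (auto simp: cos_60)
  qed
  then have "arcsin (c / 2) \<le> c"
    using c pi_gt3 by (subst arcsin_le_iff) auto
  with SO_dist_le_arcsin[OF assms(1,2)] show ?thesis using c by (simp add: c_def)
qed

lemma SO_dist_ge_chord:
  assumes "X \<in> SO" "Y \<in> SO"
  shows "mat_norm (X - Y) \<le> SO_dist X Y"
  unfolding SO_dist_eq using SO_curve_exists[OF assms] by (intro cInf_greatest) (auto dest: SO_curve_chord)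

text \<open>The difference quotients must be bounded for the supremum to dominate them. Chords up to
  1 are comparable with distances, and for longer chords the diameter bounds the difference of the
  distances to the identity.\<close>

lemma influence_Lip_star:
  fixes X Y :: "real^'n^'n"
  assumes f: "C-lipschitz_on {0..real (CARD('n) div 2) * pi} f" and X: "X \<in> SO" and Y: "Y \<in> SO"
  shows "\<bar>influence f X - influence f Y\<bar> \<le> Lip_star (influence f :: real^'n^'n \<Rightarrow> real) * mat_norm (X - Y)"
proof (cases "X = Y")
  case True
  then show ?thesis by (simp add: mat_norm_eq)
next
  case False
  define B where "B = real (CARD('n) div 2) * pi"
  have B: "B \<ge> 0" by (simp add: B_def)
  have C: "C \<ge> 0" using f by (rule lipschitz_on_nonneg)
  have dr: "SO_dist (mat 1) Z \<in> {0..B}" if "Z \<in> SO" for Z :: "real^'n^'n"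
    using SO_dist_nonneg[OF SO_one that] SO_dist_le_diameter[OF SO_one that] by (simp add: B_def)
  have bound: "\<bar>influence f X - influence f Y\<bar> / mat_norm (X - Y) \<le> C * (2 + B)"
    if X: "X \<in> SO" and Y: "Y \<in> SO" and "X \<noteq> Y" for X Y :: "real^'n^'n"
  proof -
    define c where "c = mat_norm (X - Y)"
    have c: "c > 0" using \<open>X \<noteq> Y\<close> unfolding c_def by simp
    define a b where "a = SO_dist (mat 1) X" and "b = SO_dist (mat 1) Y"
    have ab: "a \<in> {0..B}" "b \<in> {0..B}" unfolding a_def b_def using dr X Y by auto
    have "\<bar>a - b\<bar> \<le> (2 + B) * c"
    proof (cases "c \<le> 1")
      case True
      have "SO_dist Y X \<le> 2 * c" "SO_dist X Y \<le> 2 * c"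
        using SO_dist_le_two_chord[OF X Y] SO_dist_le_two_chord[OF Y X] True
        unfolding c_def by (simp_all add: mat_norm_minus_commute[of Y X])
      then have "\<bar>a - b\<bar> \<le> 2 * c"
        using SO_dist_triangle[OF SO_one X Y] SO_dist_triangle[OF SO_one Y X] unfolding a_def b_def by linarith
      also have "\<dots> \<le> (2 + B) * c" using B c by simp
      finally show ?thesis .
    next
      case False
      have "\<bar>a - b\<bar> \<le> B * 1" using ab by auto
      also have "\<dots> \<le> (2 + B) * c" using False B c by (intro mult_mono) auto
      finally show ?thesis .
    qed
    then have "C * \<bar>a - b\<bar> \<le> C * ((2 + B) * c)" using C by (rule mult_left_mono)
    moreover have "\<bar>f a - f b\<bar> \<le> C * \<bar>a - b\<bar>"
      using lipschitz_onD[OF f[folded B_def] ab] by (simp add: dist_real_def)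
    ultimately show ?thesis
      using c by (simp add: influence_def a_def b_def c_def field_simps)
  qed
  define Z where "Z = {\<bar>influence f X - influence f Y\<bar> / mat_norm (X - Y) | X Y :: real^'n^'n. X \<in> SO \<and> Y \<in> SO \<and> X \<noteq> Y}"
  have "bdd_above Z" unfolding Z_def using bound by (intro bdd_aboveI[of _ "C * (2 + B)"]) auto
  moreover have "\<bar>influence f X - influence f Y\<bar> / mat_norm (X - Y) \<in> Z" unfolding Z_def using X Y False by blast
  ultimately have "\<bar>influence f X - influence f Y\<bar> / mat_norm (X - Y) \<le> Lip_star (influence f :: real^'n^'n \<Rightarrow> real)"
    unfolding Lip_star_def Z_def[symmetric] by (intro cSup_upper)
  moreover have "mat_norm (X - Y) > 0"
    using False by simp
  ultimately show ?thesis by (simp add: pos_divide_le_eq)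
qed

subsection \<open>Differential inequalities\<close>

text \<open>First-exit argument for all components at once. At the first time when some component is
  nonnegative, all are at most 0 and one vanishes; its negative derivative would make it positive
  slightly earlier.\<close>

lemma barrier:
  fixes f :: "'k::finite \<Rightarrow> real \<Rightarrow> real"
  assumes cont: "\<And>i. continuous_on {a..} (f i)" and init: "\<And>i. f i a < 0"
    and der: "\<And>i t. t > a \<Longrightarrow> (\<And>j. f j t \<le> 0) \<Longrightarrow> f i t = 0 \<Longrightarrow> \<exists>D<0. (f i has_real_derivative D) (at t)"
    and s: "a \<le> s"
  shows "f i s < 0"
proof (rule ccontr)
  assume "\<not> f i s < 0"
  define A where "A = (\<Union>i. {t \<in> {a..s}. 0 \<le> f i t})"
  have "compact {t \<in> {a..s}. 0 \<le> f i t}" for i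
  proof -
    have "continuous_on {a..s} (f i)" by (rule continuous_on_subset[OF cont]) auto
    then have "closed ({a..s} \<inter> f i -` {0..})" by (intro continuous_closed_preimage) auto
    moreover have "{a..s} \<inter> f i -` {0..} = {t \<in> {a..s}. 0 \<le> f i t}" by auto
    ultimately show ?thesis using bounded_subset[of "{a..s}"] by (auto simp: compact_eq_bounded_closed)
  qed
  then have "compact A" unfolding A_def by (intro compact_UN) auto
  moreover have "s \<in> A" unfolding A_def using \<open>\<not> f i s < 0\<close> s by (auto intro!: exI[of _ i])
  ultimately obtain t where t: "t \<in> A" "\<And>r. r \<in> A \<Longrightarrow> t \<le> r"
    using compact_attains_inf[of A] by blast
  obtain j where j: "0 \<le> f j t" and tas: "a \<le> t" "t \<le> s" using t(1) by (auto simp: A_def)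
  then have at: "a < t" using init[of j] by (cases "a = t") auto
  \<comment> \<open>By the intermediate value theorem a positive component would have vanished
    before \<open>t\<close>.\<close>
  have le: "f l t \<le> 0" for l
  proof (rule ccontr)
    assume l: "\<not> f l t \<le> 0"
    have "continuous_on {a..t} (f l)" by (rule continuous_on_subset[OF cont]) auto
    then obtain x where x: "a \<le> x" "x \<le> t" "f l x = 0"
      using IVT'[of "f l" a 0 t] init[of l] l tas by auto
    then have "x \<in> A" using tas by (auto simp: A_def intro!: exI[of _ l])
    then have "x = t" using t(2) x by force
    then show False using x l by simp
  qed
  obtain D where D: "D < 0" "(f j has_real_derivative D) (at t)"
    using der[OF at le, of j] j le[of j] by auto
  obtain d where d: "d > 0" "\<And>h. 0 < h \<Longrightarrow> h < d \<Longrightarrow> f j t < f j (t - h)"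
    using DERIV_neg_dec_left[OF D(2,1)] by blast
  define h where "h = min (d / 2) (t - a)"
  have h: "0 < h" "h < d" "h \<le> t - a" using d(1) at by (auto simp: h_def)
  then have "t - h \<in> A" unfolding A_def using d(2)[of h] j tas by (auto intro!: exI[of _ j])
  then show False using t(2)[of "t - h"] h by simp
qed

lemma decreasing_reaches_level:
  fixes f :: "real \<Rightarrow> real"
  assumes cont: "continuous_on {a..} f" and \<delta>: "\<delta> > 0"
    and der: "\<And>t. t > a \<Longrightarrow> (f has_real_derivative f' t) (at t)"
    and le: "\<And>t. t > a \<Longrightarrow> c \<le> f t \<Longrightarrow> f' t \<le> - \<delta>"
  obtains t where "t \<ge> a" "f t < c"
proof (rule ccontr)
  assume none: "\<not> thesis"
  note found = that
  have c: "c \<le> f t" if "t \<ge> a" for t using none found[OF that] by (meson not_le)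
  \<comment> \<open>At slope \<open>- \<delta>\<close> the level \<open>c\<close> is reached after
    time \<open>(f a - c) / \<delta>\<close>; the extra 1 leaves a margin of
    \<open>\<delta>\<close>.\<close>
  define t where "t = a + (f a - c) / \<delta> + 1"
  have t: "a < t" using c[of a] \<delta> by (simp add: t_def add_nonneg_pos)
  have "continuous_on {a..t} f" by (rule continuous_on_subset[OF cont]) auto
  moreover have "f differentiable (at x)" if "a < x" for x
    using der[OF that] real_differentiable_def by blast
  ultimately obtain l z where z: "a < z" "z < t" "(f has_real_derivative l) (at z)" "f t - f a = (t - a) * l"
    using MVT[OF t] by metis
  have "l \<le> - \<delta>" using DERIV_unique[OF z(3) der[OF z(1)]] le[OF z(1)] c[of z] z(1) by simp
  then have "(t - a) * l \<le> (t - a) * (- \<delta>)" using t by (intro mult_left_mono) auto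
  also have "\<dots> = c - f a - \<delta>" using \<delta> by (simp add: t_def field_simps)
  finally have "f t < c" using z(4) \<delta> by simp
  then show False using c[of t] t by simp
qed

text \<open>The functions \<open>sqrt (u i)\<close> need not be differentiable where \<open>u i\<close> vanishes, hence the
  regularisation \<open>sqrt (u i + \<epsilon>\<^sup>2)\<close>.\<close>

lemma sum_sqrt_exponential_decay:
  fixes u :: "'k::finite \<Rightarrow> real \<Rightarrow> real"
  assumes cont: "\<And>i. continuous_on {T..} (u i)" and nonneg: "\<And>i t. T \<le> t \<Longrightarrow> 0 \<le> u i t"
    and der: "\<And>i t. T < t \<Longrightarrow> (u i has_real_derivative u' i t) (at t)"
    and bound: "\<And>i t. T < t \<Longrightarrow> u' i t \<le> - 2 * a * u i t + 2 * b * (\<Sum>j\<in>UNIV. sqrt (u j t)) * sqrt (u i t)"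
    and a: "a \<ge> 0" and b: "b \<ge> 0" and l: "l = a - real CARD('k) * b" "l > 0" and t: "T \<le> t"
  shows "(\<Sum>i\<in>UNIV. sqrt (u i t)) \<le> exp (- l * (t - T)) * (\<Sum>i\<in>UNIV. sqrt (u i T))"
proof -
  define N where "N = real CARD('k)"
  define E where "E = exp (- l * (t - T))"
  \<comment> \<open>Collects the regularisation errors per unit of \<open>\<epsilon>\<close>: the
    stationary level \<open>c\<close> and the \<open>N\<close> initial errors, damped by
    \<open>E\<close>.\<close>
  define C where "C = a * N / l + N * E"
  have C: "C \<ge> 0" using a l by (simp add: C_def N_def E_def)
  have est: "(\<Sum>i\<in>UNIV. sqrt (u i t)) \<le> E * (\<Sum>i\<in>UNIV. sqrt (u i T)) + C * \<epsilon>" if \<epsilon>: "\<epsilon> > 0" for \<epsilon>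
  proof -
    define y where "y i s = sqrt (u i s + \<epsilon>\<^sup>2)" for i s
    define Y where "Y s = (\<Sum>i\<in>UNIV. y i s)" for s
    \<comment> \<open>The regularised sum satisfies \<open>Y' \<le> - l Y + a N \<epsilon>\<close>;
      \<open>c\<close> is the stationary value of this bound, and \<open>Z\<close> carries the
      integrating factor.\<close>
    define c where "c = a * N * \<epsilon> / l"
    define Z where "Z s = (Y s - c) * exp (l * s)" for s
    have y: "y i s \<ge> \<epsilon>" "sqrt (u i s) \<le> y i s" "(y i s)\<^sup>2 = u i s + \<epsilon>\<^sup>2" "y i s > 0" if "T \<le> s" for i s
    proof -
      show "y i s \<ge> \<epsilon>" unfolding y_def using nonneg[OF that] by (intro real_le_rsqrt) auto
      then show "y i s > 0" using \<epsilon> by simp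
      show "sqrt (u i s) \<le> y i s" unfolding y_def by simp
      show "(y i s)\<^sup>2 = u i s + \<epsilon>\<^sup>2" unfolding y_def using nonneg[OF that] by simp
    qed
    have "Z t \<le> Z T"
    proof (rule DERIV_nonpos_imp_decreasing_open[OF t])
      show "continuous_on {T..t} Z"
        unfolding Z_def Y_def y_def
        by (intro continuous_intros continuous_on_subset[OF cont]) auto
      fix s assume s: "T < s" "s < t"
      then have Ts: "T \<le> s" by simp
      define S where "S = (\<Sum>j\<in>UNIV. sqrt (u j s))"
      have S0: "S \<ge> 0" unfolding S_def using nonneg[OF Ts] by (intro sum_nonneg) auto
      have SY: "S \<le> Y s" unfolding S_def Y_def using y(2)[OF Ts] by (rule sum_mono)
      define y' where "y' i = u' i s / (2 * y i s)" for i
      have "(y i has_real_derivative y' i) (at s)" for i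
      proof -
        have "((\<lambda>s. u i s + \<epsilon>\<^sup>2) has_real_derivative u' i s) (at s)"
          using DERIV_add[OF der[OF s(1), of i] DERIV_const[of "\<epsilon>\<^sup>2"]] by simp
        moreover have "0 < u i s + \<epsilon>\<^sup>2" using nonneg[OF Ts, of i] \<epsilon> by (simp add: add_nonneg_pos)
        ultimately have "((\<lambda>s. sqrt (u i s + \<epsilon>\<^sup>2)) has_real_derivative inverse (sqrt (u i s + \<epsilon>\<^sup>2)) / 2 * u' i s) (at s)"
          by (intro DERIV_chain2[OF DERIV_real_sqrt])
        then show ?thesis by (simp add: y_def[abs_def] y'_def field_simps)
      qed
      then have "(Y has_real_derivative (\<Sum>i\<in>UNIV. y' i)) (at s)"
        unfolding Y_def by (intro DERIV_sum)
      then have ZD: "(Z has_real_derivative ((\<Sum>i\<in>UNIV. y' i) + l * (Y s - c)) * exp (l * s)) (at s)"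
        unfolding Z_def by (auto intro!: derivative_eq_intros simp: algebra_simps)
      have "y' i \<le> - a * y i s + a * \<epsilon> + b * Y s" for i
      proof -
        define z r where "z = y i s" and "r = sqrt (u i s)"
        have z: "z > 0" "\<epsilon> \<le> z" "r \<le> z" "u i s = z\<^sup>2 - \<epsilon>\<^sup>2" using y[OF Ts, of i] by (auto simp: z_def r_def)
        have "u' i s \<le> - 2 * a * (z\<^sup>2 - \<epsilon>\<^sup>2) + 2 * b * S * r"
          using bound[OF s(1), of i] unfolding S_def r_def z(4)[symmetric] .
        also have "\<dots> \<le> - 2 * a * (z\<^sup>2 - \<epsilon>\<^sup>2) + 2 * b * Y s * z"
        proof -
          have "b * S * r \<le> b * Y s * z"
            using b S0 SY z nonneg[OF Ts, of i] by (intro mult_mono mult_left_mono) (auto simp: r_def)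
          then show ?thesis by simp
        qed
        also have "\<dots> \<le> (- a * z + a * \<epsilon> + b * Y s) * (2 * z)"
        proof -
          have "a * (\<epsilon> * \<epsilon>) \<le> a * (\<epsilon> * z)" using a \<epsilon> z by (intro mult_left_mono) auto
          then show ?thesis by (simp add: power2_eq_square algebra_simps)
        qed
        finally show ?thesis using z(1) by (simp add: y'_def z_def[symmetric] pos_divide_le_eq)
      qed
      then have "(\<Sum>i\<in>UNIV. y' i) \<le> (\<Sum>i\<in>(UNIV::'k set). - a * y i s + a * \<epsilon> + b * Y s)"
        by (rule sum_mono)
      also have "\<dots> = - a * Y s + N * (a * \<epsilon> + b * Y s)"
        by (simp add: sum.distrib sum_subtractf sum_negf sum_distrib_left[symmetric] Y_def[symmetric] N_def algebra_simps)
      also have "\<dots> = - l * (Y s - c)"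
      proof -
        have "a = l + N * b" "l * c = a * N * \<epsilon>" using l by (simp_all add: c_def N_def)
        then show ?thesis by (simp add: algebra_simps)
      qed
      finally have "((\<Sum>i\<in>UNIV. y' i) + l * (Y s - c)) * exp (l * s) \<le> 0"
        by (intro mult_nonpos_nonneg) auto
      with ZD show "\<exists>D. (Z has_real_derivative D) (at s) \<and> D \<le> 0" by blast
    qed
    then have "(Y t - c) * exp (l * t) * exp (- l * t) \<le> (Y T - c) * exp (l * T) * exp (- l * t)"
      unfolding Z_def by (rule mult_right_mono) simp
    then have "Y t - c \<le> (Y T - c) * E"
      by (simp add: E_def mult.assoc algebra_simps flip: exp_add)
    moreover have "c * E \<ge> 0" using a l \<epsilon> by (simp add: c_def N_def E_def)
    ultimately have "Y t \<le> E * Y T + c" by (simp add: algebra_simps)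
    moreover have "(\<Sum>i\<in>UNIV. sqrt (u i t)) \<le> Y t" unfolding Y_def using y(2)[OF t] by (rule sum_mono)
    moreover have "Y T \<le> (\<Sum>i\<in>(UNIV::'k set). sqrt (u i T) + \<epsilon>)"
      unfolding Y_def y_def using nonneg[of T] \<epsilon> sqrt_add_le_add_sqrt[of "u _ T" "\<epsilon>\<^sup>2"] by (intro sum_mono) simp
    then have "E * Y T \<le> E * ((\<Sum>i\<in>UNIV. sqrt (u i T)) + N * \<epsilon>)"
      by (intro mult_left_mono) (auto simp: sum.distrib N_def E_def)
    ultimately show ?thesis by (simp add: C_def c_def algebra_simps)
  qed
  show ?thesis
  proof (rule field_le_epsilon)
    fix e :: real assume e: "e > 0"
    have "C * (e / (C + 1)) \<le> e" using C e by (simp add: pos_divide_le_eq mult_left_mono)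
    moreover have "e / (C + 1) > 0" using C e by simp
    ultimately show "(\<Sum>i\<in>UNIV. sqrt (u i t)) \<le> exp (- l * (t - T)) * (\<Sum>i\<in>UNIV. sqrt (u i T)) + e"
      using est[of "e / (C + 1)"] unfolding E_def by linarith
  qed
qed

text \<open>The mean value theorem on unit intervals far out yields points where \<open>x'\<close>
  equals an increment of \<open>x\<close>, and these increments tend to 0.\<close>

lemma limit_derivative_zero:
  fixes x :: "real \<Rightarrow> real"
  assumes der: "\<And>t. t > T \<Longrightarrow> (x has_real_derivative x' t) (at t)"
    and x: "(x \<longlongrightarrow> l) at_top" and x': "(x' \<longlongrightarrow> c) at_top"
  shows "c = 0"
proof -
  obtain m :: nat where m: "T < real m" using reals_Archimedean2 by blast
  have "\<exists>z. real (n + m) < z \<and> x (real (n + m) + 1) - x (real (n + m)) = x' z" for n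
  proof -
    have "\<exists>z>real (n + m). z < real (n + m) + 1 \<and> x (real (n + m) + 1) - x (real (n + m)) = (real (n + m) + 1 - real (n + m)) * x' z"
      using m by (intro MVT2 der) auto
    then show ?thesis by force
  qed
  then obtain z where z: "\<And>n. real (n + m) < z n" "\<And>n. x (real (n + m) + 1) - x (real (n + m)) = x' (z n)" by metis
  have r: "filterlim (\<lambda>n. real (n + m)) at_top sequentially"
    by (rule filterlim_compose[OF filterlim_real_sequentially]) (rule filterlim_add_const_nat_at_top)
  then have "filterlim z at_top sequentially"
    by (rule filterlim_at_top_mono) (use z(1) in \<open>intro always_eventually allI less_imp_le\<close>)
  then have "(\<lambda>n. x' (z n)) \<longlonglongrightarrow> c" by (rule filterlim_compose[OF x'])
  moreover have "filterlim (\<lambda>n. real (n + m) + 1) at_top sequentially"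
    using r by (rule filterlim_at_top_mono) auto
  then have "(\<lambda>n. x (real (n + m) + 1) - x (real (n + m))) \<longlonglongrightarrow> l - l"
    by (intro tendsto_diff filterlim_compose[OF x] r)
  ultimately show ?thesis unfolding z(2) using LIMSEQ_unique by force
qed

subsection \<open>Contraction of the Winfree flow\<close>

lemma inner_matrix_mult_ge:
  fixes M D :: "real^'n^'n"
  assumes "\<And>x. c * (norm x)\<^sup>2 \<le> inner x (M *v x)"
  shows "c * (norm D)\<^sup>2 \<le> inner D (M ** D)"
  unfolding inner_matrix_columns[of D "M ** D"] norm_matrix_columns[of D] sum_distrib_left
  using assms by (intro sum_mono) (simp flip: matrix_vector_mul_assoc)

lemma inner_skew_mult:
  fixes W D :: "real^'n^'n"
  assumes "transpose W = - W"
  shows "inner D (W ** D) = 0"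
  unfolding inner_matrix_columns[of D "W ** D"] using skew_inner_zero[OF assms]
  by (simp flip: matrix_vector_mul_assoc)

text \<open>With \<open>M = X + Y\<close> and \<open>D = X - Y\<close>, the identity
  \<open>X X - Y Y = (M D + D M) / 2\<close> holds without commutativity. Transposition turns the
  right factor \<open>M\<close> into a left one.\<close>

lemma inner_diff_squares_ge:
  fixes X Y :: "real^'n^'n"
  assumes X: "\<And>x. c * (norm x)\<^sup>2 \<le> inner x (X *v x)" and Y: "\<And>x. c * (norm x)\<^sup>2 \<le> inner x (Y *v x)"
  shows "2 * c * (norm (X - Y))\<^sup>2 \<le> inner (X - Y) (X ** X - Y ** Y)"
proof -
  define D M where "D = X - Y" and "M = X + Y"
  have M: "(2 * c) * (norm x)\<^sup>2 \<le> inner x (M *v x)" for x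
    using X[of x] Y[of x] by (simp add: M_def matrix_vector_mult_add_rdistrib inner_add_right)
  have Mt: "(2 * c) * (norm x)\<^sup>2 \<le> inner x (transpose M *v x)" for x
    using M[of x] inner_matrix_transpose[of M x x] by (simp add: inner_commute del: transpose_matrix_vector)
  have "X ** X - Y ** Y = (1/2) *\<^sub>R (M ** D + D ** M)"
    unfolding M_def D_def by (simp only: matrix_distribs) (simp add: vec_eq_iff)
  moreover have "inner D (D ** M) = inner (transpose D) (transpose M ** transpose D)"
    using inner_transpose_matrix[of D "D ** M"] by (simp only: matrix_transpose_mul)
  ultimately show ?thesis
    using inner_matrix_mult_ge[OF M, of D] inner_matrix_mult_ge[OF Mt, of "transpose D"]
    unfolding D_def[symmetric] by (simp add: inner_add_right)
qed

text \<open>Only the skew part of \<open>R\<close> pairs with \<open>W\<close>, as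
  \<open>2 tr (W R) = tr (W (R - R^T))\<close>; then Cauchy-Schwarz applies.\<close>

lemma trace_skew_mult_bound:
  fixes W R :: "real^'n^'n"
  assumes "transpose W = - W"
  shows "\<bar>trace (W ** R)\<bar> \<le> mat_norm W * mat_norm (R - transpose R)"
proof -
  have "trace (W ** R) = trace (transpose R ** transpose W)"
    unfolding matrix_transpose_mul[symmetric] by (rule trace_transpose[symmetric])
  also have "\<dots> = - trace (transpose R ** W)"
    unfolding assms matrix_mult_minus_right trace_minus by (rule refl)
  also have "trace (transpose R ** W) = trace (W ** transpose R)" by (rule trace_mul_sym)
  finally have "2 * trace (W ** R) = trace (W ** (R - transpose R))"
    by (simp add: matrix_diff_ldistrib trace_sub)
  also have "\<dots> = - trace (transpose W ** (R - transpose R))"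
    unfolding assms matrix_mult_minus_left trace_minus by simp
  also have "\<dots> = - inner W (R - transpose R)"
    using mat_inner_eq[of W "R - transpose R"] unfolding mat_inner_def by simp
  finally have "2 * \<bar>trace (W ** R)\<bar> \<le> norm W * norm (R - transpose R)"
    using Cauchy_Schwarz_ineq2[of W "R - transpose R"] by simp
  then show ?thesis by (simp add: mat_norm_eq)
qed

text \<open>The left-hand side is the derivative of the squared chord along one oscillator equation
  with coupling coefficient \<open>k\<close>.\<close>

lemma trace_winfree_term_bound:
  fixes W R :: "real^'n^'n"
  assumes "transpose W = - W" "R \<in> SO"
  shows "- trace (W ** R + k *\<^sub>R (mat 1 - R ** R))
     \<le> mat_norm (R - transpose R) * (mat_norm W - k * mat_norm (R - transpose R))"
proof -
  define n where "n = mat_norm (R - transpose R)"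
  have "trace (W ** R + k *\<^sub>R (mat 1 - R ** R)) = trace (W ** R) + k * n\<^sup>2"
    unfolding trace_add trace_scaleR SO_trace_square[OF assms(2)] n_def by (rule refl)
  moreover have "- trace (W ** R) \<le> mat_norm W * n"
    using trace_skew_mult_bound[OF assms(1), of R] unfolding n_def by linarith
  moreover have "n * (mat_norm W - k * n) = mat_norm W * n - k * n\<^sup>2"
    by (simp add: power2_eq_square algebra_simps)
  ultimately show ?thesis unfolding n_def[symmetric] by linarith
qed

text \<open>\<open>inner x (R x)\<close> is \<open>(norm x)^2\<close> minus half the squared norm of
  \<open>x - R x\<close>, which the operator bound controls.\<close>

lemma SO_inner_ge_of_chord:
  fixes R :: "real^'n^'n"
  assumes "R \<in> SO" "(mat_norm (mat 1 - R))\<^sup>2 \<le> r"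
  shows "(1 - r / 2) * (norm x)\<^sup>2 \<le> inner x (R *v x)"
proof -
  have "(norm (x - R *v x))\<^sup>2 = 2 * (norm x)\<^sup>2 - 2 * inner x (R *v x)"
    using orthogonal_matrix_inner[OF SO_D(1)[OF assms(1)], of x x]
    unfolding power2_norm_eq_inner by (simp add: inner_diff_left inner_diff_right inner_commute)
  moreover have "(norm (x - R *v x))\<^sup>2 \<le> (mat_norm (mat 1 - R))\<^sup>2 * (norm x)\<^sup>2"
    using SO_diff_one_operator_bound[OF assms(1), of x]
    by (simp add: mat_norm_power2 matrix_vector_mult_diff_rdistrib)
  moreover have "(mat_norm (mat 1 - R))\<^sup>2 * (norm x)\<^sup>2 \<le> r * (norm x)\<^sup>2"
    using assms(2) by (rule mult_right_mono) simp
  ultimately show ?thesis by (simp add: algebra_simps)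
qed

lemma SO_inner_ge_of_dist:
  fixes R :: "real^'n^'n"
  assumes "R \<in> SO" "SO_dist (mat 1) R < r" "r \<le> pi"
  shows "cos r * (norm x)\<^sup>2 \<le> inner x (R *v x)"
proof (cases "x = 0")
  case False
  obtain L where L: "SO_curve (mat 1) R L" "L < r" using SO_dist_lessE[OF SO_one assms(1,2)] by blast
  have "cos r \<le> cos L" using L assms(3) SO_curve_nonneg[OF L(1)] by (intro cos_monotone_0_pi_le) auto
  also have "\<dots> \<le> inner (x /\<^sub>R norm x) (R *v (x /\<^sub>R norm x))"
    using L assms(3) False by (intro SO_curve_inner_ge) auto
  also have "\<dots> = inner x (R *v x) / (norm x)\<^sup>2"
    by (simp add: matrix_vector_mult_scaleR power2_eq_square field_simps)
  finally show ?thesis using False by (simp add: pos_le_divide_eq)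
qed simp

lemma winfree_field_nth:
  "winfree_field I \<kappa> \<Omega> R $ i = \<Omega> $ i ** R $ i +
    (\<kappa> / 2 * (1 / real CARD('k) * (\<Sum>j\<in>UNIV. I (R $ j)))) *\<^sub>R (mat 1 - R $ i ** R $ i)"
  for R :: "real^'n^'n^'k"
  by (simp add: winfree_field_def)

text \<open>Records the bounds that the contraction estimate uses. Both the chordal ball that the
  solution enters and the geodesic ball in which equilibria are sought satisfy them.\<close>

definition contraction_region :: "(real^'n^'n \<Rightarrow> real) \<Rightarrow> real \<Rightarrow> real \<Rightarrow> real \<Rightarrow> (real^'n^'n) set" where
  "contraction_region I c q \<gamma> =
     {R \<in> SO. (\<forall>x. c * (norm x)\<^sup>2 \<le> inner x (R *v x)) \<and> q \<le> I R \<and> mat_norm (mat 1 - R) \<le> \<gamma>}"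

text \<open>The skew frequency drops out of the inner product. The difference of the squares
  contracts with coefficient \<open>k X\<close>, and the difference of the couplings acts on
  \<open>I - Y Y\<close>, whose \<open>mat_norm\<close> is at most
  \<open>2 \<gamma>\<close>.\<close>

lemma winfree_field_contraction:
  fixes X Y \<Omega> :: "real^'n^'n^'k" and I :: "real^'n^'n \<Rightarrow> real"
  assumes skew: "\<And>i. skew_symmetric (\<Omega> $ i)" and \<kappa>: "\<kappa> > 0" and c: "c \<ge> 0" and q: "q \<ge> 0"
    and Lip: "\<And>A B. A \<in> SO \<Longrightarrow> B \<in> SO \<Longrightarrow> \<bar>I A - I B\<bar> \<le> K * mat_norm (A - B)"
    and X: "\<And>i. X $ i \<in> contraction_region I c q \<gamma>" and Y: "\<And>i. Y $ i \<in> contraction_region I c q \<gamma>"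
  shows "inner (X $ i - Y $ i) (winfree_field I \<kappa> \<Omega> X $ i - winfree_field I \<kappa> \<Omega> Y $ i)
    \<le> - 2 * (\<kappa> * c * q) * (mat_norm (X $ i - Y $ i))\<^sup>2
      + 2 * (\<kappa> * \<gamma> * K / real CARD('k)) * (\<Sum>j\<in>UNIV. mat_norm (X $ j - Y $ j)) * mat_norm (X $ i - Y $ i)"
proof -
  define N where "N = real CARD('k)"
  have N: "N > 0" by (simp add: N_def)
  define k where "k Z = \<kappa> / 2 * (1 / N * (\<Sum>j\<in>UNIV. I (Z $ j)))" for Z :: "real^'n^'n^'k"
  define D where "D = X $ i - Y $ i"
  define m where "m = mat_norm D"
  define s where "s = (\<Sum>j\<in>UNIV. mat_norm (X $ j - Y $ j))"
  have Xi: "X $ i \<in> SO" "\<And>x. c * (norm x)\<^sup>2 \<le> inner x ((X $ i) *v x)" using X[of i] by (auto simp: contraction_region_def)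
  have Yi: "Y $ i \<in> SO" "\<And>x. c * (norm x)\<^sup>2 \<le> inner x ((Y $ i) *v x)" "mat_norm (mat 1 - Y $ i) \<le> \<gamma>"
    using Y[of i] by (auto simp: contraction_region_def)
  have \<gamma>: "\<gamma> \<ge> 0" using Yi(3) mat_norm_nonneg order_trans by blast
  have m: "m \<ge> 0" "(norm D)\<^sup>2 = 2 * m\<^sup>2" "norm D = sqrt 2 * m"
    unfolding m_def mat_norm_power2 by (simp_all add: mat_norm_eq)
  have "(\<Sum>j\<in>(UNIV::'k set). q) \<le> (\<Sum>j\<in>UNIV. I (X $ j))"
    using X by (intro sum_mono) (auto simp: contraction_region_def)
  then have "N * q \<le> (\<Sum>j\<in>UNIV. I (X $ j))" by (simp add: N_def)
  then have kX: "\<kappa> / 2 * q \<le> k X"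
    unfolding k_def using \<kappa> N by (intro mult_left_mono) (auto simp: field_simps)
  then have "(\<kappa> / 2 * q) * (2 * c * (norm D)\<^sup>2) \<le> k X * inner D (X $ i ** X $ i - Y $ i ** Y $ i)"
    unfolding D_def
  proof (rule mult_mono[OF _ inner_diff_squares_ge[OF Xi(2) Yi(2)]])
    note \<open>\<kappa> / 2 * q \<le> k X\<close>
    moreover have "0 \<le> \<kappa> / 2 * q" using \<kappa> q by simp
    ultimately show "0 \<le> k X" by linarith
  qed (use c in auto)
  then have first: "2 * (\<kappa> * c * q) * m\<^sup>2 \<le> k X * inner D (X $ i ** X $ i - Y $ i ** Y $ i)"
    unfolding m(2) by (simp add: algebra_simps)
  have kdiff: "\<bar>k X - k Y\<bar> \<le> \<kappa> / 2 * (K / N * s)"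
  proof -
    have "k X - k Y = \<kappa> / 2 * (1 / N * (\<Sum>j\<in>UNIV. I (X $ j) - I (Y $ j)))"
      by (simp add: k_def sum_subtractf algebra_simps)
    also have "\<bar>\<dots>\<bar> = \<kappa> / 2 * (1 / N * \<bar>\<Sum>j\<in>UNIV. I (X $ j) - I (Y $ j)\<bar>)"
      using \<kappa> N by (simp add: abs_mult)
    also have "\<dots> \<le> \<kappa> / 2 * (1 / N * (K * s))"
    proof -
      have "\<bar>\<Sum>j\<in>UNIV. I (X $ j) - I (Y $ j)\<bar> \<le> (\<Sum>j\<in>UNIV. \<bar>I (X $ j) - I (Y $ j)\<bar>)" by (rule sum_abs)
      also have "\<dots> \<le> K * s"
        unfolding s_def sum_distrib_left using X Y by (intro sum_mono Lip) (auto simp: contraction_region_def)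
      finally show ?thesis using \<kappa> N by (intro mult_left_mono) auto
    qed
    finally show ?thesis by simp
  qed
  have "mat_norm (mat 1 - Y $ i ** Y $ i) \<le> 2 * \<gamma>"
  proof -
    have "mat_norm (Y $ i - transpose (Y $ i)) \<le> mat_norm (mat 1 - transpose (Y $ i)) + mat_norm (mat 1 - Y $ i)"
      using divide_right_mono[OF norm_triangle_ineq4[of "mat 1 - transpose (Y $ i)" "mat 1 - Y $ i"], of "sqrt 2"]
      by (simp add: mat_norm_eq add_divide_distrib)
    also have "mat_norm (mat 1 - transpose (Y $ i)) = mat_norm (mat 1 - Y $ i)"
      by (simp add: mat_norm_eq norm_mat_1_diff_transpose)
    finally show ?thesis using Yi(3) norm_one_minus_square_eq[OF Yi(1)] by simp
  qed
  then have nY: "norm (mat 1 - Y $ i ** Y $ i) \<le> sqrt 2 * (2 * \<gamma>)" by (simp add: mat_norm_eq field_simps)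
  have "(k X - k Y) * inner D (mat 1 - Y $ i ** Y $ i) \<le> \<bar>k X - k Y\<bar> * \<bar>inner D (mat 1 - Y $ i ** Y $ i)\<bar>"
    by (simp flip: abs_mult)
  also have "\<dots> \<le> (\<kappa> / 2 * (K / N * s)) * ((sqrt 2 * m) * (sqrt 2 * (2 * \<gamma>)))"
  proof (rule mult_mono[OF kdiff])
    have "\<bar>inner D (mat 1 - Y $ i ** Y $ i)\<bar> \<le> norm D * norm (mat 1 - Y $ i ** Y $ i)" by (rule Cauchy_Schwarz_ineq2)
    also have "\<dots> \<le> (sqrt 2 * m) * (sqrt 2 * (2 * \<gamma>))"
      unfolding m(3) using nY m(1) by (intro mult_left_mono) auto
    finally show "\<bar>inner D (mat 1 - Y $ i ** Y $ i)\<bar> \<le> (sqrt 2 * m) * (sqrt 2 * (2 * \<gamma>))" .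
    show "0 \<le> \<kappa> / 2 * (K / N * s)" using kdiff by (meson abs_ge_zero order_trans)
  qed simp
  also have "\<dots> = (sqrt 2 * sqrt 2) * ((\<kappa> * \<gamma> * K / N) * s * m)" by simp
  also have "\<dots> = 2 * (\<kappa> * \<gamma> * K / N) * s * m" by (simp only: real_sqrt_mult_self)
  finally have second: "(k X - k Y) * inner D (mat 1 - Y $ i ** Y $ i) \<le> 2 * (\<kappa> * \<gamma> * K / N) * s * m" .
  have "winfree_field I \<kappa> \<Omega> X $ i - winfree_field I \<kappa> \<Omega> Y $ i =
      \<Omega> $ i ** D - k X *\<^sub>R (X $ i ** X $ i - Y $ i ** Y $ i) + (k X - k Y) *\<^sub>R (mat 1 - Y $ i ** Y $ i)"
    unfolding winfree_field_nth N_def[symmetric] k_def[symmetric]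
    by (simp add: D_def matrix_diff_ldistrib scaleR_diff_right scaleR_diff_left)
  then have "inner D (winfree_field I \<kappa> \<Omega> X $ i - winfree_field I \<kappa> \<Omega> Y $ i) =
      - (k X * inner D (X $ i ** X $ i - Y $ i ** Y $ i)) + (k X - k Y) * inner D (mat 1 - Y $ i ** Y $ i)"
    using inner_skew_mult[of "\<Omega> $ i" D] skew[of i] by (simp add: inner_add_right inner_diff_right skew_symmetric_def)
  with first second show ?thesis unfolding D_def[symmetric] m_def[symmetric] s_def[symmetric] N_def[symmetric] by simp
qed

lemma l1_norm_triangle: "l1_norm (R + S) \<le> l1_norm R + l1_norm S"
  unfolding l1_norm_def sum.distrib[symmetric] by (intro sum_mono) (simp add: mat_norm_triangle)

lemma l1_norm_minus: "l1_norm (- R) = l1_norm R"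
  by (simp add: l1_norm_def mat_norm_eq)

lemma norm_le_l1_norm: "norm R \<le> sqrt 2 * l1_norm R"
proof -
  have "norm R \<le> (\<Sum>i\<in>UNIV. norm (R $ i))" unfolding norm_vec_def[of R] by (rule L2_set_le_sum) simp
  also have "\<dots> = sqrt 2 * l1_norm R" by (simp add: l1_norm_def mat_norm_eq sum_distrib_left)
  finally show ?thesis .
qed

lemma SO_closed: "closed (SO :: (real^'n^'n) set)"
proof -
  have SO: "(SO :: (real^'n^'n) set) = {R. transpose R ** R = mat 1} \<inter> {R. det R = 1}"
    by (auto simp: SO_def rotation_matrix_def orthogonal_matrix)
  have "closed {R :: real^'n^'n. transpose R ** R = mat 1}"
    by (rule closed_Collect_eq[OF continuous_on_matrix_mult[OF linear_continuous_on[OF bounded_linear_transpose]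
          continuous_on_id] continuous_on_const])
  moreover have "closed {R :: real^'n^'n. det R = 1}"
    unfolding det_def by (intro closed_Collect_eq continuous_intros)
  ultimately show ?thesis unfolding SO by (rule closed_Int)
qed

lemma SO_mat_norm_le:
  fixes R :: "real^'n^'n"
  assumes "R \<in> SO"
  shows "mat_norm R \<le> sqrt (real CARD('n))"
proof -
  have "(norm R)\<^sup>2 = real CARD('n)"
    unfolding norm_matrix_columns using assms by (simp add: SO_D)
  then have "norm R = sqrt (real CARD('n))" by (metis norm_ge_zero real_sqrt_unique)
  then show ?thesis by (simp add: mat_norm_eq pos_divide_le_eq)
qed

text \<open>In the application \<open>c\<close> is \<open>cos \<gamma>\<close>, \<open>q\<close> is
  \<open>Itilde \<gamma>\<close> and \<open>K\<close> is \<open>Lip_star I\<close>, which makes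
  \<open>l\<close> the rate \<open>lam\<close>.\<close>

locale winfree_contraction =
  fixes I :: "real^'n^'n \<Rightarrow> real" and \<kappa> c q \<gamma> K l :: real and \<Omega> :: "real^'n^'n^'k"
  assumes skew: "\<And>i. skew_symmetric (\<Omega> $ i)" and \<kappa>: "\<kappa> > 0" and c: "c \<ge> 0" and q: "q \<ge> 0"
    and \<gamma>: "\<gamma> \<ge> 0" and K: "K \<ge> 0"
    and Lip: "\<And>A B. A \<in> SO \<Longrightarrow> B \<in> SO \<Longrightarrow> \<bar>I A - I B\<bar> \<le> K * mat_norm (A - B)"
    and l_def: "l = \<kappa> * (c * q - \<gamma> * K)" and l: "l > 0"
begin

text \<open>The squared differences satisfy the hypotheses of
  \<open>sum_sqrt_exponential_decay\<close>. Summation over all oscillators cancels the factor 1/N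
  of the coupling error, which leaves the rate \<open>l\<close>.\<close>

lemma contraction:
  fixes X Y :: "real \<Rightarrow> real^'n^'n^'k"
  assumes contX: "continuous_on {T..} X" and contY: "continuous_on {T..} Y"
    and derX: "\<And>t. t > T \<Longrightarrow> (X has_vector_derivative winfree_field I \<kappa> \<Omega> (X t)) (at t)"
    and derY: "\<And>t. t > T \<Longrightarrow> (Y has_vector_derivative winfree_field I \<kappa> \<Omega> (Y t)) (at t)"
    and X: "\<And>t i. t \<ge> T \<Longrightarrow> X t $ i \<in> contraction_region I c q \<gamma>"
    and Y: "\<And>t i. t \<ge> T \<Longrightarrow> Y t $ i \<in> contraction_region I c q \<gamma>"
    and t: "t \<ge> T"
  shows "l1_norm (X t - Y t) \<le> exp (- l * (t - T)) * l1_norm (X T - Y T)"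
proof -
  define u where "u i t = (mat_norm (X t $ i - Y t $ i))\<^sup>2" for i t
  define u' where "u' i t = inner (X t $ i - Y t $ i) (winfree_field I \<kappa> \<Omega> (X t) $ i - winfree_field I \<kappa> \<Omega> (Y t) $ i)" for i t
  have l1: "(\<Sum>i\<in>UNIV. sqrt (u i t)) = l1_norm (X t - Y t)" for t
    by (simp add: u_def l1_norm_def)
  have "(\<Sum>i\<in>UNIV. sqrt (u i t)) \<le> exp (- l * (t - T)) * (\<Sum>i\<in>UNIV. sqrt (u i T))"
  proof (rule sum_sqrt_exponential_decay[where a="\<kappa> * c * q" and b="\<kappa> * \<gamma> * K / real CARD('k)" and u'=u', OF _ _ _ _ _ _ _ l t])
    show "continuous_on {T..} (u i)" for i
      unfolding u_def mat_norm_eq by (intro continuous_intros contX contY) auto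
    show "0 \<le> u i t" for i t by (simp add: u_def)
    show "(u i has_real_derivative u' i s) (at s)" if s: "T < s" for i s
    proof -
      have "((\<lambda>s. X s $ i - Y s $ i) has_vector_derivative (winfree_field I \<kappa> \<Omega> (X s) $ i - winfree_field I \<kappa> \<Omega> (Y s) $ i)) (at s)"
        by (intro has_vector_derivative_diff bounded_linear.has_vector_derivative[OF bounded_linear_vec_nth] derX derY s)
      from bounded_bilinear.has_vector_derivative[OF bounded_bilinear_inner this this]
      have "((\<lambda>s. inner (X s $ i - Y s $ i) (X s $ i - Y s $ i)) has_real_derivative 2 * u' i s) (at s)"
        by (simp add: has_real_derivative_iff_has_vector_derivative u'_def inner_commute)
      from DERIV_cdivide[OF this, of 2] show ?thesis
        by (simp add: u_def[abs_def] mat_norm_power2 power2_norm_eq_inner)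
    qed
    show "u' i s \<le> - 2 * (\<kappa> * c * q) * u i s +
        2 * (\<kappa> * \<gamma> * K / real CARD('k)) * (\<Sum>j\<in>UNIV. sqrt (u j s)) * sqrt (u i s)" if s: "T < s" for i s
      using winfree_field_contraction[OF skew \<kappa> c q Lip X Y, of s s i] s by (simp add: u_def u'_def)
    show "0 \<le> \<kappa> * c * q" using \<kappa> c q by simp
    show "0 \<le> \<kappa> * \<gamma> * K / real CARD('k)" using \<kappa> \<gamma> K by simp
    show "l = \<kappa> * c * q - real CARD('k) * (\<kappa> * \<gamma> * K / real CARD('k))" by (simp add: l_def algebra_simps)
  qed
  then show ?thesis by (simp add: l1)
qed

lemma tendsto_influence:
  assumes "(f \<longlongrightarrow> A) F" "\<forall>\<^sub>F t in F. f t \<in> SO" "A \<in> SO"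
  shows "((\<lambda>t. I (f t)) \<longlongrightarrow> I A) F"
proof (rule LIM_zero_cancel, rule Lim_null_comparison)
  have "((\<lambda>t. K * mat_norm (f t - A)) \<longlongrightarrow> K * mat_norm (A - A)) F"
    unfolding mat_norm_eq by (intro tendsto_intros assms(1)) auto
  then show "((\<lambda>t. K * mat_norm (f t - A)) \<longlongrightarrow> 0) F" by (simp add: mat_norm_eq)
  show "\<forall>\<^sub>F t in F. norm (I (f t) - I A) \<le> K * mat_norm (f t - A)"
    using assms(2) by eventually_elim (simp add: Lip assms(3))
qed

text \<open>The equation is autonomous, so a time shift of the solution is a solution in the same
  region. Contraction makes the two exponentially close, uniformly in the shift, whence the Cauchy
  property.\<close>

lemma convergence_to_equilibrium:
  fixes X :: "real \<Rightarrow> real^'n^'n^'k"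
  assumes cont: "continuous_on {T..} X"
    and der: "\<And>t. t > T \<Longrightarrow> (X has_vector_derivative winfree_field I \<kappa> \<Omega> (X t)) (at t)"
    and X: "\<And>t i. t \<ge> T \<Longrightarrow> X t $ i \<in> contraction_region I c q \<gamma>"
  obtains E where "(X \<longlongrightarrow> E) at_top" "winfree_equilibrium I \<kappa> \<Omega> E"
proof -
  have XSO: "X t $ i \<in> SO" if "t \<ge> T" for t i using X[OF that] by (auto simp: contraction_region_def)
  \<comment> \<open>Bounds the \<open>l1_norm\<close> of the difference of any two configurations of
    rotations, hence independently of the shift \<open>h\<close>.\<close>
  define C where "C = 2 * (real CARD('k) * sqrt (real CARD('n)))"
  have bound: "l1_norm (X (t + h) - X t) \<le> C * exp (- l * (t - T))" if "t \<ge> T" "h \<ge> 0" for t h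
  proof -
    have "l1_norm (X (t + h) - X t) \<le> exp (- l * (t - T)) * l1_norm (X (T + h) - X T)"
    proof (rule contraction[of T "\<lambda>t. X (t + h)" X])
      show "continuous_on {T..} (\<lambda>t. X (t + h))"
        by (rule continuous_on_compose2[OF cont]) (use that in \<open>auto intro!: continuous_intros\<close>)
      show "((\<lambda>t. X (t + h)) has_vector_derivative winfree_field I \<kappa> \<Omega> (X (s + h))) (at s)" if "T < s" for s
      proof -
        have "((\<lambda>t. t + h) has_vector_derivative 1) (at s)" by (auto intro!: derivative_eq_intros)
        from vector_diff_chain_at[OF this, of X "winfree_field I \<kappa> \<Omega> (X (s + h))"] show ?thesis
          using der[of "s + h"] that \<open>h \<ge> 0\<close> by (simp add: o_def)
      qed
    qed (use that cont der X in auto)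
    also have "\<dots> \<le> exp (- l * (t - T)) * C"
    proof (rule mult_left_mono)
      have b: "l1_norm (X s) \<le> real CARD('k) * sqrt (real CARD('n))" if "s \<ge> T" for s
        unfolding l1_norm_def using sum_mono[of UNIV "\<lambda>i. mat_norm (X s $ i)" "\<lambda>_. sqrt (real CARD('n))"] XSO[OF that]
        by (simp add: SO_mat_norm_le)
      have "l1_norm (X (T + h) - X T) \<le> l1_norm (X (T + h)) + l1_norm (X T)"
        using l1_norm_triangle[of "X (T + h)" "- X T"] by (simp add: l1_norm_minus)
      also have "\<dots> \<le> C" using b[of T] b[of "T + h"] that unfolding C_def by simp
      finally show "l1_norm (X (T + h) - X T) \<le> C" .
    qed simp
    finally show ?thesis by (simp add: mult.commute)
  qed
  have e0: "((\<lambda>t. sqrt 2 * (C * exp (- l * (t - T)))) \<longlongrightarrow> 0) at_top"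
  proof -
    have "filterlim (\<lambda>t. - T + t) at_top at_top"
      by (rule filterlim_tendsto_add_at_top[OF tendsto_const filterlim_ident])
    then have "filterlim (\<lambda>t. - l * (t - T)) at_bot at_top"
      using filterlim_tendsto_neg_mult_at_bot[OF tendsto_const[of "- l" at_top] _ \<open>filterlim (\<lambda>t. - T + t) at_top at_top\<close>] l by simp
    from filterlim_compose[OF exp_at_bot this] show ?thesis
      by (intro tendsto_mult_right_zero)
  qed
  have d: "dist (X s) (X t) \<le> sqrt 2 * (C * exp (- l * (t - T)))" if "t \<ge> T" "s \<ge> t" for s t
    unfolding dist_norm using bound[of t "s - t"] that
    by (intro order_trans[OF norm_le_l1_norm] mult_left_mono) auto
  have "Cauchy (\<lambda>n. X (T + real n))"
  proof (rule metric_CauchyI)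
    fix e :: real assume "e > 0"
    then have "\<forall>\<^sub>F t in at_top. sqrt 2 * (C * exp (- l * (t - T))) < e / 2"
      using order_tendstoD(2)[OF e0, of "e/2"] by simp
    then obtain t0 where t0: "\<And>t. t \<ge> t0 \<Longrightarrow> sqrt 2 * (C * exp (- l * (t - T))) < e / 2"
      by (auto simp: eventually_at_top_linorder)
    obtain M :: nat where M: "t0 - T \<le> real M" using real_arch_simple by blast
    have a: "dist (X (T + real n)) (X (T + real M)) < e / 2" if "n \<ge> M" for n
      using d[of "T + real M" "T + real n"] t0[of "T + real M"] M that by simp
    then have "dist (X (T + real m)) (X (T + real n)) < e" if "m \<ge> M" "n \<ge> M" for m n
      using dist_triangle_half_r[of "X (T + real M)"] a[OF that(1)] a[OF that(2)] by (simp add: dist_commute)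
    then show "\<exists>M. \<forall>m\<ge>M. \<forall>n\<ge>M. dist (X (T + real m)) (X (T + real n)) < e" by blast
  qed
  then obtain E where E: "(\<lambda>n. X (T + real n)) \<longlonglongrightarrow> E" using Cauchy_convergent_iff convergent_def by metis
  have dE: "dist E (X t) \<le> sqrt 2 * (C * exp (- l * (t - T)))" if "t \<ge> T" for t
  proof (rule LIMSEQ_le_const2)
    show "(\<lambda>n. dist (X (T + real n)) (X t)) \<longlonglongrightarrow> dist E (X t)" by (intro tendsto_intros E)
    obtain M :: nat where "t - T \<le> real M" using real_arch_simple by blast
    then show "\<exists>M. \<forall>n\<ge>M. dist (X (T + real n)) (X t) \<le> sqrt 2 * (C * exp (- l * (t - T)))"
      using that by (intro exI[of _ M] allI impI d) auto
  qed
  have XE: "(X \<longlongrightarrow> E) at_top"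
  proof (rule tendsto_dist_iff[THEN iffD2], rule Lim_null_comparison[OF _ e0])
    show "\<forall>\<^sub>F t in at_top. norm (dist (X t) E) \<le> sqrt 2 * (C * exp (- l * (t - T)))"
      using eventually_ge_at_top[of T] by eventually_elim (use dE in \<open>simp add: dist_commute\<close>)
  qed
  have XEi: "((\<lambda>t. X t $ i) \<longlongrightarrow> E $ i) at_top" for i by (intro tendsto_intros XE)
  have evSO: "\<forall>\<^sub>F t in at_top. X t $ i \<in> SO" for i
    using eventually_ge_at_top[of T] by eventually_elim (use XSO in auto)
  have ESO: "E $ i \<in> SO" for i
    by (rule Lim_in_closed_set[OF SO_closed evSO _ XEi]) simp
  \<comment> \<open>Each entry of the solution converges, and its derivative converges to the field
    at \<open>E\<close>; such a limit of derivatives can only be 0.\<close>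
  have "winfree_field I \<kappa> \<Omega> E $ i $ a $ b = 0" for i a b
  proof (rule limit_derivative_zero)
    show "((\<lambda>t. X t $ i $ a $ b) has_real_derivative winfree_field I \<kappa> \<Omega> (X t) $ i $ a $ b) (at t)" if "T < t" for t
      unfolding has_real_derivative_iff_has_vector_derivative
      by (intro bounded_linear.has_vector_derivative[OF bounded_linear_vec_nth] der that)
    show "((\<lambda>t. X t $ i $ a $ b) \<longlongrightarrow> E $ i $ a $ b) at_top" by (intro tendsto_intros XE)
    have "((\<lambda>t. winfree_field I \<kappa> \<Omega> (X t) $ i) \<longlongrightarrow> winfree_field I \<kappa> \<Omega> E $ i) at_top"
      unfolding winfree_field_nth
      by (intro tendsto_intros tendsto_matrix_mult XEi tendsto_influence evSO ESO)
    then show "((\<lambda>t. winfree_field I \<kappa> \<Omega> (X t) $ i $ a $ b) \<longlongrightarrow> winfree_field I \<kappa> \<Omega> E $ i $ a $ b) at_top"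
      by (rule tendsto_vec_nth[OF tendsto_vec_nth])
  qed
  then have "winfree_field I \<kappa> \<Omega> E = 0" by (simp add: vec_eq_iff)
  with ESO XE show thesis using that by (simp add: winfree_equilibrium_def)
qed

end

subsection \<open>Entrance into the contraction region\<close>

text \<open>\<open>x (4 - x) > 4 p^2\<close> holds exactly between the roots
  \<open>2 - 2 sqrt (1 - p^2)\<close> and \<open>2 + 2 sqrt (1 - p^2)\<close>. The larger root will
  be the square of \<open>\<Gamma> i\<close>.\<close>

lemma quadratic_gt_of_between:
  fixes p r s :: real
  assumes "r \<le> s" "s < 2 + 2 * sqrt (1 - p\<^sup>2)" "p\<^sup>2 \<le> 1" "4 * p\<^sup>2 < r * (4 - r)"
  shows "4 * p\<^sup>2 < s * (4 - s)"
proof (cases "s \<le> 2")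
  case True
  have "0 \<le> (s - r) * (4 - s - r)" using True assms(1) by (intro mult_nonneg_nonneg) auto
  also have "\<dots> = s * (4 - s) - r * (4 - r)" by (simp add: algebra_simps)
  finally show ?thesis using assms(4) by simp
next
  case False
  then have "(s - 2)\<^sup>2 < (2 * sqrt (1 - p\<^sup>2))\<^sup>2" using assms(2) by (intro power_strict_mono) auto
  also have "\<dots> = 4 * (1 - p\<^sup>2)" using assms(3) by (simp add: power_mult_distrib)
  finally show ?thesis by (simp add: power2_eq_square algebra_simps)
qed

text \<open>A concave function on an interval is minimal at an end point.\<close>

lemma quadratic_ge_min:
  fixes r s t :: real
  assumes "r \<le> s" "s \<le> t"
  shows "min (r * (4 - r)) (t * (4 - t)) \<le> s * (4 - s)"
proof (cases "r + s \<le> 4")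
  case True
  have "0 \<le> (s - r) * (4 - s - r)" using True assms(1) by (intro mult_nonneg_nonneg) auto
  also have "\<dots> = s * (4 - s) - r * (4 - r)" by (simp add: algebra_simps)
  finally show ?thesis by simp
next
  case False
  then have "0 \<le> (t - s) * (t + s - 4)" using assms by (intro mult_nonneg_nonneg) auto
  also have "\<dots> = s * (4 - s) - t * (4 - t)" by (simp add: algebra_simps)
  finally show ?thesis by simp
qed

text \<open>With \<open>n = mat_norm (R - R^T)\<close> the derivative of the squared chord is at
  most \<open>- n (a (n - 2 p))\<close>. The chord inequality gives
  \<open>n \<ge> sqrt m > 2 p\<close>, and beyond \<open>2 p\<close> this bound is monotone in
  \<open>n\<close>.\<close>

lemma trace_winfree_term_le:
  fixes W R :: "real^'n^'n"
  assumes W: "transpose W = - W" and R: "R \<in> SO" and k: "a \<le> k" and a: "0 < a" and p: "mat_norm W = 2 * a * p"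
    and m: "4 * p\<^sup>2 < m" "m \<le> (mat_norm (mat 1 - R))\<^sup>2 * (4 - (mat_norm (mat 1 - R))\<^sup>2)"
  shows "- trace (W ** R + k *\<^sub>R (mat 1 - R ** R)) \<le> - (sqrt m * (a * (sqrt m - 2 * p)))"
    and "0 < sqrt m * (a * (sqrt m - 2 * p))"
proof -
  define n where "n = mat_norm (R - transpose R)"
  have p0: "p \<ge> 0" using p a mat_norm_nonneg[of W] by (simp add: zero_le_mult_iff)
  have "(2 * p)\<^sup>2 < m" using m(1) by (simp add: power_mult_distrib)
  then have s: "2 * p < sqrt m" by (rule real_less_rsqrt)
  have "m \<le> n\<^sup>2" using m(2) SO_mat_norm_diff_transpose_ge[OF R] by (simp add: n_def)
  then have n: "sqrt m \<le> n" by (intro real_le_lsqrt) (auto simp: n_def)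
  have "0 < sqrt m" "0 < sqrt m - 2 * p" using s p0 by linarith+
  then show "0 < sqrt m * (a * (sqrt m - 2 * p))" using a by (intro mult_pos_pos)
  have "sqrt m * (a * (sqrt m - 2 * p)) \<le> n * (a * (n - 2 * p))"
    using n s p0 a by (intro mult_mono) auto
  moreover have "n * (k * n) \<ge> n * (a * n)" using k by (intro mult_left_mono mult_right_mono) (auto simp: n_def)
  moreover have "n * (mat_norm W - k * n) = n * (a * (2 * p)) - n * (k * n)" unfolding p by (simp add: algebra_simps)
  moreover have "n * (a * (n - 2 * p)) = n * (a * n) - n * (a * (2 * p))" by (simp add: algebra_simps)
  ultimately have "n * (mat_norm W - k * n) \<le> - (sqrt m * (a * (sqrt m - 2 * p)))" by linarith
  with trace_winfree_term_bound[OF W R, of k] show "- trace (W ** R + k *\<^sub>R (mat 1 - R ** R)) \<le> - (sqrt m * (a * (sqrt m - 2 * p)))"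
    unfolding n_def by linarith
qed

text \<open>A half-turn in a coordinate plane. It serves to show that the Lipschitz constant is
  nonnegative.\<close>

lemma SO_nontrivial:
  assumes "2 \<le> CARD('n)"
  obtains X :: "real^'n^'n" where "X \<in> SO" "X \<noteq> mat 1"
proof -
  obtain i j :: 'n where ij: "i \<noteq> j"
    using assms by (metis card_2_iff' ex_card subset_UNIV)
  have on: "norm (axis i (1::real)) = 1" "norm (axis j (1::real)) = 1" "inner (axis i (1::real)) (axis j 1) = 0"
    using ij by (auto simp: inner_axis_axis)
  have "plane_rotation (axis i 1) (axis j 1) pi *v axis i 1 = - axis i 1"
    using on by (simp add: plane_rotation_mult_vector norm_eq_1 inner_commute scaleR_2[symmetric] del: inner_axis_axis)
      (simp add: vec_eq_iff)
  moreover have "axis i (1::real) \<noteq> - axis i 1" by (simp add: vec_eq_iff axis_def)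
  ultimately have "plane_rotation (axis i 1) (axis j 1) pi \<noteq> mat 1" by auto
  with plane_rotation_in_SO[OF on] show thesis using that by blast
qed

text \<open>All rests on \<open>\<beta>\<close> lying in the closure of the set where
  \<open>f\<close> is nonzero. For \<open>n < 2\<close> that set lies in {0}, and a zero at some
  \<open>r < \<beta>\<close> would by monotonicity confine it to \<open>{..r}\<close>.\<close>

lemma influence_profileD:
  assumes prof: "influence_profile n \<beta> f" and \<beta>: "0 < \<beta>"
  shows "2 \<le> n" "\<And>r. 0 \<le> r \<Longrightarrow> r \<le> real (n div 2) * pi \<Longrightarrow> 0 \<le> f r"
    "\<And>r s. 0 \<le> r \<Longrightarrow> r \<le> s \<Longrightarrow> s \<le> real (n div 2) * pi \<Longrightarrow> f s \<le> f r"
    "\<exists>L. L-lipschitz_on {0..real (n div 2) * pi} f"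
    "\<And>r. 0 \<le> r \<Longrightarrow> r \<le> real (n div 2) * pi \<Longrightarrow> r < \<beta> \<Longrightarrow> 0 < f r"
proof -
  define D where "D = {0..real (n div 2) * pi}"
  have D: "\<And>r. r \<in> D \<Longrightarrow> 0 \<le> f r" "antimono_on D f" "\<exists>L. L-lipschitz_on D f" "closure {r\<in>D. f r \<noteq> 0} = {0..\<beta>}"
    using prof unfolding influence_profile_def Let_def D_def by auto
  show f0: "0 \<le> f r" if "0 \<le> r" "r \<le> real (n div 2) * pi" for r using D(1)[of r] that by (simp add: D_def)
  show mono: "f s \<le> f r" if "0 \<le> r" "r \<le> s" "s \<le> real (n div 2) * pi" for r s
    using D(2) that by (auto simp: monotone_on_def D_def)
  show "\<exists>L. L-lipschitz_on {0..real (n div 2) * pi} f" using D(3) by (simp add: D_def)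
  have \<beta>in: "\<beta> \<in> closure {r\<in>D. f r \<noteq> 0}" using D(4) \<beta> by simp
  show "2 \<le> n"
  proof (rule ccontr)
    assume "\<not> 2 \<le> n"
    then have "D \<subseteq> {0}" by (auto simp: D_def)
    then have "{r\<in>D. f r \<noteq> 0} \<subseteq> {0}" by auto
    then have "closure {r\<in>D. f r \<noteq> 0} \<subseteq> {0}" by (rule closure_minimal) simp
    with \<beta>in \<beta> show False by auto
  qed
  show "0 < f r" if r: "0 \<le> r" "r \<le> real (n div 2) * pi" "r < \<beta>" for r
  proof (rule ccontr)
    assume "\<not> 0 < f r"
    then have "f r = 0" using f0[of r] r by simp
    then have "f s = 0" if "s \<in> D" "r \<le> s" for s
      using f0[of s] mono[of r s] r that by (simp add: D_def)
    then have "{r\<in>D. f r \<noteq> 0} \<subseteq> {..r}" using linorder_le_cases by blast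
    then have "closure {r\<in>D. f r \<noteq> 0} \<subseteq> {..r}" by (rule closure_minimal) simp
    with \<beta>in r show False by auto
  qed
qed

theorem theorem4p1:
  fixes \<Omega> R0 :: "real^'n^'n^'k"
    and R :: "real \<Rightarrow> real^'n^'n^'k"
    and Itilde :: "real \<Rightarrow> real"
    and I :: "real^'n^'n \<Rightarrow> real"
    and \<kappa> \<beta> \<gamma>\<^sub>0 \<gamma> lam :: real
    and \<Gamma> :: "'k \<Rightarrow> real"
    and i_star :: 'k
  assumes skew: "\<forall>i. skew_symmetric (\<Omega> $ i)"
    and kappa_pos: "\<kappa> > 0"
    and profile: "influence_profile CARD('n) \<beta> Itilde"
    and I_def: "I = influence Itilde"
    and beta: "0 < \<beta>" "\<beta> < pi / 2"
    and gamma0: "0 < \<gamma>\<^sub>0" "\<gamma>\<^sub>0 < 2 * sin (\<beta> / 2)"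
    and gamma: "\<gamma> = 2 * arcsin (\<gamma>\<^sub>0 / 2)" "\<gamma> < \<beta>"
    and Gamma_def: "\<Gamma> = (\<lambda>i. sqrt (2 + 2 * sqrt (1 -
           (real CARD('k))\<^sup>2 * (mat_norm (\<Omega> $ i))\<^sup>2 / (\<kappa>\<^sup>2 * (Itilde \<gamma>)\<^sup>2))))"
    and R0_SO: "\<forall>i. R0 $ i \<in> SO"
    and R0_star: "R0 $ i_star \<in> SO_ball \<gamma>\<^sub>0"
    and R0_ball: "\<forall>i. R0 $ i \<in> SO_ball (\<Gamma> i)"
    and lam_def: "lam = \<kappa> * (cos \<gamma> * Itilde \<gamma> - \<gamma> * Lip_star I)"
    and lam_pos: "lam > 0"
    and kappa_c: "\<kappa> > real CARD('k) * (MAX j. mat_norm (\<Omega> $ j)) /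
                        (sin (2 * sin (\<gamma> / 2)) * Itilde \<gamma>)"
    and solution: "winfree_solution I \<kappa> \<Omega> R0 R"
  shows "(\<exists>!Rinf. winfree_equilibrium I \<kappa> \<Omega> Rinf \<and> (\<forall>i. Rinf $ i \<in> SO_ball \<gamma>)) \<and>
         (\<forall>Rinf. winfree_equilibrium I \<kappa> \<Omega> Rinf \<and> (\<forall>i. Rinf $ i \<in> SO_ball \<gamma>) \<longrightarrow>
           (\<exists>C. \<forall>\<^sub>F t in at_top. l1_norm (R t - Rinf) \<le> C * exp (- lam * t)))"
proof -

  \<comment> \<open>Constants and half-angle relations\<close>
  define f where "f = Itilde"
  define N where "N = real CARD('k)"
  define q where "q = f \<gamma>"
  define K where "K = Lip_star I"
  \<comment> \<open>The level of the squared chord that bounds the chordal ball of radius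
    \<open>\<gamma>\<^sub>0\<close>.\<close>
  define \<alpha> where "\<alpha> = \<gamma>\<^sub>0\<^sup>2"
  define M where "M = real (CARD('n) div 2) * pi"
  have N: "N > 0" by (simp add: N_def)
  note prof = influence_profileD[OF profile beta(1), folded f_def M_def]
  have W: "transpose (\<Omega> $ i) = - \<Omega> $ i" for i using skew by (simp add: skew_symmetric_def)
  have M: "pi \<le> M" using prof(1) mult_right_mono[of 1 "real (CARD('n) div 2)" pi] by (simp add: M_def)

  have "sin (\<beta> / 2) < 1" using sin_monotone_2pi[of "\<beta> / 2" "pi / 2"] beta by simp
  then have g2: "\<gamma>\<^sub>0 < 2" using gamma0 by simp
  have sg: "sin (\<gamma> / 2) = \<gamma>\<^sub>0 / 2" using gamma(1) gamma0 g2 by simp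
  have "0 < arcsin (\<gamma>\<^sub>0 / 2)" using arcsin_less_arcsin[of 0 "\<gamma>\<^sub>0 / 2"] gamma0 g2 by simp
  then have \<gamma>: "0 < \<gamma>" "\<gamma> < pi / 2" using gamma beta by auto
  have cos\<gamma>: "cos \<gamma> = 1 - \<alpha> / 2"
    using cos_double_sin[of "\<gamma> / 2"] sg by (simp add: \<alpha>_def power_divide)
  have cos0: "cos \<gamma> > 0" using \<gamma> by (intro cos_gt_zero_pi) auto
  have \<gamma>0\<gamma>: "\<gamma>\<^sub>0 \<le> \<gamma>" using sin_x_le_x[of "\<gamma> / 2"] sg \<gamma> by simp
  have \<alpha>: "0 < \<alpha>" "\<alpha> < 2" using gamma0 cos0 cos\<gamma> by (auto simp: \<alpha>_def)
  \<comment> \<open>Turns the threshold \<open>4 p^2 < \<alpha> (4 - \<alpha>)\<close> into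
    \<open>p < sin \<gamma>\<close> for nonnegative \<open>p\<close>.\<close>
  have sin\<gamma>: "\<alpha> * (4 - \<alpha>) = 4 * (sin \<gamma>)\<^sup>2"
  proof -
    have "(sin \<gamma>)\<^sup>2 = 1 - (1 - \<alpha> / 2)\<^sup>2" using sin_squared_eq[of \<gamma>] cos\<gamma> by simp
    then show ?thesis by (simp add: power2_eq_square algebra_simps)
  qed
  have \<gamma>pi: "\<gamma> \<le> pi" using \<gamma> by linarith
  then have \<gamma>M: "\<gamma> \<le> M" using M by linarith
  have q: "q > 0" unfolding q_def using \<gamma> \<gamma>M gamma(2) by (intro prof) auto

  \<comment> \<open>Frequencies relative to the coupling\<close>
  define p where "p i = N * mat_norm (\<Omega> $ i) / (\<kappa> * q)" for i
  \<comment> \<open>The coupling coefficient that remains when only \<open>i_star\<close>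
    contributes, with influence \<open>q\<close>. The square of \<open>p i\<close> is the term
    subtracted under the inner root of \<open>\<Gamma> i\<close>.\<close>
  define a where "a = \<kappa> * q / (2 * N)"
  have a: "a > 0" using kappa_pos q N by (simp add: a_def)
  have pW: "mat_norm (\<Omega> $ i) = 2 * a * p i" for i using kappa_pos q N by (simp add: a_def p_def)
  have p: "0 \<le> p i" "p i < sin \<gamma>" for i
  proof -
    show "0 \<le> p i" using kappa_pos q N by (simp add: p_def)
    \<comment> \<open>As \<open>2 sin (\<gamma> / 2)\<close> is \<open>\<gamma>\<^sub>0\<close>, the
      critical coupling bounds \<open>p i\<close> by \<open>sin \<gamma>\<^sub>0\<close>, which is
      at most \<open>sin \<gamma>\<close>.\<close>
    have s0: "sin \<gamma>\<^sub>0 > 0" using gamma0 g2 pi_gt3 by (intro sin_gt_zero) auto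
    have "mat_norm (\<Omega> $ i) \<le> (MAX j. mat_norm (\<Omega> $ j))" by (rule Max_ge) auto
    then have "N * mat_norm (\<Omega> $ i) \<le> N * (MAX j. mat_norm (\<Omega> $ j))" using N by simp
    also have "\<dots> < \<kappa> * (sin \<gamma>\<^sub>0 * q)"
      using kappa_c s0 q unfolding sg f_def[symmetric] q_def[symmetric] N_def[symmetric] by (simp add: pos_divide_less_eq)
    also have "\<dots> = (\<kappa> * q) * sin \<gamma>\<^sub>0" by simp
    finally have "p i < sin \<gamma>\<^sub>0" using kappa_pos q by (simp add: p_def pos_divide_less_eq mult_ac)
    also have "\<dots> \<le> sin \<gamma>" using \<gamma>0\<gamma> \<gamma> gamma0 by (intro sin_monotone_2pi_le) auto
    finally show "p i < sin \<gamma>" .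
  qed
  have p1: "(p i)\<^sup>2 \<le> 1" for i
  proof -
    have "p i \<le> 1" using p(2)[of i] sin_le_one[of \<gamma>] by linarith
    then show ?thesis using p(1)[of i] by (intro power_le_one)
  qed
  have p\<alpha>: "4 * (p i)\<^sup>2 < \<alpha> * (4 - \<alpha>)" for i
    unfolding sin\<gamma> using p[of i] by (simp add: power_strict_mono)
  have \<Gamma>2: "(\<Gamma> i)\<^sup>2 = 2 + 2 * sqrt (1 - (p i)\<^sup>2)" "\<Gamma> i \<ge> 0" for i
  proof -
    have "N\<^sup>2 * (mat_norm (\<Omega> $ i))\<^sup>2 / (\<kappa>\<^sup>2 * q\<^sup>2) = (p i)\<^sup>2"
      by (simp add: p_def power_divide power_mult_distrib)
    then have "\<Gamma> i = sqrt (2 + 2 * sqrt (1 - (p i)\<^sup>2))"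
      unfolding Gamma_def f_def[symmetric] q_def[symmetric] N_def[symmetric] by simp
    moreover have "0 \<le> 2 + 2 * sqrt (1 - (p i)\<^sup>2)" using p1[of i] by (intro add_nonneg_nonneg mult_nonneg_nonneg real_sqrt_ge_zero) auto
    ultimately show "(\<Gamma> i)\<^sup>2 = 2 + 2 * sqrt (1 - (p i)\<^sup>2)" "\<Gamma> i \<ge> 0" by simp_all
  qed

  \<comment> \<open>Lipschitz constant and contraction region\<close>
  obtain L where L: "L-lipschitz_on {0..M} f" using prof(4) by blast
  have Lip: "\<bar>I A - I B\<bar> \<le> K * mat_norm (A - B)" if "A \<in> SO" "B \<in> SO" for A B
    unfolding K_def I_def f_def[symmetric] by (rule influence_Lip_star[OF L[unfolded M_def] that])
  have K: "K \<ge> 0"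
  proof -
    obtain X :: "real^'n^'n" where X: "X \<in> SO" "X \<noteq> mat 1" using SO_nontrivial[OF prof(1)] by blast
    have "0 \<le> K * mat_norm (X - mat 1)" using Lip[OF X(1) SO_one] by (meson abs_ge_zero order_trans)
    moreover have "0 < mat_norm (X - mat 1)" using X(2) by simp
    ultimately show ?thesis using mult_neg_pos[of K "mat_norm (X - mat 1)"] by linarith
  qed
  interpret winfree_contraction I \<kappa> "cos \<gamma>" q \<gamma> K lam \<Omega>
    using skew kappa_pos cos0 q \<gamma> K Lip lam_def lam_pos
    by unfold_locales (auto simp: f_def q_def K_def)

  have I0: "0 \<le> I X" if "X \<in> SO" for X
    unfolding I_def influence_def f_def[symmetric] M_def[symmetric]
    using SO_dist_nonneg[OF SO_one that] SO_dist_le_diameter[OF SO_one that] by (intro prof(2)) (auto simp: M_def)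
  have Iq: "q \<le> I X" if "X \<in> SO" "SO_dist (mat 1) X \<le> \<gamma>" for X
    unfolding I_def influence_def f_def[symmetric] q_def
    using SO_dist_nonneg[OF SO_one that(1)] that(2) \<gamma>M by (intro prof(3)) auto
  \<comment> \<open>\<open>\<gamma> = 2 arcsin (\<gamma>\<^sub>0 / 2)\<close> is precisely the
    distance bound that belongs to the chord \<open>\<gamma>\<^sub>0\<close>.\<close>
  have dist_chord: "SO_dist (mat 1) X \<le> \<gamma>" if "X \<in> SO" "mat_norm (mat 1 - X) \<le> \<gamma>\<^sub>0" for X
  proof -
    have "SO_dist (mat 1) X \<le> 2 * arcsin (mat_norm (mat 1 - X) / 2)"
      using SO_dist_le_arcsin[OF SO_one that(1)] that(2) g2 by simp
    also have "\<dots> \<le> \<gamma>"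
    proof -
      have "arcsin (mat_norm (mat 1 - X) / 2) \<le> arcsin (\<gamma>\<^sub>0 / 2)"
        by (rule arcsin_le_arcsin) (use that(2) g2 mat_norm_nonneg[of "mat 1 - X"] in linarith)+
      then show ?thesis using gamma(1) by linarith
    qed
    finally show ?thesis .
  qed
  have chord_of_sq: "mat_norm (mat 1 - X) \<le> \<gamma>\<^sub>0" if "(mat_norm (mat 1 - X))\<^sup>2 \<le> \<alpha>" for X :: "real^'n^'n"
    by (rule power2_le_imp_le) (use that gamma0(1) in \<open>auto simp: \<alpha>_def\<close>)
  have regionA: "X \<in> contraction_region I (cos \<gamma>) q \<gamma>" if "X \<in> SO" "(mat_norm (mat 1 - X))\<^sup>2 \<le> \<alpha>" for X
    unfolding contraction_region_def cos\<gamma>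
    using SO_inner_ge_of_chord[OF that] Iq[OF that(1) dist_chord[OF that(1) chord_of_sq[OF that(2)]]]
      chord_of_sq[OF that(2)] \<gamma>0\<gamma> that(1) by auto
  have regionB: "X \<in> contraction_region I (cos \<gamma>) q \<gamma>" if "X \<in> SO_ball \<gamma>" for X
  proof -
    have X: "X \<in> SO" "SO_dist (mat 1) X < \<gamma>" using that by (auto simp: SO_ball_def)
    then show ?thesis
      unfolding contraction_region_def
      using SO_inner_ge_of_dist[OF X \<gamma>pi] Iq[OF X(1)] SO_dist_ge_chord[OF SO_one X(1)] \<gamma> by auto
  qed

  \<comment> \<open>Squared chords along the solution\<close>
  define k where "k Z = \<kappa> / 2 * (1 / N * (\<Sum>j\<in>UNIV. I (Z $ j)))" for Z :: "real^'n^'n^'k"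
  have field: "winfree_field I \<kappa> \<Omega> Z $ i = \<Omega> $ i ** Z $ i + k Z *\<^sub>R (mat 1 - Z $ i ** Z $ i)" for Z i
    by (simp add: winfree_field_nth k_def N_def)
  \<comment> \<open>All influences are nonnegative, so keeping only the summand of
    \<open>i_star\<close> gives a lower bound.\<close>
  have ka: "a \<le> k Z" if "\<And>j. Z $ j \<in> SO" "(mat_norm (mat 1 - Z $ i_star))\<^sup>2 \<le> \<alpha>" for Z
  proof -
    have "q \<le> I (Z $ i_star)" using regionA[OF that] by (simp add: contraction_region_def)
    also have "\<dots> \<le> (\<Sum>j\<in>UNIV. I (Z $ j))" using I0 that(1) by (intro member_le_sum) auto
    finally have "\<kappa> / 2 * (1 / N * q) \<le> k Z" unfolding k_def using kappa_pos N by (intro mult_left_mono) auto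
    then show ?thesis by (simp add: a_def field_simps)
  qed

  have R0: "R 0 = R0" and Rc: "continuous_on {0..} R" and RSO: "\<And>t i. t \<ge> 0 \<Longrightarrow> R t $ i \<in> SO"
    and Rd: "\<And>t. t > 0 \<Longrightarrow> (R has_vector_derivative winfree_field I \<kappa> \<Omega> (R t)) (at t)"
    using solution by (auto simp: winfree_solution_def)
  define \<rho> where "\<rho> i t = real CARD('n) - trace (R t $ i)" for i t
  define \<rho>' where "\<rho>' i t = - trace (winfree_field I \<kappa> \<Omega> (R t) $ i)" for i t
  have \<rho>: "\<rho> i t = (mat_norm (mat 1 - R t $ i))\<^sup>2" if "t \<ge> 0" for i t
    using SO_mat_norm_power2_trace[OF RSO[OF that]] by (simp add: \<rho>_def)
  have \<rho>d: "(\<rho> i has_real_derivative \<rho>' i t) (at t)" if "t > 0" for i t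
    unfolding \<rho>_def \<rho>'_def has_real_derivative_iff_has_vector_derivative
    using has_vector_derivative_diff[OF has_vector_derivative_const[of "real CARD('n)"]
      bounded_linear.has_vector_derivative[OF bounded_linear_trace
      bounded_linear.has_vector_derivative[OF bounded_linear_vec_nth Rd[OF that], of i]]] by simp
  have \<rho>c: "continuous_on {0..} (\<rho> i)" for i
    unfolding \<rho>_def
    by (intro continuous_intros bounded_linear.continuous_on[OF bounded_linear_trace] Rc)
  have drop: "\<rho>' i t \<le> - (sqrt m * (a * (sqrt m - 2 * p i)))" "0 < sqrt m * (a * (sqrt m - 2 * p i))"
    if "t > 0" "\<rho> i_star t \<le> \<alpha>" "4 * (p i)\<^sup>2 < m" "m \<le> \<rho> i t * (4 - \<rho> i t)" for i t m
  proof -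
    have t: "t \<ge> 0" using that(1) by simp
    have "a \<le> k (R t)" using that(2) \<rho>[OF t] by (intro ka RSO[OF t]) auto
    from trace_winfree_term_le[OF W RSO[OF t] this a pW that(3) that(4)[unfolded \<rho>[OF t]]]
    show "\<rho>' i t \<le> - (sqrt m * (a * (sqrt m - 2 * p i)))" "0 < sqrt m * (a * (sqrt m - 2 * p i))"
      unfolding \<rho>'_def field by auto
  qed

  \<comment> \<open>Confinement and entrance into the chordal ball\<close>
  have "\<exists>m. \<alpha> \<le> m \<and> \<rho> i 0 < m \<and> m < (\<Gamma> i)\<^sup>2 \<and> (i = i_star \<longrightarrow> m = \<alpha>)" for i
  proof -
    have \<alpha>\<Gamma>: "\<alpha> < (\<Gamma> i)\<^sup>2" unfolding \<Gamma>2 using \<alpha> p1[of i] by (intro order_less_le_trans[OF \<alpha>(2)]) auto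
    have c: "mat_norm (mat 1 - R0 $ i) < r" if "R0 $ i \<in> SO_ball r" for r
      using SO_dist_ge_chord[OF SO_one, of "R0 $ i"] that by (auto simp: SO_ball_def)
    show ?thesis
    proof (cases "i = i_star")
      case True
      have "(mat_norm (mat 1 - R0 $ i))\<^sup>2 < \<gamma>\<^sub>0\<^sup>2"
        using c R0_star True by (intro power_strict_mono) auto
      then show ?thesis using \<alpha>\<Gamma> \<rho>[of 0 i] R0 by (intro exI[of _ \<alpha>]) (auto simp: \<alpha>_def)
    next
      case False
      have "(mat_norm (mat 1 - R0 $ i))\<^sup>2 < (\<Gamma> i)\<^sup>2"
        using c R0_ball by (intro power_strict_mono) auto
      then have "max \<alpha> (\<rho> i 0) < (\<Gamma> i)\<^sup>2" using \<alpha>\<Gamma> \<rho>[of 0 i] R0 by auto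
      then obtain m where "max \<alpha> (\<rho> i 0) < m" "m < (\<Gamma> i)\<^sup>2" using dense by blast
      then show ?thesis using False by (intro exI[of _ m]) auto
    qed
  qed
  \<comment> \<open>Barrier levels above the initial values and below \<open>(\<Gamma> i)^2\<close>.
    For \<open>i_star\<close> the level is exactly \<open>\<alpha>\<close>, which keeps its
    influence at least \<open>q\<close>.\<close>
  then obtain m where m: "\<And>i. \<alpha> \<le> m i" "\<And>i. \<rho> i 0 < m i" "\<And>i. m i < (\<Gamma> i)\<^sup>2" "m i_star = \<alpha>" by metis
  have mp: "4 * (p i)\<^sup>2 < m i * (4 - m i)" for i
    using quadratic_gt_of_between[OF m(1)[of i] _ p1[of i] p\<alpha>] m(3)[of i] unfolding \<Gamma>2 by simp

  \<comment> \<open>The components are treated together, because the decrease of each relies on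
    \<open>i_star\<close> staying at or below \<open>\<alpha>\<close>.\<close>
  have below: "\<rho> i t < m i" if "t \<ge> 0" for i t
  proof -
    have "\<rho> i t - m i < 0"
    proof (rule barrier[where a=0 and f="\<lambda>i t. \<rho> i t - m i", OF _ _ _ that])
      show "continuous_on {0..} (\<lambda>t. \<rho> i t - m i)" for i by (intro continuous_intros \<rho>c)
      show "\<rho> i 0 - m i < 0" for i using m(2) by simp
      fix i t assume t: "t > (0::real)" "\<And>j. \<rho> j t - m j \<le> 0" "\<rho> i t - m i = 0"
      have "\<rho> i_star t \<le> \<alpha>" using t(2)[of i_star] m(4) by simp
      from drop[OF t(1) this mp[of i]] have "\<rho>' i t < 0" using t(3) by force
      then show "\<exists>D<0. ((\<lambda>t. \<rho> i t - m i) has_real_derivative D) (at t)"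
        using DERIV_diff[OF \<rho>d[OF t(1), of i] DERIV_const[of "m i"]] by auto
    qed
    then show ?thesis by simp
  qed
  have star: "\<rho> i_star t \<le> \<alpha>" if "t \<ge> 0" for t using below[OF that, of i_star] m(4) by simp

  have "\<exists>s\<ge>0. \<rho> i s < \<alpha>" for i
  proof -
    \<comment> \<open>A lower bound of \<open>x (4 - x)\<close> between \<open>\<alpha>\<close> and
      \<open>m i\<close>; it yields the uniform rate of descent \<open>\<delta>\<close>.\<close>
    define b where "b = min (\<alpha> * (4 - \<alpha>)) (m i * (4 - m i))"
    have b: "4 * (p i)\<^sup>2 < b" using p\<alpha> mp by (simp add: b_def)
    define \<delta> where "\<delta> = sqrt b * (a * (sqrt b - 2 * p i))"
    have le: "b \<le> \<rho> i t * (4 - \<rho> i t)" if "t > 0" "\<alpha> \<le> \<rho> i t" for t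
      unfolding b_def using that below[of t i] by (intro quadratic_ge_min) auto
    have "0 < \<delta>" unfolding \<delta>_def
    proof -
      have "2 * p i < sqrt b" using b by (intro real_less_rsqrt) (simp add: power_mult_distrib)
      then have "0 < sqrt b" "0 < sqrt b - 2 * p i" using p(1)[of i] by linarith+
      then show "0 < sqrt b * (a * (sqrt b - 2 * p i))" using a by (intro mult_pos_pos)
    qed
    then obtain s where "s \<ge> 0" "\<rho> i s < \<alpha>"
      by (rule decreasing_reaches_level[OF \<rho>c[of i] _ \<rho>d, of \<delta> \<alpha>])
        (use drop(1)[OF _ star b le] in \<open>auto simp: \<delta>_def\<close>)
    then show ?thesis by blast
  qed
  then obtain s where s: "\<And>i. s i \<ge> 0" "\<And>i. \<rho> i (s i) < \<alpha>" by metis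
  \<comment> \<open>The barrier argument again, now with a one-element index type, since
    \<open>i_star\<close> is already confined.\<close>
  have stay: "\<rho> i t < \<alpha>" if "t \<ge> s i" for i t
  proof -
    have "\<rho> i t - \<alpha> < 0"
    proof (rule barrier[where a="s i" and f="\<lambda>(_::unit) t. \<rho> i t - \<alpha>", OF _ _ _ that])
      show "continuous_on {s i..} (\<lambda>t. \<rho> i t - \<alpha>)"
        using s(1)[of i] by (intro continuous_intros continuous_on_subset[OF \<rho>c]) auto
      show "\<rho> i (s i) - \<alpha> < 0" using s(2) by simp
      fix t assume t: "t > s i" "\<rho> i t - \<alpha> = 0"
      have t0: "t > 0" using t(1) s(1)[of i] by simp
      have "\<rho>' i t < 0" using drop[OF t0 star[OF less_imp_le[OF t0]] p\<alpha>, of i] t(2) by force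
      then show "\<exists>D<0. ((\<lambda>t. \<rho> i t - \<alpha>) has_real_derivative D) (at t)"
        using DERIV_diff[OF \<rho>d[OF t0, of i] DERIV_const[of \<alpha>]] by auto
    qed
    then show ?thesis by simp
  qed
  define T where "T = (MAX i. s i)"
  have T: "s i \<le> T" for i unfolding T_def by (rule Max_ge) auto
  have T0: "0 \<le> T" using T[of undefined] s(1)[of undefined] by simp
  have Rregion: "R t $ i \<in> contraction_region I (cos \<gamma>) q \<gamma>" if "t \<ge> T" for t i
    using stay[of i t] T[of i] that T0 \<rho>[of t i] by (intro regionA RSO) auto
  have RcT: "continuous_on {T..} R" using T0 by (intro continuous_on_subset[OF Rc]) auto
  have RdT: "(R has_vector_derivative winfree_field I \<kappa> \<Omega> (R t)) (at t)" if "t > T" for t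
    using Rd that T0 by simp

  \<comment> \<open>Exponential attraction by equilibria\<close>
  have attract: "l1_norm (R t - E) \<le> (exp (lam * T) * l1_norm (R T - E)) * exp (- lam * t)"
    if E: "winfree_equilibrium I \<kappa> \<Omega> E" "\<And>i. E $ i \<in> SO_ball \<gamma>" and t: "t \<ge> T" for E t
  proof -
    have "l1_norm (R t - E) \<le> exp (- lam * (t - T)) * l1_norm (R T - E)"
    proof (rule contraction[of T R "\<lambda>_. E", OF RcT _ RdT _ Rregion _ t])
      show "((\<lambda>_. E) has_vector_derivative winfree_field I \<kappa> \<Omega> E) (at t)" for t
        using E(1) by (simp add: winfree_equilibrium_def)
    qed (use E(2) regionB in auto)
    also have "exp (- lam * (t - T)) = exp (lam * T) * exp (- lam * t)"
      by (simp add: algebra_simps flip: exp_add)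
    finally show ?thesis by (simp add: mult_ac)
  qed

  \<comment> \<open>The limit as the unique equilibrium in the ball\<close>
  obtain E where E: "(R \<longlongrightarrow> E) at_top" "winfree_equilibrium I \<kappa> \<Omega> E"
    using convergence_to_equilibrium[OF RcT RdT Rregion] by blast
  have ESO: "E $ i \<in> SO" for i using E(2) by (simp add: winfree_equilibrium_def)
  have Ele: "(mat_norm (mat 1 - E $ i))\<^sup>2 \<le> \<alpha>" for i
  proof (rule tendsto_upperbound)
    show "((\<lambda>t. (mat_norm (mat 1 - R t $ i))\<^sup>2) \<longlongrightarrow> (mat_norm (mat 1 - E $ i))\<^sup>2) at_top"
      unfolding mat_norm_power2 by (intro tendsto_intros E) simp
    show "\<forall>\<^sub>F t in at_top. (mat_norm (mat 1 - R t $ i))\<^sup>2 \<le> \<alpha>"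
      using eventually_ge_at_top[of T] by eventually_elim (use stay T T0 \<rho> in \<open>smt (verit)\<close>)
  qed simp
  \<comment> \<open>The limit inherits only the bound \<open>\<le> \<alpha>\<close>. On the boundary
    the trace of the field would be positive, which an equilibrium excludes; so the chord is below
    \<open>\<gamma>\<^sub>0\<close> and the distance below \<open>\<gamma>\<close>.\<close>
  have Eball: "E $ i \<in> SO_ball \<gamma>" for i
  proof -
    define r where "r = (mat_norm (mat 1 - E $ i))\<^sup>2"
    have "r \<noteq> \<alpha>"
    proof
      assume "r = \<alpha>"
      then have "\<alpha> * (4 - \<alpha>) \<le> (mat_norm (mat 1 - E $ i))\<^sup>2 * (4 - (mat_norm (mat 1 - E $ i))\<^sup>2)" by (simp add: r_def)
      from trace_winfree_term_le[OF W ESO ka[OF ESO Ele] a pW p\<alpha>[of i] this]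
      have "- trace (winfree_field I \<kappa> \<Omega> E $ i) < 0" unfolding field by linarith
      then show False using E(2) by (simp add: winfree_equilibrium_def trace_def)
    qed
    then have "(mat_norm (mat 1 - E $ i))\<^sup>2 < \<gamma>\<^sub>0\<^sup>2" using Ele[of i] unfolding r_def \<alpha>_def by simp
    then have "mat_norm (mat 1 - E $ i) < \<gamma>\<^sub>0" using gamma0 by (simp add: power_less_imp_less_base)
    then have "2 * arcsin (mat_norm (mat 1 - E $ i) / 2) < \<gamma>"
    proof -
      note c = \<open>mat_norm (mat 1 - E $ i) < \<gamma>\<^sub>0\<close>
      have "arcsin (mat_norm (mat 1 - E $ i) / 2) < arcsin (\<gamma>\<^sub>0 / 2)"
        by (rule arcsin_less_arcsin) (use c g2 mat_norm_nonneg[of "mat 1 - E $ i"] in linarith)+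
      then show ?thesis using gamma(1) by linarith
    qed
    moreover have "SO_dist (mat 1) (E $ i) \<le> 2 * arcsin (mat_norm (mat 1 - E $ i) / 2)"
      using \<open>mat_norm (mat 1 - E $ i) < \<gamma>\<^sub>0\<close> g2 by (intro SO_dist_le_arcsin SO_one ESO) simp
    ultimately show ?thesis using ESO by (simp add: SO_ball_def)
  qed
  \<comment> \<open>Every equilibrium in the ball attracts the given solution, so uniqueness of
    limits makes it equal to \<open>E\<close>.\<close>
  have limit: "(R \<longlongrightarrow> E') at_top" if E': "winfree_equilibrium I \<kappa> \<Omega> E'" "\<And>i. E' $ i \<in> SO_ball \<gamma>" for E'
  proof (rule tendsto_dist_iff[THEN iffD2], rule Lim_null_comparison)
    show "\<forall>\<^sub>F t in at_top. norm (dist (R t) E') \<le> sqrt 2 * ((exp (lam * T) * l1_norm (R T - E')) * exp (- lam * t))"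
      using eventually_ge_at_top[of T]
    proof eventually_elim
      case (elim t)
      have "dist (R t) E' \<le> sqrt 2 * l1_norm (R t - E')" unfolding dist_norm by (rule norm_le_l1_norm)
      also have "\<dots> \<le> sqrt 2 * ((exp (lam * T) * l1_norm (R T - E')) * exp (- lam * t))"
        using attract[OF E' elim] by (intro mult_left_mono) auto
      finally show ?case by simp
    qed
    have "filterlim (\<lambda>t. - lam * t) at_bot at_top"
      by (rule filterlim_tendsto_neg_mult_at_bot[OF tendsto_const _ filterlim_ident]) (use lam_pos in simp)
    from filterlim_compose[OF exp_at_bot this]
    show "((\<lambda>t. sqrt 2 * ((exp (lam * T) * l1_norm (R T - E')) * exp (- lam * t))) \<longlongrightarrow> 0) at_top"
      by (intro tendsto_mult_right_zero)
  qed
  show ?thesis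
  proof (intro conjI allI impI ex1I[of _ E])
    show "winfree_equilibrium I \<kappa> \<Omega> E" "\<And>i. E $ i \<in> SO_ball \<gamma>" using E Eball by auto
    show "E' = E" if "winfree_equilibrium I \<kappa> \<Omega> E' \<and> (\<forall>i. E' $ i \<in> SO_ball \<gamma>)" for E'
      using tendsto_unique[OF _ limit E(1)] that by simp
    fix E' assume "winfree_equilibrium I \<kappa> \<Omega> E' \<and> (\<forall>i. E' $ i \<in> SO_ball \<gamma>)"
    then have "\<forall>t\<ge>T. l1_norm (R t - E') \<le> exp (lam * T) * l1_norm (R T - E') * exp (- lam * t)"
      using attract[of E'] by blast
    then show "\<exists>C. \<forall>\<^sub>F t in at_top. l1_norm (R t - E') \<le> C * exp (- lam * t)"
      unfolding eventually_at_top_linorder by blast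
  qed
qed

end
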